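(* Let $h\in\mathbb R[x_1,\ldots,x_n]$ be irreducible, homogeneous of degree $d$ and hyperbolic in direction $e\in\mathbb R^n$, and let $k=2(d-1)$. Let $F(h,e)$ be the set of all linear functionals $\varphi\colon\mathbb C\langle z\rangle_{2k}\to\mathbb C$ such that: $\varphi(1)=1$ and $\varphi(p^* )=\overline{\varphi(p)}$ for all $p\in\mathbb C\langle z\rangle_{2k}$; $\varphi(p^*p)\ge0$ for all $p\in\mathbb C\langle z\rangle_k$; and $\varphi(p\cdot h_{a,e}(a\bullet z)\cdot q)=0$ for all $a\in\mathbb R^n$ and all $p,q\in\mathbb C\langle z\rangle$ with $\deg(p\cdot h_{a,e}(a\bullet z)\cdot q)\le 2k$. (This set is a spectrahedron.) Then: (1) If $F(h,e)\neq\emptyset$, then $\Lambda_e(h)$ is spectrahedral, i.e. $\Lambda_e(h)=\{a\in\mathbb R^n: a_1M_1+\cdots+a_nM_n\succeq0\}$ for some hermitian matrices $M_1,\ldots,M_n$. (2) If $F(h,e)=\emptyset$, then $-1\in\Sigma^2\mathcal A_e(h)$, and in particular no power $h^r$ ($r\ge1$) admits a definite determinantal representation.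
   Context: $h$ is hyperbolic in direction $e$ if $h(e)\ne0$ and for every $a\in\mathbb R^n$ the polynomial $h_{a,e}(t):=h(a-te)$ has only real roots; $\Lambda_e(h)=\{a: h_{a,e}(t)\text{ has only nonnegative roots}\}$. Write $a\bullet z=a_1z_1+\cdots+a_nz_n$. $\mathbb C\langle z\rangle=\mathbb C\langle z_1,\ldots,z_n\rangle$ is the free noncommutative unital algebra with involution determined by $z_i^*=z_i$, and $\mathbb C\langle z\rangle_m$ is the subspace of noncommutative polynomials of degree at most $m$. $J_e(h)$ is the two-sided ideal generated by all $h_{a,e}(a\bullet z)$, $a\in\mathbb R^n$, together with $1-e\bullet z$; $\mathcal A_e(h)=\mathbb C\langle z\rangle/J_e(h)$ and $\Sigma^2\mathcal A_e(h)$ is the set of finite sums $\sum_i a_i^*a_i$ in $\mathcal A_e(h)$. A polynomial $g$ admits a definite determinantal representation if $g=\det(x_1M_1+\cdots+x_nM_n)$ for hermitian matrices $M_i$ with $e_1M_1+\cdots+e_nM_n$ strictly definite. *)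

theory Defs
  imports Complex_Main "HOL-Library.Poly_Mapping" "HOL-Computational_Algebra.Polynomial"
    "HOL-Computational_Algebra.Factorial_Ring" "Jordan_Normal_Form.Determinant"
begin

text \<open>Points of R^n are functions 'n => real with 'n a finite index type (n = CARD('n)).
  A polynomial in R[x_i : i in 'n] is a finitely supported map from monomials
  (exponent vectors 'n =>0 nat) to real coefficients; ring structure from Poly_Mapping.\<close>

type_synonym 'n mpoly = "('n \<Rightarrow>\<^sub>0 nat) \<Rightarrow>\<^sub>0 real"

definition mpeval :: "'n::finite mpoly \<Rightarrow> ('n \<Rightarrow> real) \<Rightarrow> real" where
  "mpeval h x = (\<Sum>m\<in>Poly_Mapping.keys h. Poly_Mapping.lookup h m * (\<Prod>i\<in>UNIV. x i ^ Poly_Mapping.lookup m i))"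

definition homogeneous_of_degree :: "'n::finite mpoly \<Rightarrow> nat \<Rightarrow> bool" where
  "homogeneous_of_degree h d \<longleftrightarrow> (\<forall>m\<in>Poly_Mapping.keys h. (\<Sum>i\<in>UNIV. Poly_Mapping.lookup m i) = d)"

text \<open>h_{a,e}(t) = h(a - t e), as a univariate real polynomial in t.\<close>
definition hae :: "'n::finite mpoly \<Rightarrow> ('n \<Rightarrow> real) \<Rightarrow> ('n \<Rightarrow> real) \<Rightarrow> real poly" where
  "hae h a e = (\<Sum>m\<in>Poly_Mapping.keys h. smult (Poly_Mapping.lookup h m) (\<Prod>i\<in>UNIV. [:a i, - e i:] ^ Poly_Mapping.lookup m i))"

definition hyperbolic :: "'n::finite mpoly \<Rightarrow> ('n \<Rightarrow> real) \<Rightarrow> bool" where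
  "hyperbolic h e \<longleftrightarrow> mpeval h e \<noteq> 0 \<and>
     (\<forall>a. \<forall>z::complex. poly (map_poly complex_of_real (hae h a e)) z = 0 \<longrightarrow> z \<in> \<real>)"

definition Lambda :: "'n::finite mpoly \<Rightarrow> ('n \<Rightarrow> real) \<Rightarrow> ('n \<Rightarrow> real) set" where
  "Lambda h e = {a. \<forall>z::complex. poly (map_poly complex_of_real (hae h a e)) z = 0 \<longrightarrow>
                      z \<in> \<real> \<and> Re z \<ge> 0}"

type_synonym 'n ncpoly = "'n list \<Rightarrow>\<^sub>0 complex"

definition nc_one :: "'n ncpoly" where
  "nc_one = Poly_Mapping.single [] 1"

definition nc_mult :: "'n ncpoly \<Rightarrow> 'n ncpoly \<Rightarrow> 'n ncpoly" where
  "nc_mult p q = (\<Sum>u\<in>Poly_Mapping.keys p. \<Sum>v\<in>Poly_Mapping.keys q. Poly_Mapping.single (u @ v) (Poly_Mapping.lookup p u * Poly_Mapping.lookup q v))"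

definition nc_scale :: "complex \<Rightarrow> 'n ncpoly \<Rightarrow> 'n ncpoly" where
  "nc_scale c p = Poly_Mapping.map (\<lambda>x. c * x) p"

definition nc_star :: "'n ncpoly \<Rightarrow> 'n ncpoly" where
  "nc_star p = (\<Sum>u\<in>Poly_Mapping.keys p. Poly_Mapping.single (rev u) (cnj (Poly_Mapping.lookup p u)))"

definition nc_deg :: "'n ncpoly \<Rightarrow> nat" where
  "nc_deg p = (if p = 0 then 0 else Max (length ` Poly_Mapping.keys p))"

definition nc_pow :: "'n ncpoly \<Rightarrow> nat \<Rightarrow> 'n ncpoly" where
  "nc_pow x j = ((nc_mult x) ^^ j) nc_one"

definition nc_lin :: "('n::finite \<Rightarrow> real) \<Rightarrow> 'n ncpoly" where
  "nc_lin a = (\<Sum>i\<in>UNIV. Poly_Mapping.single [i] (complex_of_real (a i)))"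

definition nc_subst :: "real poly \<Rightarrow> 'n ncpoly \<Rightarrow> 'n ncpoly" where
  "nc_subst g x = (\<Sum>j\<le>degree g. nc_scale (complex_of_real (coeff g j)) (nc_pow x j))"

definition hgen :: "'n::finite mpoly \<Rightarrow> ('n \<Rightarrow> real) \<Rightarrow> ('n \<Rightarrow> real) \<Rightarrow> 'n ncpoly" where
  "hgen h e a = nc_subst (hae h a e) (nc_lin a)"

inductive_set nc_ideal :: "'n ncpoly set \<Rightarrow> 'n ncpoly set" for G where
  zero: "0 \<in> nc_ideal G"
| gen: "g \<in> G \<Longrightarrow> nc_mult (nc_mult p g) q \<in> nc_ideal G"
| add: "x \<in> nc_ideal G \<Longrightarrow> y \<in> nc_ideal G \<Longrightarrow> x + y \<in> nc_ideal G"

definition J_ideal :: "'n::finite mpoly \<Rightarrow> ('n \<Rightarrow> real) \<Rightarrow> 'n ncpoly set" where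
  "J_ideal h e = nc_ideal ({hgen h e a | a. True} \<union> {nc_one - nc_lin e})"

text \<open>-1 \<in> \<Sigma>^2 A_e(h): the class of -1 equals a finite sum of hermitian squares of classes,
  i.e. -1 - \<Sum> s_i^* s_i \<in> J_e(h).\<close>
definition minus_one_in_sos :: "'n::finite mpoly \<Rightarrow> ('n \<Rightarrow> real) \<Rightarrow> bool" where
  "minus_one_in_sos h e \<longleftrightarrow>
     (\<exists>ss :: 'n ncpoly list. - nc_one - sum_list (map (\<lambda>s. nc_mult (nc_star s) s) ss) \<in> J_ideal h e)"

text \<open>The set F(h,e) of linear functionals on C<z>_{2k} (represented by functions that are
  required to be C-linear on the subspace of polynomials of degree \<le> 2k; values outside
  that subspace are irrelevant).\<close>
definition Fset :: "'n::finite mpoly \<Rightarrow> ('n \<Rightarrow> real) \<Rightarrow> nat \<Rightarrow> ('n ncpoly \<Rightarrow> complex) set" where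
  "Fset h e k = {\<phi>.
     (\<forall>p q. nc_deg p \<le> 2*k \<longrightarrow> nc_deg q \<le> 2*k \<longrightarrow> \<phi> (p + q) = \<phi> p + \<phi> q) \<and>
     (\<forall>c p. nc_deg p \<le> 2*k \<longrightarrow> \<phi> (nc_scale c p) = c * \<phi> p) \<and>
     \<phi> nc_one = 1 \<and>
     (\<forall>p. nc_deg p \<le> 2*k \<longrightarrow> \<phi> (nc_star p) = cnj (\<phi> p)) \<and>
     (\<forall>p. nc_deg p \<le> k \<longrightarrow> \<phi> (nc_mult (nc_star p) p) \<in> \<real> \<and> Re (\<phi> (nc_mult (nc_star p) p)) \<ge> 0) \<and>
     (\<forall>a p q. nc_deg (nc_mult (nc_mult p (hgen h e a)) q) \<le> 2*k \<longrightarrow>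
              \<phi> (nc_mult (nc_mult p (hgen h e a)) q) = 0)}"

definition hermitian_mat :: "nat \<Rightarrow> complex mat \<Rightarrow> bool" where
  "hermitian_mat m A \<longleftrightarrow> A \<in> carrier_mat m m \<and> (\<forall>i<m. \<forall>j<m. A $$ (j, i) = cnj (A $$ (i, j)))"

definition quad_form :: "nat \<Rightarrow> complex mat \<Rightarrow> (nat \<Rightarrow> complex) \<Rightarrow> complex" where
  "quad_form m A v = (\<Sum>i<m. \<Sum>j<m. cnj (v i) * A $$ (i, j) * v j)"

definition psd_mat :: "nat \<Rightarrow> complex mat \<Rightarrow> bool" where
  "psd_mat m A \<longleftrightarrow> hermitian_mat m A \<and> (\<forall>v. Re (quad_form m A v) \<ge> 0)"

definition pd_mat :: "nat \<Rightarrow> complex mat \<Rightarrow> bool" where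
  "pd_mat m A \<longleftrightarrow> hermitian_mat m A \<and> (\<forall>v. (\<exists>i<m. v i \<noteq> 0) \<longrightarrow> Re (quad_form m A v) > 0)"

definition lin_pencil :: "nat \<Rightarrow> ('n::finite \<Rightarrow> complex mat) \<Rightarrow> ('n \<Rightarrow> real) \<Rightarrow> complex mat" where
  "lin_pencil m M x = mat m m (\<lambda>(r, c). \<Sum>i\<in>UNIV. complex_of_real (x i) * M i $$ (r, c))"

definition spectrahedral :: "('n::finite \<Rightarrow> real) set \<Rightarrow> bool" where
  "spectrahedral S \<longleftrightarrow> (\<exists>m (M :: 'n \<Rightarrow> complex mat). (\<forall>i. hermitian_mat m (M i)) \<and>
        S = {a. psd_mat m (lin_pencil m M a)})"

text \<open>Definite determinantal representation g = det(x_1 M_1 + ... + x_n M_n) (equality of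
  polynomials, equivalently of polynomial functions on R^n), with e_1 M_1 + ... + e_n M_n
  strictly (positive or negative) definite.\<close>
definition definite_det_rep :: "'n::finite mpoly \<Rightarrow> ('n \<Rightarrow> real) \<Rightarrow> bool" where
  "definite_det_rep g e \<longleftrightarrow> (\<exists>m (M :: 'n \<Rightarrow> complex mat). (\<forall>i. hermitian_mat m (M i)) \<and>
        (pd_mat m (lin_pencil m M e) \<or> pd_mat m (- lin_pencil m M e)) \<and>
        (\<forall>x. complex_of_real (mpeval g x) = det (lin_pencil m M x)))"

end

theory Submission
  imports Defs "HOL-Computational_Algebra.Fundamental_Theorem_Algebra"
begin

text \<open>
  Given \<open>\<phi> \<in> F(h,e)\<close>, the points \<open>a\<close> at which \<open>p \<mapsto> \<phi>(p\<^sup>* (a \<bullet> z) p)\<close> is positive semidefinite on the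
  polynomials of degree at most \<open>d - 1\<close> form a spectrahedral cone. It contains \<open>\<Lambda>\<^sub>e(h)\<close>: if all roots
  of \<open>h\<^bsub>a,e\<^esub>\<close> are positive, then \<open>t\<close> is a square modulo \<open>h\<^bsub>a,e\<^esub>\<close>. If it were larger, then at all of its
  points outside \<open>\<Lambda>\<^sub>e(h)\<close>, which contain an open set, the moments \<open>\<phi>((a \<bullet> z)\<^sup>j)\<close> would have a singular
  \<open>d \<times> d\<close> Hankel matrix, so its determinant would vanish identically. The generic kernel of the
  Hankel form is then generated by a factor of \<open>h(x - t e)\<close> of degree strictly between \<open>0\<close> and \<open>d\<close> in
  \<open>t\<close>. Its values are almost integral over the polynomial ring, hence polynomial, and \<open>h\<close> would be
  reducible.

  If \<open>-1\<close> is not a sum of squares in \<open>\<A>\<^sub>e(h)\<close>, then, the generators being bounded, a maximal proper cone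
  containing the sums of squares yields a positive functional, whose restriction lies in \<open>F(h,e)\<close>. A
  definite determinantal representation of \<open>h\<^sup>r\<close> represents \<open>\<A>\<^sub>e(h)\<close> by matrices that are self-adjoint
  for the inner product \<open>e\<^sub>1 M\<^sub>1 + \<dots> + e\<^sub>n M\<^sub>n\<close>, and every vector state lies in \<open>F(h,e)\<close>.
\<close>

text \<open>The order k = 2 (d - 1) is fixed by two demands. A square root S of t modulo h_{a,e} has
  degree at most d - 1, and positivity is applied to S p, so test polynomials p of degree d - 1 cost
  degree 2 (d - 1). Conversely, a point b outside Lambda is detected by p = h_{b,e} divided by the
  linear factor of a negative root, again of degree d - 1. For d = 1 the bound 2 k is 0 and the
  functional does not see a . z at all; that degree is settled directly. The obstacle in the
  converse is that the factor F of h(x - t e) is found pointwise, only where the Hankel determinant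
  H of size r = deg F is nonzero, and could have denominators in x. Multiplying the Hankel form by
  (t - y)^j multiplies its determinant by the j-th power of the norm (-1)^r F(y), while the new
  determinant is again polynomial in x. So the single denominator H serves all powers of F(y), and
  complete integral closedness of the polynomial ring removes it. Topology is confined to lines: the
  open set is only met along rays, where a univariate polynomial with infinitely many zeros
  vanishes.\<close>

text \<open>With concatenation as addition, words are an exponent monoid, and finitely supported
  maps on them inherit the convolution product: \<open>ncpoly\<close> becomes the free algebra as a
  ring, and general ring facts apply to it.\<close>

instantiation list :: (type) monoid_add
begin
definition zero_list :: "'a list" where "zero_list = []"
definition plus_list :: "'a list \<Rightarrow> 'a list \<Rightarrow> 'a list" where "plus_list = (@)"
instance by standard (simp_all add: zero_list_def plus_list_def)
end

lemma poly_mapping_sum_single: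
  fixes p :: "'a \<Rightarrow>\<^sub>0 'b::comm_monoid_add"
  shows "p = (\<Sum>u\<in>Poly_Mapping.keys p. Poly_Mapping.single u (Poly_Mapping.lookup p u))"
proof (rule poly_mapping_eqI)
  fix k
  show "Poly_Mapping.lookup p k =
    Poly_Mapping.lookup (\<Sum>u\<in>Poly_Mapping.keys p. Poly_Mapping.single u (Poly_Mapping.lookup p u)) k"
    by (cases "k \<in> Poly_Mapping.keys p")
      (auto simp: lookup_sum lookup_single when_def not_in_keys_iff_lookup_eq_zero)
qed

lemma poly_mapping_add_induct [case_names zero single add]:
  fixes p :: "'a \<Rightarrow>\<^sub>0 'b::comm_monoid_add"
  assumes "P 0" "\<And>u c. P (Poly_Mapping.single u c)" "\<And>p q. P p \<Longrightarrow> P q \<Longrightarrow> P (p + q)"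
  shows "P p"
proof -
  have "P (\<Sum>u\<in>S. Poly_Mapping.single u (Poly_Mapping.lookup p u))" if "finite S" for S
    using that by induction (auto intro: assms)
  then show ?thesis
    using poly_mapping_sum_single[of p] by (metis finite_keys)
qed

section \<open>Linear extension of functions on monomials\<close>

text \<open>One construction with three uses: evaluation of commutative polynomials, functionals on
  the free algebra given by their values on words, and the action of the free algebra on
  vectors.\<close>

definition lin_ext :: "('a \<Rightarrow> 'b) \<Rightarrow> ('a \<Rightarrow>\<^sub>0 'b::comm_ring_1) \<Rightarrow> 'b" where
  "lin_ext c p = (\<Sum>u\<in>Poly_Mapping.keys p. Poly_Mapping.lookup p u * c u)"

lemma lin_ext_superset:
  assumes "finite S" "Poly_Mapping.keys p \<subseteq> S"
  shows "lin_ext c p = (\<Sum>u\<in>S. Poly_Mapping.lookup p u * c u)"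
  unfolding lin_ext_def
  by (rule sum.mono_neutral_left) (use assms in \<open>auto simp: in_keys_iff\<close>)

lemma lin_ext_zero [simp]: "lin_ext c 0 = 0"
  by (simp add: lin_ext_def)

lemma lin_ext_single [simp]: "lin_ext c (Poly_Mapping.single u x) = x * c u"
  by (subst lin_ext_superset[of "{u}"]) (auto simp: keys_single split: if_splits)

lemma lin_ext_add: "lin_ext c (p + q) = lin_ext c p + lin_ext c q"
proof -
  let ?S = "Poly_Mapping.keys p \<union> Poly_Mapping.keys q"
  have "lin_ext c (p + q) = (\<Sum>u\<in>?S. Poly_Mapping.lookup (p + q) u * c u)"
    by (rule lin_ext_superset) (auto dest: subsetD[OF Poly_Mapping.keys_add])
  also have "\<dots> = lin_ext c p + lin_ext c q"
    by (subst (1 2) lin_ext_superset[of ?S])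
      (auto simp: lookup_add ring_distribs sum.distrib)
  finally show ?thesis .
qed

lemma lin_ext_uminus: "lin_ext c (- p) = - lin_ext c p"
  by (metis add.right_inverse add_eq_0_iff lin_ext_add lin_ext_zero)

lemma lin_ext_diff: "lin_ext c (p - q) = lin_ext c p - lin_ext c q"
  by (metis diff_conv_add_uminus lin_ext_add lin_ext_uminus)

lemma lin_ext_sum: "lin_ext c (\<Sum>i\<in>I. f i) = (\<Sum>i\<in>I. lin_ext c (f i))"
  by (induction I rule: infinite_finite_induct) (auto simp: lin_ext_add)

lemma lin_ext_scale: "lin_ext c (Poly_Mapping.single 0 x * p) = x * lin_ext c p"
  by (induction p rule: poly_mapping_add_induct)
    (auto simp: lin_ext_add mult_single ring_distribs mult.assoc)

lemma lin_ext_mult: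
  assumes "\<And>u v. c (u + v) = c u * c v"
  shows "lin_ext c (p * q) = lin_ext c p * lin_ext c q"
proof (induction p rule: poly_mapping_add_induct)
  case (single u x)
  show ?case
    by (induction q rule: poly_mapping_add_induct)
      (auto simp: lin_ext_add mult_single ring_distribs assms mult_ac)
qed (auto simp: lin_ext_add ring_distribs)



section \<open>The free algebra as a ring\<close>

lemma nc_one_eq: "nc_one = 1"
  unfolding nc_one_def by (metis single_one zero_list_def)

lemma nc_mult_eq: "nc_mult p q = p * q"
proof -
  have "p * q = (\<Sum>u\<in>Poly_Mapping.keys p. Poly_Mapping.single u (Poly_Mapping.lookup p u)) *
     (\<Sum>v\<in>Poly_Mapping.keys q. Poly_Mapping.single v (Poly_Mapping.lookup q v))"
    using poly_mapping_sum_single[of p] poly_mapping_sum_single[of q] by simp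
  also have "\<dots> = nc_mult p q"
    by (simp add: nc_mult_def sum_product mult_single plus_list_def)
  finally show ?thesis ..
qed

abbreviation cst :: "complex \<Rightarrow> 'n ncpoly" where
  "cst c \<equiv> Poly_Mapping.single 0 c"

lemma nc_scale_eq: "nc_scale c p = cst c * p"
  by (simp add: nc_scale_def mult_map_scale_conv_mult)

lemma nc_pow_eq: "nc_pow x j = x ^ j"
  by (induction j) (auto simp: nc_pow_def nc_one_eq nc_mult_eq)

lemma cst_mult: "cst a * cst b = cst (a * b)"
  by (simp add: mult_single)

lemma cst_commute: "p * cst c = cst c * p"
  by (induction p rule: poly_mapping_add_induct) (auto simp: mult_single ring_distribs mult.commute)

lemma cst_left_commute: "p * (cst c * q) = cst c * (p * q)"
  by (metis cst_commute mult.assoc)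

lemma lookup_nc_star: "Poly_Mapping.lookup (nc_star p) w = cnj (Poly_Mapping.lookup p (rev w))"
proof -
  have "Poly_Mapping.lookup (nc_star p) w =
      (\<Sum>u\<in>Poly_Mapping.keys p. if u = rev w then cnj (Poly_Mapping.lookup p u) else 0)"
    unfolding nc_star_def lookup_sum
    by (rule sum.cong) (auto simp: lookup_single when_def rev_swap)
  also have "\<dots> = cnj (Poly_Mapping.lookup p (rev w))"
    by (simp add: not_in_keys_iff_lookup_eq_zero)
  finally show ?thesis .
qed

lemma nc_star_zero [simp]: "nc_star 0 = 0"
  by (rule poly_mapping_eqI) (simp add: lookup_nc_star)

lemma nc_star_add: "nc_star (p + q) = nc_star p + nc_star q"
  by (rule poly_mapping_eqI) (simp add: lookup_nc_star lookup_add)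

lemma nc_star_uminus: "nc_star (- p) = - nc_star p"
  by (rule poly_mapping_eqI) (simp add: lookup_nc_star)

lemma nc_star_diff: "nc_star (p - q) = nc_star p - nc_star q"
  by (metis diff_conv_add_uminus nc_star_add nc_star_uminus)

lemma nc_star_star [simp]: "nc_star (nc_star p) = p"
  by (rule poly_mapping_eqI) (simp add: lookup_nc_star)

lemma nc_star_sum: "nc_star (\<Sum>i\<in>I. f i) = (\<Sum>i\<in>I. nc_star (f i))"
  by (induction I rule: infinite_finite_induct) (auto simp: nc_star_add)

lemma nc_star_single [simp]: "nc_star (Poly_Mapping.single u c) = Poly_Mapping.single (rev u) (cnj c)"
  by (rule poly_mapping_eqI) (auto simp: lookup_nc_star lookup_single when_def)

lemma rev_zero_list [simp]: "rev (0::'a list) = 0"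
  by (simp add: zero_list_def)

lemma rev_plus_list: "rev (u + v) = rev v + rev u"
  by (simp add: plus_list_def)

lemma nc_star_one [simp]: "nc_star 1 = 1"
  using nc_star_single[of 0 1] by simp

lemma nc_star_mult: "nc_star (p * q) = nc_star q * nc_star p"
proof (induction p rule: poly_mapping_add_induct)
  case (single u x)
  show ?case
    by (induction q rule: poly_mapping_add_induct)
      (auto simp: nc_star_add mult_single ring_distribs rev_plus_list mult.commute)
qed (auto simp: nc_star_add ring_distribs)

lemma nc_star_power: "nc_star (p ^ j) = nc_star p ^ j"
  by (induction j) (auto simp: nc_star_mult power_commutes)

lemma nc_star_lin [simp]: "nc_star (nc_lin a) = nc_lin a"
  by (simp add: nc_lin_def nc_star_sum)

lemma nc_lin_add: "nc_lin (\<lambda>i. a i + b i) = nc_lin a + nc_lin b"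
  by (simp add: nc_lin_def single_add sum.distrib)

lemma nc_lin_scale: "nc_lin (\<lambda>i. s * a i) = cst (complex_of_real s) * nc_lin a"
  by (simp add: nc_lin_def sum_distrib_left mult_single)

subsection \<open>Degrees\<close>

text \<open>A bound on the support instead of a maximum over it, so that the zero polynomial needs
  no separate treatment.\<close>

definition deg_le :: "nat \<Rightarrow> 'n ncpoly \<Rightarrow> bool" where
  "deg_le j p \<longleftrightarrow> (\<forall>u\<in>Poly_Mapping.keys p. length u \<le> j)"

lemma nc_deg_le_iff: "nc_deg p \<le> j \<longleftrightarrow> deg_le j p"
proof (cases "p = 0")
  case True
  then show ?thesis by (simp add: nc_deg_def deg_le_def)
next
  case False
  then have "Poly_Mapping.keys p \<noteq> {}" by (metis poly_mapping_eqI keys_zero not_in_keys_iff_lookup_eq_zero empty_iff)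
  then show ?thesis
    using False by (auto simp: nc_deg_def deg_le_def)
qed

lemma deg_le_mono: "deg_le i p \<Longrightarrow> i \<le> j \<Longrightarrow> deg_le j p"
  by (fastforce simp: deg_le_def)

lemma deg_le_zero [simp]: "deg_le j 0"
  by (simp add: deg_le_def)

lemma deg_le_add: "deg_le j p \<Longrightarrow> deg_le j q \<Longrightarrow> deg_le j (p + q)"
  unfolding deg_le_def using Poly_Mapping.keys_add by fastforce

lemma deg_le_uminus: "deg_le j p \<Longrightarrow> deg_le j (- p)"
  by (auto simp: deg_le_def in_keys_iff)

lemma deg_le_diff: "deg_le j p \<Longrightarrow> deg_le j q \<Longrightarrow> deg_le j (p - q)"
  by (metis deg_le_add deg_le_uminus diff_conv_add_uminus)

lemma deg_le_sum: "(\<And>i. i \<in> I \<Longrightarrow> deg_le j (f i)) \<Longrightarrow> deg_le j (\<Sum>i\<in>I. f i)"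
  by (induction I rule: infinite_finite_induct) (auto intro: deg_le_add)

lemma deg_le_single: "length u \<le> j \<Longrightarrow> deg_le j (Poly_Mapping.single u c)"
  by (auto simp: deg_le_def)



lemma deg_le_mult: "deg_le i p \<Longrightarrow> deg_le j q \<Longrightarrow> deg_le (i + j) (p * q)"
  unfolding deg_le_def by (force dest!: subsetD[OF keys_mult] simp: plus_list_def intro: add_mono)

lemma deg_le_cst [simp]: "deg_le j (cst c)"
  by (auto intro: deg_le_single simp: zero_list_def)

lemma deg_le_one [simp]: "deg_le j 1"
  using deg_le_cst[of j 1] by simp

lemma deg_le_scale: "deg_le j p \<Longrightarrow> deg_le j (cst c * p)"
  using deg_le_mult[of 0 "cst c" j p] by simp

lemma deg_le_star: "deg_le j p \<Longrightarrow> deg_le j (nc_star p)"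
proof -
  assume *: "deg_le j p"
  have "length u \<le> j" if "u \<in> Poly_Mapping.keys (nc_star p)" for u
    using that bspec[OF *[unfolded deg_le_def], of "rev u"]
    by (simp add: in_keys_iff lookup_nc_star)
  then show ?thesis by (simp add: deg_le_def)
qed

lemma deg_le_power: "deg_le i p \<Longrightarrow> deg_le (i * n) (p ^ n)"
  by (induction n) (auto dest: deg_le_mult)

lemma deg_le_lin: "deg_le 1 (nc_lin a)"
  unfolding nc_lin_def by (intro deg_le_sum deg_le_single) simp

subsection \<open>Substitution into real univariate polynomials\<close>

lemma nc_subst_superset:
  assumes "degree g \<le> N"
  shows "nc_subst g x = (\<Sum>j\<le>N. cst (complex_of_real (coeff g j)) * x ^ j)"
  unfolding nc_subst_def nc_scale_eq nc_pow_eq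
  by (rule sum.mono_neutral_left) (use assms in \<open>auto simp: coeff_eq_0\<close>)

lemma nc_subst_zero [simp]: "nc_subst 0 x = 0"
  by (simp add: nc_subst_superset[of 0 0])

lemma nc_subst_add: "nc_subst (f + g) x = nc_subst f x + nc_subst g x"
proof -
  let ?N = "max (degree f) (degree g)"
  have "degree (f + g) \<le> ?N" by (rule degree_add_le_max)
  then show ?thesis
    by (simp add: nc_subst_superset[of _ ?N] single_add ring_distribs sum.distrib)
qed

lemma nc_subst_smult: "nc_subst (smult c f) x = cst (complex_of_real c) * nc_subst f x"
  by (simp add: nc_subst_superset[of _ "degree f"] sum_distrib_left cst_mult flip: mult.assoc)

lemma nc_subst_uminus: "nc_subst (- f) x = - nc_subst f x"
  by (metis add.right_inverse add_eq_0_iff nc_subst_add nc_subst_zero)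

lemma nc_subst_diff: "nc_subst (f - g) x = nc_subst f x - nc_subst g x"
  by (metis diff_conv_add_uminus nc_subst_add nc_subst_uminus)

lemma nc_subst_pCons: "nc_subst (pCons c f) x = cst (complex_of_real c) + x * nc_subst f x"
proof -
  have "nc_subst (pCons c f) x =
      (\<Sum>j\<le>Suc (degree f). cst (complex_of_real (coeff (pCons c f) j)) * x ^ j)"
    by (rule nc_subst_superset) (rule degree_pCons_le)
  also have "\<dots> = cst (complex_of_real c) + x * nc_subst f x"
    unfolding sum.atMost_Suc_shift
    by (simp add: nc_subst_superset[of f "degree f"] sum_distrib_left cst_left_commute)
  finally show ?thesis .
qed

lemma nc_subst_mult: "nc_subst (f * g) x = nc_subst f x * nc_subst g x"
proof (induction f)
  case (pCons c f)
  then show ?case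
    by (simp add: nc_subst_add nc_subst_smult nc_subst_pCons ring_distribs mult.assoc)
qed simp

lemma nc_subst_one [simp]: "nc_subst 1 x = 1"
  by (simp add: nc_subst_superset[of 1 0])

lemma nc_subst_X: "nc_subst [:0, 1:] x = x"
  by (simp add: nc_subst_pCons)

lemma nc_star_subst: "nc_star x = x \<Longrightarrow> nc_star (nc_subst f x) = nc_subst f x"
  by (simp add: nc_subst_superset[of f "degree f"] nc_star_sum nc_star_mult nc_star_power cst_commute)

lemma deg_le_subst:
  assumes "degree f \<le> N" "deg_le 1 x"
  shows "deg_le N (nc_subst f x)"
  unfolding nc_subst_superset[OF assms(1)]
  by (intro deg_le_sum deg_le_scale) (use assms(2) deg_le_power[of 1 x] in \<open>auto intro: deg_le_mono\<close>)

section \<open>Polynomial functions\<close>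

text \<open>Polymorphic in the target: real points give evaluation, and the primes
  \<open>prime_of\<close> give the natural numbers \<open>mono_key\<close> that order the
  monomials.\<close>

definition mono_val :: "('n::finite \<Rightarrow> 'b::comm_monoid_mult) \<Rightarrow> ('n \<Rightarrow>\<^sub>0 nat) \<Rightarrow> 'b" where
  "mono_val x m = (\<Prod>i\<in>UNIV. x i ^ Poly_Mapping.lookup m i)"

lemma mono_val_add: "mono_val x (m + m') = mono_val x m * mono_val x m'"
  by (simp add: mono_val_def lookup_add power_add prod.distrib)

lemma mono_val_zero [simp]: "mono_val x 0 = 1"
  by (simp add: mono_val_def)

lemma mpeval_eq_lin_ext: "mpeval p x = lin_ext (mono_val x) p"
  by (simp add: mpeval_def lin_ext_def mono_val_def)

lemma mpeval_add: "mpeval (p + q) x = mpeval p x + mpeval q x"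
  by (simp add: mpeval_eq_lin_ext lin_ext_add)

lemma mpeval_mult: "mpeval (p * q) x = mpeval p x * mpeval q x"
  by (simp add: mpeval_eq_lin_ext lin_ext_mult mono_val_add)

lemma mpeval_diff: "mpeval (p - q) x = mpeval p x - mpeval q x"
  by (simp add: mpeval_eq_lin_ext lin_ext_diff)

lemma mpeval_const: "mpeval (Poly_Mapping.single 0 c) x = c"
  by (simp add: mpeval_eq_lin_ext)

lemma mpeval_one [simp]: "mpeval 1 x = 1"
  using mpeval_const[of 1] by simp

lemma mpeval_power: "mpeval (p ^ r) x = mpeval p x ^ r"
  by (induction r) (auto simp: mpeval_mult)

lemma mpeval_coord: "mpeval (Poly_Mapping.single (Poly_Mapping.single i 1) 1) x = x i"
  by (simp add: mpeval_eq_lin_ext mono_val_def lookup_single when_def if_distrib[of "\<lambda>n. _ ^ n"]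
      cong: if_cong)

text \<open>Most polynomials below arise as values of determinants or sums, so they are handled as
  functions; \<open>mpeval_inject\<close> leads back to formal polynomials when irreducibility of h
  is contradicted.\<close>

definition polyfun :: "(('n::finite \<Rightarrow> real) \<Rightarrow> real) \<Rightarrow> bool" where
  "polyfun f \<longleftrightarrow> (\<exists>p. f = mpeval p)"

lemma polyfun_mpeval [intro]: "polyfun (mpeval p)"
  by (auto simp: polyfun_def)

lemma polyfun_const [intro]: "polyfun (\<lambda>x. c)"
  unfolding polyfun_def by (rule exI[of _ "Poly_Mapping.single 0 c"]) (simp add: mpeval_const fun_eq_iff)

lemma polyfun_coord [intro]: "polyfun (\<lambda>x. x i)"
  unfolding polyfun_def
  by (rule exI[of _ "Poly_Mapping.single (Poly_Mapping.single i 1) 1"]) (simp add: mpeval_coord[simplified] fun_eq_iff)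

lemma polyfun_add [intro]: "polyfun f \<Longrightarrow> polyfun g \<Longrightarrow> polyfun (\<lambda>x. f x + g x)"
  unfolding polyfun_def using mpeval_add by (metis (no_types, lifting) ext)

lemma polyfun_mult [intro]: "polyfun f \<Longrightarrow> polyfun g \<Longrightarrow> polyfun (\<lambda>x. f x * g x)"
  unfolding polyfun_def using mpeval_mult by (metis (no_types, lifting) ext)

lemma polyfun_diff [intro]: "polyfun f \<Longrightarrow> polyfun g \<Longrightarrow> polyfun (\<lambda>x. f x - g x)"
  unfolding polyfun_def using mpeval_diff by (metis (no_types, lifting) ext)

lemma polyfun_sum [intro]: "(\<And>i. i \<in> I \<Longrightarrow> polyfun (f i)) \<Longrightarrow> polyfun (\<lambda>x. \<Sum>i\<in>I. f i x)"
  by (induction I rule: infinite_finite_induct) auto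

lemma polyfun_prod [intro]: "(\<And>i. i \<in> I \<Longrightarrow> polyfun (f i)) \<Longrightarrow> polyfun (\<lambda>x. \<Prod>i\<in>I. f i x)"
  by (induction I rule: infinite_finite_induct) auto

lemma polyfun_det:
  assumes "\<And>i j. i < n \<Longrightarrow> j < n \<Longrightarrow> polyfun (f i j)"
  shows "polyfun (\<lambda>x. det (mat n n (\<lambda>(i, j). f i j x)))"
proof -
  have "det (mat n n (\<lambda>(i, j). f i j x)) =
      (\<Sum>p | p permutes {0..<n}. signof p * (\<Prod>i = 0..<n. f i (p i) x))" for x
    unfolding det_def
    by (auto intro!: sum.cong prod.cong)
  then show ?thesis
    using assms by (auto intro!: polyfun_sum polyfun_mult polyfun_prod)
qed

lemma polyfun_on_line:
  assumes "polyfun f"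
  shows "\<exists>p. \<forall>t. f (\<lambda>i. b i + t * c i) = poly p t"
proof -
  obtain q where q: "f = mpeval q" using assms by (auto simp: polyfun_def)
  have "f (\<lambda>i. b i + t * c i) =
     poly (\<Sum>m\<in>Poly_Mapping.keys q. smult (Poly_Mapping.lookup q m)
       (\<Prod>i\<in>UNIV. [:b i, c i:] ^ Poly_Mapping.lookup m i)) t" for t
    by (simp add: q mpeval_def poly_sum poly_prod)
  then show ?thesis by blast
qed

subsection \<open>A monomial order\<close>

text \<open>Sending the variables to distinct primes embeds the monoid of monomials into the positive
  natural numbers under multiplication; the usual order of the natural numbers then becomes a
  well-founded monomial order, and exponents can be read off from prime multiplicities.\<close>

definition prime_of :: "'n::finite \<Rightarrow> nat" where
  "prime_of = (SOME f. inj f \<and> (\<forall>i. prime (f i)))"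

lemma prime_of: "inj (prime_of :: 'n::finite \<Rightarrow> nat)" "prime (prime_of (i :: 'n))"
proof -
  obtain g :: "'n \<Rightarrow> nat" where "inj g"
    using finite_imp_inj_to_nat_seg[OF finite_UNIV[where 'a = 'n]] by auto
  define f where "f = enumerate {p::nat. prime p} \<circ> g"
  have "inj f"
    unfolding f_def using \<open>inj g\<close> inj_enumerate[OF primes_infinite] by (rule inj_compose[rotated])
  moreover have "prime (f i)" for i
    using enumerate_in_set[OF primes_infinite, of "g i"] by (simp add: f_def)
  ultimately have "\<exists>f :: 'n \<Rightarrow> nat. inj f \<and> (\<forall>i. prime (f i))" by blast
  then have "inj (prime_of :: 'n \<Rightarrow> nat) \<and> (\<forall>i :: 'n. prime (prime_of i))"
    unfolding prime_of_def by (rule someI_ex)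
  then show "inj (prime_of :: 'n \<Rightarrow> nat)" "prime (prime_of (i :: 'n))" by auto
qed

abbreviation mono_key :: "('n::finite \<Rightarrow>\<^sub>0 nat) \<Rightarrow> nat" where
  "mono_key \<equiv> mono_val prime_of"

lemma mono_key_pos [simp]: "mono_key m > 0"
  unfolding mono_val_def by (intro prod_pos) (auto intro: prime_gt_0_nat prime_of)

lemma multiplicity_mono_key: "multiplicity (prime_of i) (mono_key m) = Poly_Mapping.lookup m i"
proof -
  have *: "0 \<notin> (\<lambda>j. prime_of j ^ Poly_Mapping.lookup m j) ` UNIV"
    using prime_of(2) by (metis (mono_tags, lifting) imageE not_prime_0 power_not_zero)
  have "multiplicity (prime_of i) (mono_key m) =
     (\<Sum>j\<in>UNIV. multiplicity (prime_of i) (prime_of j ^ Poly_Mapping.lookup m j))"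
    unfolding mono_val_def
    by (rule prime_elem_multiplicity_prod_distrib)
      (use prime_imp_prime_elem[OF prime_of(2)] * in auto)
  also have "\<dots> = (\<Sum>j\<in>UNIV. if i = j then Poly_Mapping.lookup m j else 0)"
  proof (rule sum.cong)
    fix j :: 'a
    show "multiplicity (prime_of i) (prime_of j ^ Poly_Mapping.lookup m j) =
      (if i = j then Poly_Mapping.lookup m j else 0)"
      using prime_of(2)[of i] prime_of(2)[of j] inj_eq[OF prime_of(1), of i j]
      by (auto simp: multiplicity_prime_power multiplicity_distinct_prime_power)
  qed simp
  finally show ?thesis by simp
qed

lemma mono_key_eq_iff: "mono_key m = mono_key m' \<longleftrightarrow> m = m'"
  by (metis multiplicity_mono_key poly_mapping_eqI)

definition lead :: "('n::finite \<Rightarrow>\<^sub>0 nat) \<Rightarrow> 'n mpoly \<Rightarrow> bool" where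
  "lead m p \<longleftrightarrow> m \<in> Poly_Mapping.keys p \<and> (\<forall>m'\<in>Poly_Mapping.keys p. mono_key m' \<le> mono_key m)"

lemma lead_exists:
  assumes "p \<noteq> 0"
  obtains m where "lead m p"
proof -
  have "Poly_Mapping.keys p \<noteq> {}"
    using assms by (metis poly_mapping_eqI keys_zero not_in_keys_iff_lookup_eq_zero empty_iff)
  then have "Max (mono_key ` Poly_Mapping.keys p) \<in> mono_key ` Poly_Mapping.keys p"
    by (intro Max_in) auto
  then obtain m where "m \<in> Poly_Mapping.keys p" "mono_key m = Max (mono_key ` Poly_Mapping.keys p)"
    by auto
  then have "lead m p" by (auto simp: lead_def)
  then show ?thesis by (rule that)
qed

text \<open>Keys multiply when monomials are added, and a product of two positive numbers below
  given bounds reaches the product of the bounds only if both reach theirs. So the top coefficient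
  comes from a single pair and cannot cancel.\<close>

lemma lead_mult:
  assumes "lead m p" "lead m' q"
  shows "lead (m + m') (p * q)"
    and "Poly_Mapping.lookup (p * q) (m + m') = Poly_Mapping.lookup p m * Poly_Mapping.lookup q m'"
proof -
  let ?P = "Poly_Mapping.keys p" and ?Q = "Poly_Mapping.keys q"
  have m: "m \<in> ?P" "m' \<in> ?Q" using assms by (auto simp: lead_def)
  have *: "(u + v = m + m') = (u = m \<and> v = m')" if "u \<in> ?P" "v \<in> ?Q" for u v
  proof
    assume "u + v = m + m'"
    then have "mono_key m * mono_key m' = mono_key u * mono_key v" by (metis mono_val_add)
    moreover have "mono_key u \<le> mono_key m" "mono_key v \<le> mono_key m'"
      using assms that by (auto simp: lead_def)
    ultimately have "mono_key u = mono_key m \<and> mono_key v = mono_key m'"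
      using mono_key_pos[of m] mono_key_pos[of m'] mono_key_pos[of u] mono_key_pos[of v]
      by (smt (verit) le_neq_implies_less mult_le_less_imp_less mult_less_le_imp_less
          nat_less_le order_refl zero_le)
    then show "u = m \<and> v = m'" by (simp add: mono_key_eq_iff)
  qed auto
  have "p * q = (\<Sum>u\<in>?P. \<Sum>v\<in>?Q.
      Poly_Mapping.single (u + v) (Poly_Mapping.lookup p u * Poly_Mapping.lookup q v))"
    using poly_mapping_sum_single[of p] poly_mapping_sum_single[of q]
    by (metis (no_types, lifting) mult_single sum.cong sum_product)
  then have "Poly_Mapping.lookup (p * q) (m + m') = (\<Sum>u\<in>?P. \<Sum>v\<in>?Q.
      if u = m \<and> v = m' then Poly_Mapping.lookup p u * Poly_Mapping.lookup q v else 0)"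
    by (simp add: lookup_sum lookup_single when_def * cong: sum.cong)
  also have "\<dots> = (\<Sum>u\<in>?P. if u = m then Poly_Mapping.lookup p u * Poly_Mapping.lookup q m' else 0)"
    using m by (intro sum.cong) (auto simp: sum.delta)
  also have "\<dots> = Poly_Mapping.lookup p m * Poly_Mapping.lookup q m'"
    using m by simp
  finally show eq: "Poly_Mapping.lookup (p * q) (m + m') =
    Poly_Mapping.lookup p m * Poly_Mapping.lookup q m'" .
  have "m + m' \<in> Poly_Mapping.keys (p * q)"
    using m eq by (simp add: in_keys_iff)
  moreover have "mono_key w \<le> mono_key (m + m')" if "w \<in> Poly_Mapping.keys (p * q)" for w
  proof -
    obtain a b where "w = a + b" "a \<in> ?P" "b \<in> ?Q" using keys_mult[of p q] \<open>w \<in> _\<close> by blast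
    then show ?thesis
      using assms mult_le_mono[of "mono_key a" "mono_key m" "mono_key b" "mono_key m'"]
      by (simp add: lead_def mono_val_add)
  qed
  ultimately show "lead (m + m') (p * q)" by (simp add: lead_def)
qed

lemma mpoly_no_zero_divisors:
  assumes "p \<noteq> (0 :: 'n::finite mpoly)" "q \<noteq> 0"
  shows "p * q \<noteq> 0"
  using lead_exists[OF assms(1)] lead_exists[OF assms(2)] lead_mult(1)
  by (metis empty_iff keys_zero lead_def)

lemma mpoly_power_nonzero: "p \<noteq> (0 :: 'n::finite mpoly) \<Longrightarrow> p ^ k \<noteq> 0"
  by (induction k) (auto simp: mpoly_no_zero_divisors)

lemma lead_power:
  assumes "lead m p"
  shows "\<exists>m'. lead m' (p ^ k) \<and> mono_key m' = mono_key m ^ k"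
proof (induction k)
  case 0
  have "lead 0 (1 :: 'a mpoly)" by (simp add: lead_def)
  then show ?case by (auto intro!: exI[of _ 0])
next
  case (Suc k)
  then obtain m' where "lead m' (p ^ k)" "mono_key m' = mono_key m ^ k" by blast
  then show ?case
    using lead_mult(1)[OF assms, of m' "p ^ k"] by (auto simp: mono_val_add intro!: exI[of _ "m + m'"])
qed

text \<open>The dominating term wins along the curve of points with coordinates \<open>prime_of i ^ s\<close>.\<close>

lemma mpeval_nonzero:
  assumes "p \<noteq> 0"
  shows "\<exists>x. mpeval p x \<noteq> 0"
proof -
  obtain m where m: "lead m p" using lead_exists assms by blast
  define S where "S = Poly_Mapping.keys p - {m}"
  have lt: "mono_key u < mono_key m" if "u \<in> S" for u
    using m that mono_key_eq_iff[of u m] by (force simp: lead_def S_def)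
  define x where "x s = (\<lambda>i :: 'a. real (prime_of i) ^ s)" for s :: nat
  have mv: "mono_val (x s) u = real (mono_key u) ^ s" for s u
    by (simp add: x_def mono_val_def prod_power_distrib flip: power_mult)
      (simp add: mult.commute power_mult)
  have "mpeval p (x s) / real (mono_key m) ^ s = Poly_Mapping.lookup p m +
      (\<Sum>u\<in>S. Poly_Mapping.lookup p u * (real (mono_key u) / real (mono_key m)) ^ s)" for s
  proof -
    have "mpeval p (x s) = Poly_Mapping.lookup p m * real (mono_key m) ^ s +
        (\<Sum>u\<in>S. Poly_Mapping.lookup p u * real (mono_key u) ^ s)"
      unfolding S_def mpeval_eq_lin_ext lin_ext_def mv
      by (rule sum.remove) (use m in \<open>auto simp: lead_def\<close>)
    then show ?thesis
      using mono_key_pos[of m] by (simp add: add_divide_distrib sum_divide_distrib power_divide)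
  qed
  moreover have "(\<lambda>s. Poly_Mapping.lookup p m +
      (\<Sum>u\<in>S. Poly_Mapping.lookup p u * (real (mono_key u) / real (mono_key m)) ^ s))
    \<longlonglongrightarrow> Poly_Mapping.lookup p m + (\<Sum>u\<in>S. Poly_Mapping.lookup p u * 0)"
    using lt mono_key_pos[of m]
    by (intro tendsto_add tendsto_const tendsto_sum tendsto_mult LIMSEQ_power_zero) auto
  ultimately have lim: "(\<lambda>s. mpeval p (x s) / real (mono_key m) ^ s) \<longlonglongrightarrow> Poly_Mapping.lookup p m"
    by simp
  show ?thesis
  proof (rule ccontr)
    assume "\<nexists>x. mpeval p x \<noteq> 0"
    then have "(\<lambda>s :: nat. 0 :: real) \<longlonglongrightarrow> Poly_Mapping.lookup p m"
      using lim by simp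
    then have "Poly_Mapping.lookup p m = 0" by (simp add: LIMSEQ_const_iff)
    then show False using m by (simp add: lead_def in_keys_iff)
  qed
qed

lemma mpeval_inject: "mpeval p = mpeval q \<Longrightarrow> p = q"
  using mpeval_nonzero[of "p - q"] by (force simp: mpeval_diff)

text \<open>Identity principle: f D vanishes at every point, and the polynomial ring has no zero
  divisors.\<close>

lemma polyfun_zero_of_nonzero_set:
  assumes "polyfun f" "polyfun D" "D x0 \<noteq> 0" "\<And>x. D x \<noteq> 0 \<Longrightarrow> f x = 0"
  shows "f x = 0"
proof -
  obtain p q where p: "f = mpeval p" and q: "D = mpeval q"
    using assms(1,2) by (auto simp: polyfun_def)
  have "mpeval (p * q) x = 0" for x
    using assms(4)[of x] by (cases "D x = 0") (auto simp: mpeval_mult p q)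
  then have "p * q = 0" using mpeval_nonzero by blast
  moreover have "q \<noteq> 0" using assms(3) by (auto simp: q mpeval_def)
  ultimately have "p = 0" using mpoly_no_zero_divisors by blast
  then show ?thesis by (simp add: p mpeval_def)
qed

subsection \<open>Complete integral closedness\<close>

text \<open>The case of natural numbers, to which the keys of leading monomials reduce the
  polynomial case. At each prime, k v(a) \<le> v(c) + k v(b) with k > v(c) forces v(a) \<le>
  v(b).\<close>

lemma dvd_of_pow_dvd_mult_pow_nat:
  fixes a b c :: nat
  assumes "\<And>k. a ^ k dvd c * b ^ k" "c > 0" "a > 0" "b > 0"
  shows "a dvd b"
proof (rule multiplicity_le_imp_dvd)
  fix p :: nat assume p: "prime p"
  define k where "k = Suc (multiplicity p c)"
  have "multiplicity p (a ^ k) \<le> multiplicity p (c * b ^ k)"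
    by (rule dvd_imp_multiplicity_le) (use assms in auto)
  then have "k * multiplicity p a \<le> multiplicity p c + k * multiplicity p b"
    using p assms by (simp add: prime_elem_multiplicity_mult_distrib prime_elem_multiplicity_power_distrib)
  also have "\<dots> < k * Suc (multiplicity p b)" by (simp add: k_def)
  finally show "multiplicity p a \<le> multiplicity p b"
    by (metis less_Suc_eq_le nat_mult_less_cancel_disj)
qed (use assms in simp)

text \<open>Division with remainder by leading terms: almost integrality of \<open>N / D\<close> forces the leading
  monomial of \<open>D\<close> to divide that of \<open>N\<close>, and it survives subtracting the quotient of the two.\<close>

lemma mpoly_completely_integrally_closed:
  fixes D c N :: "'n::finite mpoly"
  assumes "D \<noteq> 0" "c \<noteq> 0" "\<And>k. D ^ k dvd c * N ^ k"
  shows "D dvd N"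
proof -
  \<comment> \<open>The induction is on a strict bound b for the keys occurring in N, which drops
    whenever the leading term is removed; b = 0 leaves only N = 0.\<close>
  have "(\<forall>m\<in>Poly_Mapping.keys N. mono_key m < b) \<Longrightarrow> D dvd N" if "\<And>k. D ^ k dvd c * N ^ k" for b N
    using that
  proof (induction b arbitrary: N)
    case 0
    then have "Poly_Mapping.keys N = {}" by auto
    then have "N = 0" using lead_exists[of N] by (auto simp: lead_def)
    then show ?case by simp
  next
    case (Suc b)
    show ?case
    proof (cases "N = 0")
      case False
      obtain mN mD mc where mN: "lead mN N" and mD: "lead mD D" and mc: "lead mc c"
        using lead_exists False assms(1,2) by metis
      have "mono_key mD ^ k dvd mono_key mc * mono_key mN ^ k" for k
      proof -
        obtain W where W: "c * N ^ k = D ^ k * W" using Suc.prems(2) by (metis dvdE)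
        have "W \<noteq> 0"
          using mpoly_no_zero_divisors[OF assms(2) mpoly_power_nonzero[OF False, of k]] W by auto
        then obtain mW where mW: "lead mW W" using lead_exists by blast
        obtain u v where u: "lead u (D ^ k)" "mono_key u = mono_key mD ^ k"
          and v: "lead v (N ^ k)" "mono_key v = mono_key mN ^ k"
          using lead_power mN mD by metis
        have "mono_key (mc + v) = mono_key (u + mW)"
          using lead_mult(1)[OF mc v(1)] lead_mult(1)[OF u(1) mW] W
          by (metis lead_def order_antisym)
        then show ?thesis by (metis dvd_triv_left mono_val_add u(2) v(2))
      qed
      then have dvd: "mono_key mD dvd mono_key mN"
        by (rule dvd_of_pow_dvd_mult_pow_nat) auto
      have le: "Poly_Mapping.lookup mD i \<le> Poly_Mapping.lookup mN i" for i
        using dvd_imp_multiplicity_le[OF dvd, of "prime_of i"] by (simp add: multiplicity_mono_key)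
      define t where "t = mN - mD"
      have t: "t + mD = mN"
        by (rule poly_mapping_eqI) (use le in \<open>simp add: t_def lookup_add lookup_minus\<close>)
      define \<gamma> where "\<gamma> = Poly_Mapping.lookup N mN / Poly_Mapping.lookup D mD"
      define T where "T = Poly_Mapping.single t \<gamma>"
      have DmD: "Poly_Mapping.lookup D mD \<noteq> 0" "Poly_Mapping.lookup N mN \<noteq> 0"
        using mD mN by (auto simp: lead_def in_keys_iff)
      have T: "lead t T" using DmD by (simp add: T_def lead_def \<gamma>_def)
      have key_lt: "mono_key m < b" if m: "m \<in> Poly_Mapping.keys (N - T * D)" for m
      proof -
        have "m \<in> Poly_Mapping.keys N \<or> m \<in> Poly_Mapping.keys (T * D)"
          using m by (auto simp: in_keys_iff lookup_minus)
        then have "mono_key m \<le> mono_key mN"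
          using lead_mult(1)[OF T mD] mN by (auto simp: lead_def t)
        moreover have "m \<noteq> mN"
          using m lead_mult(2)[OF T mD] DmD
          by (auto simp: in_keys_iff lookup_minus t T_def \<gamma>_def)
        moreover have "mono_key mN \<le> b"
          using Suc.prems(1) mN by (auto simp: lead_def less_Suc_eq_le)
        ultimately show ?thesis
          using mono_key_eq_iff[of m mN] by linarith
      qed
      \<comment> \<open>The hypothesis survives subtraction of T D: in the binomial expansion, c N^j
        supplies the factor D^j and the power of T D supplies D^(k - j).\<close>
      have "D ^ k dvd c * (N - T * D) ^ k" for k
      proof -
        have "c * (N - T * D) ^ k =
            (\<Sum>j\<le>k. of_nat (k choose j) * (c * N ^ j) * (- T * D) ^ (k - j))"
          using binomial_ring[of N "- T * D" k] by (simp add: sum_distrib_left mult_ac)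
        also have "D ^ k dvd \<dots>"
        proof (rule dvd_sum)
          fix j assume "j \<in> {..k}"
          then have "D ^ k = D ^ j * D ^ (k - j)" by (simp flip: power_add)
          moreover have "D ^ j dvd of_nat (k choose j) * (c * N ^ j)"
            using Suc.prems(2) by (rule dvd_mult)
          moreover have "D ^ (k - j) dvd (- T * D) ^ (k - j)"
            by (simp add: power_mult_distrib del: mult_minus_left)
          ultimately show "D ^ k dvd of_nat (k choose j) * (c * N ^ j) * (- T * D) ^ (k - j)"
            by (metis mult_dvd_mono)
        qed
        finally show ?thesis .
      qed
      with Suc.IH key_lt have "D dvd N - T * D" by blast
      then have "D dvd (N - T * D) + T * D" by (rule dvd_add) simp
      then show ?thesis by simp
    qed simp
  qed
  moreover have "\<exists>b. \<forall>m\<in>Poly_Mapping.keys N. mono_key m < b"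
    using finite_nat_set_iff_bounded[of "mono_key ` Poly_Mapping.keys N"] by auto
  ultimately show ?thesis using assms(3) by blast
qed

lemma polyfun_almost_integral:
  fixes D :: "('n::finite \<Rightarrow> real) \<Rightarrow> real"
  assumes D: "polyfun D" "D x0 \<noteq> 0"
    and u: "\<And>k. \<exists>W. polyfun W \<and> (\<forall>x. D x \<noteq> 0 \<longrightarrow> D x * u x ^ k = W x)"
  shows "\<exists>U. polyfun U \<and> (\<forall>x. D x \<noteq> 0 \<longrightarrow> U x = u x)"
proof -
  obtain q where q: "D = mpeval q" using D by (auto simp: polyfun_def)
  have q0: "q \<noteq> 0" using D(2) by (auto simp: q mpeval_def)
  obtain N where N: "\<And>x. D x \<noteq> 0 \<Longrightarrow> D x * u x = mpeval N x"
    using u[of 1] by (auto simp: polyfun_def)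
  have "q dvd N"
  proof (rule mpoly_completely_integrally_closed)
    \<comment> \<open>The multiplier is q^2: nothing is known about W where D vanishes, and the
      extra factor q makes both sides of the identity below zero there.\<close>
    show "q \<noteq> 0" "q * q \<noteq> 0" using q0 mpoly_no_zero_divisors by auto
    fix k
    obtain W where W: "\<And>x. D x \<noteq> 0 \<Longrightarrow> D x * u x ^ k = mpeval W x"
      using u[of k] by (auto simp: polyfun_def)
    have "mpeval (q * q * N ^ k) x = mpeval (q ^ k * (q * W)) x" for x
    proof (cases "D x = 0")
      case True
      then show ?thesis by (simp add: mpeval_mult q)
    next
      case False
      then show ?thesis
        using N[OF False] W[OF False] 
        by (simp add: mpeval_mult mpeval_power q power_mult_distrib mult_ac
            flip: N[OF False] W[OF False])
    qed
    then show "q ^ k dvd q * q * N ^ k" using mpeval_inject by (metis dvdI ext)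
  qed
  then obtain U where U: "N = q * U" by blast
  have "mpeval U x = u x" if "D x \<noteq> 0" for x
    using N[OF that] that by (simp add: U mpeval_mult q)
  then show ?thesis by blast
qed

section \<open>Families of univariate polynomials\<close>

definition polyfam :: "(('n::finite \<Rightarrow> real) \<Rightarrow> real poly) \<Rightarrow> bool" where
  "polyfam G \<longleftrightarrow> (\<forall>i. polyfun (\<lambda>a. coeff (G a) i))"

lemma polyfam_const [intro]: "polyfam (\<lambda>a. g)"
  by (auto simp: polyfam_def)

lemma polyfam_add: "polyfam F \<Longrightarrow> polyfam G \<Longrightarrow> polyfam (\<lambda>a. F a + G a)"
  by (auto simp: polyfam_def)

lemma polyfam_diff: "polyfam F \<Longrightarrow> polyfam G \<Longrightarrow> polyfam (\<lambda>a. F a - G a)"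
  by (auto simp: polyfam_def)

lemma polyfam_mult: "polyfam F \<Longrightarrow> polyfam G \<Longrightarrow> polyfam (\<lambda>a. F a * G a)"
  unfolding polyfam_def coeff_mult by (intro allI polyfun_sum polyfun_mult) auto

lemma polyfam_smult: "polyfun c \<Longrightarrow> polyfam G \<Longrightarrow> polyfam (\<lambda>a. smult (c a) (G a))"
  by (auto simp: polyfam_def)

lemma polyfam_pCons: "polyfun c \<Longrightarrow> polyfam G \<Longrightarrow> polyfam (\<lambda>a. pCons (c a) (G a))"
  unfolding polyfam_def
proof
  fix i assume "polyfun c" "\<forall>i. polyfun (\<lambda>a. coeff (G a) i)"
  then show "polyfun (\<lambda>a. coeff (pCons (c a) (G a)) i)" by (cases i) auto
qed

lemma polyfam_monom: "polyfun c \<Longrightarrow> polyfam (\<lambda>a. monom (c a) n)"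
  unfolding polyfam_def
proof
  fix i assume "polyfun c"
  then show "polyfun (\<lambda>a. coeff (monom (c a) n) i)" by (cases "n = i") auto
qed

lemma polyfam_sum: "(\<And>i. i \<in> I \<Longrightarrow> polyfam (F i)) \<Longrightarrow> polyfam (\<lambda>a. \<Sum>i\<in>I. F i a)"
  by (induction I rule: infinite_finite_induct) (auto intro: polyfam_add)

lemma polyfam_prod: "(\<And>i. i \<in> I \<Longrightarrow> polyfam (F i)) \<Longrightarrow> polyfam (\<lambda>a. \<Prod>i\<in>I. F i a)"
  by (induction I rule: infinite_finite_induct) (auto intro: polyfam_mult)

lemma polyfam_power: "polyfam F \<Longrightarrow> polyfam (\<lambda>a. F a ^ n)"
  by (induction n) (auto intro: polyfam_mult)

text \<open>Long division introduces no denominators in a, because the leading coefficient c of the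
  divisor is the same nonzero constant at every point.\<close>

lemma polyfam_divmod_exists:
  assumes F: "polyfam F" "\<And>a. degree (F a) = r" "\<And>a. coeff (F a) r = c" "c \<noteq> 0"
    and G: "polyfam G" "\<And>a i. i \<ge> N \<Longrightarrow> coeff (G a) i = 0"
  shows "\<exists>Q R. polyfam Q \<and> polyfam R \<and>
    (\<forall>a. G a = Q a * F a + R a \<and> (\<forall>i\<ge>r. coeff (R a) i = 0))"
  using G
proof (induction N arbitrary: G)
  case 0
  then show ?case by (intro exI[of _ "\<lambda>a. 0"] exI[of _ G]) auto
next
  case (Suc N)
  show ?case
  proof (cases "N \<ge> r")
    case False
    then show ?thesis
      using Suc.prems by (intro exI[of _ "\<lambda>a. 0"] exI[of _ G]) auto
  next
    case True
    define T where "T a = monom (coeff (G a) N / c) (N - r)" for a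
    have T: "polyfam T"
      unfolding T_def divide_inverse using Suc.prems(1)
      by (intro polyfam_monom polyfun_mult polyfun_const) (auto simp: polyfam_def)
    have coeffT: "coeff (T a * F a) i = (if i < N - r then 0 else coeff (G a) N / c * coeff (F a) (i - (N - r)))" for a i
      unfolding T_def by (subst coeff_monom_mult) auto
    have "coeff (G a - T a * F a) i = 0" if "i \<ge> N" for a i
    proof (cases "i = N")
      case True
      then show ?thesis using \<open>N \<ge> r\<close> F(3,4) by (auto simp: coeffT)
    next
      case False
      then have "i \<ge> Suc N" "i - (N - r) > degree (F a)" using that True F(2) by auto
      then show ?thesis using Suc.prems(2)[of i a] by (simp add: coeffT coeff_eq_0)
    qed
    moreover have "polyfam (\<lambda>a. G a - T a * F a)"
      by (intro polyfam_diff polyfam_mult Suc.prems T F)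
    ultimately obtain Q R where QR: "polyfam Q" "polyfam R"
      "\<And>a. G a - T a * F a = Q a * F a + R a" "\<And>a i. i \<ge> r \<Longrightarrow> coeff (R a) i = 0"
      using Suc.IH[of "\<lambda>a. G a - T a * F a"] by blast
    have "G a = (Q a + T a) * F a + R a" for a
      using QR(3)[of a] by (simp add: algebra_simps)
    then show ?thesis
      using QR T polyfam_add[of Q T] by (intro exI[of _ "\<lambda>a. Q a + T a"] exI[of _ R]) auto
  qed
qed

lemma polyfam_div_mod:
  assumes F: "polyfam F" "\<And>a. degree (F a) = r" "\<And>a. coeff (F a) r = c" "c \<noteq> 0"
    and G: "polyfam G" "\<And>a. degree (G a) \<le> N"
  shows "polyfam (\<lambda>a. G a div F a)" "polyfam (\<lambda>a. G a mod F a)"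
proof -
  have *: "\<And>a i. i \<ge> Suc N \<Longrightarrow> coeff (G a) i = 0"
    using G(2) by (metis Suc_le_lessD coeff_eq_0 le_less_trans)
  obtain Q R where QR: "polyfam Q" "polyfam R" "\<And>a. G a = Q a * F a + R a"
    "\<And>a i. i \<ge> r \<Longrightarrow> coeff (R a) i = 0"
    using polyfam_divmod_exists[OF F G(1) *] by metis
  have "G a div F a = Q a \<and> G a mod F a = R a" for a
  proof -
    have "F a \<noteq> 0" using F(3)[of a] F(4) by auto
    have "R a = 0 \<or> degree (R a) < degree (F a)"
      using QR(4)[of r a] QR(4)[of "degree (R a)" a] F(2)
      by (metis leading_coeff_0_iff not_le_imp_less)
    then have "R a div F a = 0" "R a mod F a = R a"
      by (auto simp: div_poly_less mod_poly_less)
    then show ?thesis using \<open>F a \<noteq> 0\<close> by (simp add: QR(3))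
  qed
  then show "polyfam (\<lambda>a. G a div F a)" "polyfam (\<lambda>a. G a mod F a)"
    using QR(1,2) by simp_all
qed

section \<open>Real-rooted polynomials\<close>

definition real_rooted :: "real poly \<Rightarrow> bool" where
  "real_rooted g \<longleftrightarrow> (\<forall>z::complex. poly (map_poly complex_of_real g) z = 0 \<longrightarrow> z \<in> \<real>)"

lemma cpoly_pCons:
  "poly (map_poly complex_of_real (pCons c p)) z = complex_of_real c + z * poly (map_poly complex_of_real p) z"
  by (simp add: map_poly_pCons)

lemma cpoly_add: "poly (map_poly complex_of_real (p + q)) z =
    poly (map_poly complex_of_real p) z + poly (map_poly complex_of_real q) z"
proof (induction p arbitrary: q)
  case (pCons c p)
  then show ?case by (cases q) (simp add: cpoly_pCons ring_distribs)
qed simp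

lemma cpoly_smult: "poly (map_poly complex_of_real (smult c p)) z =
    complex_of_real c * poly (map_poly complex_of_real p) z"
  by (induction p) (simp_all add: cpoly_pCons ring_distribs)

lemma cpoly_mult: "poly (map_poly complex_of_real (p * q)) z =
    poly (map_poly complex_of_real p) z * poly (map_poly complex_of_real q) z"
  by (induction p) (simp_all add: cpoly_pCons cpoly_add cpoly_smult ring_distribs)

lemma cpoly_of_real: "poly (map_poly complex_of_real p) (complex_of_real t) = complex_of_real (poly p t)"
  by (induction p) (simp_all add: cpoly_pCons)

lemma real_rooted_factor: "real_rooted (p * q) \<Longrightarrow> real_rooted p"
  by (auto simp: real_rooted_def cpoly_mult)

lemma real_rooted_has_root:
  assumes "real_rooted g" "degree g > 0"
  obtains r where "poly g r = 0"
proof -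
  have "degree (map_poly complex_of_real g) > 0"
    using assms(2) by (subst degree_map_poly) auto
  then obtain z where z: "poly (map_poly complex_of_real g) z = 0"
    using fundamental_theorem_of_algebra[of "map_poly complex_of_real g"] by (auto simp: constant_degree)
  then obtain r where "z = complex_of_real r" using assms(1) by (auto simp: real_rooted_def Reals_def)
  then show ?thesis using z that by (auto simp: cpoly_of_real)
qed

lemma real_rooted_split:
  assumes "real_rooted g" "g \<noteq> 0"
  shows "\<exists>c rs. c \<noteq> 0 \<and> g = smult c (\<Prod>r\<leftarrow>rs. [:- r, 1:])"
  using assms
proof (induction "degree g" arbitrary: g)
  case 0
  then obtain c where "g = [:c:]" by (metis degree_eq_zeroE)
  then show ?case using 0 by (intro exI[of _ c] exI[of _ "[]"]) auto
next
  case (Suc n)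
  then obtain r where "poly g r = 0" using real_rooted_has_root[of g] by auto
  then obtain q where q: "g = [:- r, 1:] * q" by (metis poly_eq_0_iff_dvd dvdE)
  then have "q \<noteq> 0" using Suc.prems by auto
  then have "degree g = Suc (degree q)" unfolding q by (subst degree_mult_eq) auto
  moreover have "real_rooted q" using Suc.prems(1) q by (metis mult.commute real_rooted_factor)
  ultimately obtain c rs where *: "c \<noteq> 0" "q = smult c (\<Prod>r\<leftarrow>rs. [:- r, 1:])"
    using Suc.hyps \<open>q \<noteq> 0\<close> by (metis nat.inject)
  then show ?case by (intro exI[of _ c] exI[of _ "r # rs"]) (simp add: q)
qed

text \<open>Hensel lifting, one linear factor at a time.\<close>

lemma sqrt_mod_linear_factors:
  fixes f :: "real poly"
  assumes "\<And>r. r \<in> set rs \<Longrightarrow> poly f r > 0"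
  shows "\<exists>s. (\<Prod>r\<leftarrow>rs. [:- r, 1:]) dvd f - s ^ 2"
  using assms
proof (induction rs)
  case (Cons r rs)
  define g where "g = (\<Prod>r\<leftarrow>rs. [:- r, 1:])"
  obtain s where "g dvd f - s ^ 2" using Cons by (auto simp: g_def)
  then obtain q where q: "f - s ^ 2 = g * q" by blast
  have fr: "poly f r > 0" using Cons.prems by simp
  have eq: "f - (s + smult c g) ^ 2 = g * (q - smult (2 * c) s - smult (c ^ 2) g)" for c
  proof -
    have "f - (s + smult c g) ^ 2 = (f - s ^ 2) - g * (smult (2 * c) s + smult (c ^ 2) g)"
      unfolding poly_eq_poly_eq_iff[symmetric] fun_eq_iff
      by (simp add: power2_eq_square algebra_simps)
    then show ?thesis by (simp add: q algebra_simps)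
  qed
  \<comment> \<open>Adding c g keeps the congruence modulo g. At a new root r, c is chosen so that
    the corrected s takes the value sqrt (f r) there. At a repeated root the value of s is already
    right, and c solves q(r) = 2 c s(r), which is possible because s(r)^2 = f(r) > 0.\<close>
  have "\<exists>c. [:- r, 1:] * g dvd f - (s + smult c g) ^ 2"
  proof (cases "poly g r = 0")
    case True
    have "poly f r = poly s r ^ 2"
      using arg_cong[OF q, of "\<lambda>p. poly p r"] True by simp
    then have "poly s r \<noteq> 0" using fr by auto
    then have "poly (q - smult (2 * c) s - smult (c ^ 2) g) r = 0"
      if "c = poly q r / (2 * poly s r)" for c
      using True that by simp
    then show ?thesis
      unfolding eq by (metis mult.commute mult_dvd_mono dvd_refl poly_eq_0_iff_dvd)
  next
    case False
    define c where "c = (sqrt (poly f r) - poly s r) / poly g r"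
    have "poly (f - (s + smult c g) ^ 2) r = 0"
      using False fr by (simp add: c_def)
    then have "poly (q - smult (2 * c) s - smult (c ^ 2) g) r = 0"
      unfolding eq using False by simp
    then show ?thesis
      unfolding eq by (metis mult.commute mult_dvd_mono dvd_refl poly_eq_0_iff_dvd)
  qed
  then show ?case by (auto simp: g_def)
qed auto

text \<open>Used with f = t to make a . z a square, and with f = N - t^2 to bound it. Reducing the
  root modulo g gives the degree bound on which the truncation order rests.\<close>

lemma sqrt_mod_real_rooted:
  fixes f g :: "real poly"
  assumes "real_rooted g" "degree g > 0" "\<And>r. poly g r = 0 \<Longrightarrow> poly f r > 0"
  shows "\<exists>s. degree s < degree g \<and> g dvd f - s ^ 2"
proof -
  have "g \<noteq> 0" using assms(2) by auto
  then obtain c rs where g: "c \<noteq> 0" "g = smult c (\<Prod>r\<leftarrow>rs. [:- r, 1:])"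
    using real_rooted_split assms(1) by blast
  have "poly g r = 0" if "r \<in> set rs" for r
    using that unfolding g by (induction rs) auto
  then obtain s where "(\<Prod>r\<leftarrow>rs. [:- r, 1:]) dvd f - s ^ 2"
    using sqrt_mod_linear_factors[of rs f] assms(3) by blast
  then have s: "g dvd f - s ^ 2" using g by (simp add: smult_dvd_iff)
  have "f - (s mod g) ^ 2 = (f - s ^ 2) + (s - s mod g) * (s + s mod g)"
    by (simp add: power2_eq_square algebra_simps)
  moreover have "g dvd s - s mod g" by (metis dvd_minus_mod)
  ultimately have "g dvd f - (s mod g) ^ 2" using s by (metis dvd_add dvd_mult2)
  moreover have "degree (s mod g) < degree g"
    using degree_mod_less[OF \<open>g \<noteq> 0\<close>, of s] assms(2) by auto
  ultimately show ?thesis by blast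
qed

section \<open>The polynomials \<open>h(a - t e)\<close>\<close>

lemma poly_hae: "poly (hae h a e) t = mpeval h (\<lambda>i. a i - t * e i)"
  by (simp add: hae_def mpeval_def poly_sum poly_prod)

lemma polyfam_hae: "polyfam (\<lambda>a. hae h a e)"
  unfolding hae_def
  by (intro polyfam_sum polyfam_smult polyfam_prod polyfam_power polyfam_pCons polyfun_const polyfun_coord
      polyfam_const)

lemma mpeval_homogeneous:
  assumes "homogeneous_of_degree h d"
  shows "mpeval h (\<lambda>i. s * x i) = s ^ d * mpeval h x"
proof -
  have "(\<Prod>i\<in>UNIV. (s * x i) ^ Poly_Mapping.lookup m i) = s ^ d * (\<Prod>i\<in>UNIV. x i ^ Poly_Mapping.lookup m i)"
    if "m \<in> Poly_Mapping.keys h" for m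
    using assms that by (auto simp: homogeneous_of_degree_def power_mult_distrib prod.distrib power_sum)
  then show ?thesis by (simp add: mpeval_def sum_distrib_left mult_ac)
qed

text \<open>Some b i may be zero, so the coefficient is taken at the formal degree, which need not
  be the actual one.\<close>

lemma degree_prod_linear_powers:
  fixes a b :: "'n::finite \<Rightarrow> real"
  shows "degree (\<Prod>i\<in>I. [:a i, b i:] ^ l i) \<le> (\<Sum>i\<in>I. l i)"
    and "coeff (\<Prod>i\<in>I. [:a i, b i:] ^ l i) (\<Sum>i\<in>I. l i) = (\<Prod>i\<in>I. b i ^ l i)"
proof -
  have lin: "degree ([:a i, b i:] ^ k) \<le> k \<and> coeff ([:a i, b i:] ^ k) k = b i ^ k" for i k
  proof (induction k)
    case (Suc k)
    have "degree [:a i, b i:] \<le> 1" by simp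
    then have "degree ([:a i, b i:] * [:a i, b i:] ^ k) \<le> 1 + k"
      using Suc degree_mult_le[of "[:a i, b i:]" "[:a i, b i:] ^ k"] by linarith
    moreover have "coeff ([:a i, b i:] * [:a i, b i:] ^ k) (Suc k) = b i * coeff ([:a i, b i:] ^ k) k"
      using Suc by (simp add: coeff_pCons coeff_eq_0)
    ultimately show ?case using Suc by simp
  qed simp
  have "degree (\<Prod>i\<in>I. [:a i, b i:] ^ l i) \<le> (\<Sum>i\<in>I. l i) \<and>
    coeff (\<Prod>i\<in>I. [:a i, b i:] ^ l i) (\<Sum>i\<in>I. l i) = (\<Prod>i\<in>I. b i ^ l i)"
  proof (induction I rule: infinite_finite_induct)
    case (insert j I)
    let ?p = "[:a j, b j:] ^ l j" and ?q = "\<Prod>i\<in>I. [:a i, b i:] ^ l i"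
    have d: "degree ?p \<le> l j" "degree ?q \<le> (\<Sum>i\<in>I. l i)" using lin insert by auto
    have "coeff (?p * ?q) (l j + (\<Sum>i\<in>I. l i)) =
        (\<Sum>k\<le>l j + (\<Sum>i\<in>I. l i). if k = l j then coeff ?p k * coeff ?q (l j + (\<Sum>i\<in>I. l i) - k) else 0)"
      unfolding coeff_mult
    proof (rule sum.cong)
      fix k
      show "coeff ?p k * coeff ?q (l j + (\<Sum>i\<in>I. l i) - k) =
        (if k = l j then coeff ?p k * coeff ?q (l j + (\<Sum>i\<in>I. l i) - k) else 0)"
        using d by (cases k "l j" rule: linorder_cases) (auto simp: coeff_eq_0)
    qed simp
    then have "coeff (?p * ?q) (l j + (\<Sum>i\<in>I. l i)) = b j ^ l j * (\<Prod>i\<in>I. b i ^ l i)"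
      using lin insert by simp
    moreover have "degree (?p * ?q) \<le> l j + (\<Sum>i\<in>I. l i)"
      using degree_mult_le[of ?p ?q] d by linarith
    ultimately show ?case using insert by simp
  qed auto
  then show "degree (\<Prod>i\<in>I. [:a i, b i:] ^ l i) \<le> (\<Sum>i\<in>I. l i)"
    and "coeff (\<Prod>i\<in>I. [:a i, b i:] ^ l i) (\<Sum>i\<in>I. l i) = (\<Prod>i\<in>I. b i ^ l i)" by auto
qed

lemma hae_degree_coeff:
  assumes "homogeneous_of_degree h d"
  shows "degree (hae h a e) \<le> d" "coeff (hae h a e) d = (- 1) ^ d * mpeval h e"
proof -
  have *: "(\<Sum>i\<in>UNIV. Poly_Mapping.lookup m i) = d" if "m \<in> Poly_Mapping.keys h" for m
    using assms that by (auto simp: homogeneous_of_degree_def)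
  show "degree (hae h a e) \<le> d"
    unfolding hae_def
    using degree_prod_linear_powers(1)[of a "\<lambda>i. - e i"] *
    by (intro degree_sum_le) (auto intro: order_trans[OF degree_smult_le])
  have "coeff (hae h a e) d = mpeval h (\<lambda>i. - e i)"
    unfolding hae_def mpeval_def coeff_sum coeff_smult
  proof (rule sum.cong)
    fix m assume "m \<in> Poly_Mapping.keys h"
    then show "Poly_Mapping.lookup h m * coeff (\<Prod>i\<in>UNIV. [:a i, - e i:] ^ Poly_Mapping.lookup m i) d =
      Poly_Mapping.lookup h m * (\<Prod>i\<in>UNIV. (- e i) ^ Poly_Mapping.lookup m i)"
      using degree_prod_linear_powers(2)[of a "\<lambda>i. - e i" "Poly_Mapping.lookup m" UNIV] * by simp
  qed simp
  then show "coeff (hae h a e) d = (- 1) ^ d * mpeval h e"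
    using mpeval_homogeneous[OF assms, of "- 1" e] by simp
qed

locale hyperbolic_poly =
  fixes h :: "'n::finite mpoly" and e :: "'n \<Rightarrow> real" and d :: nat
  assumes homogeneous: "homogeneous_of_degree h d"
    and hyperbolic: "hyperbolic h e"
    and d_pos: "d > 0"
begin

abbreviation "g a \<equiv> hae h a e"

lemma h_e: "mpeval h e \<noteq> 0"
  using hyperbolic by (simp add: hyperbolic_def)

lemma degree_g: "degree (g a) = d"
  using hae_degree_coeff[OF homogeneous, of a e] h_e
  by (metis le_antisym le_degree mult_eq_0_iff power_eq_0_iff zero_neq_neg_one)

lemma lead_g: "coeff (g a) d = (- 1) ^ d * mpeval h e"
  using hae_degree_coeff(2)[OF homogeneous] .

lemma g_nonzero: "g a \<noteq> 0"
  using degree_g[of a] d_pos by auto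

lemma real_rooted_g: "real_rooted (g a)"
  using hyperbolic by (simp add: hyperbolic_def real_rooted_def)

lemma Lambda_iff: "a \<in> Lambda h e \<longleftrightarrow> (\<forall>t. poly (g a) t = 0 \<longrightarrow> t \<ge> 0)"
proof
  assume "a \<in> Lambda h e"
  then show "\<forall>t. poly (g a) t = 0 \<longrightarrow> t \<ge> 0"
    unfolding Lambda_def by (metis (mono_tags, lifting) Re_complex_of_real cpoly_of_real mem_Collect_eq of_real_0)
next
  assume *: "\<forall>t. poly (g a) t = 0 \<longrightarrow> t \<ge> 0"
  have "z \<in> \<real> \<and> Re z \<ge> 0" if "poly (map_poly complex_of_real (g a)) z = 0" for z
  proof -
    have "z \<in> \<real>" using real_rooted_g that by (simp add: real_rooted_def)
    then obtain t where "z = complex_of_real t" by (auto simp: Reals_def)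
    then show ?thesis using * that by (auto simp: cpoly_of_real)
  qed
  then show "a \<in> Lambda h e" by (simp add: Lambda_def)
qed

lemma poly_g_shift: "poly (g (\<lambda>i. a i + s * e i)) t = poly (g a) (t - s)"
  by (simp add: poly_hae algebra_simps)

lemma poly_g_zero: "poly (g (\<lambda>i. 0)) t = (- t) ^ d * mpeval h e"
  using mpeval_homogeneous[OF homogeneous, of "- t" e] by (simp add: poly_hae)

end

section \<open>Hankel determinants and irreducibility\<close>

lemma det_mat_zero_iff:
  fixes f :: "nat \<Rightarrow> nat \<Rightarrow> 'a::field"
  shows "det (mat n n (\<lambda>(i, j). f i j)) = 0 \<longleftrightarrow>
    (\<exists>c. (\<exists>j<n. c j \<noteq> 0) \<and> (\<forall>i<n. (\<Sum>j<n. f i j * c j) = 0))" (is "?L \<longleftrightarrow> ?R")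
proof -
  let ?A = "mat n n (\<lambda>(i, j). f i j)"
  have A: "?A \<in> carrier_mat n n" by simp
  have mv: "?A *\<^sub>v vec n c = 0\<^sub>v n \<longleftrightarrow> (\<forall>i<n. (\<Sum>j<n. f i j * c j) = 0)" for c
    by (auto simp: vec_eq_iff scalar_prod_def atLeast0LessThan)
  have vz: "vec n c \<noteq> 0\<^sub>v n \<longleftrightarrow> (\<exists>j<n. c j \<noteq> 0)" for c :: "nat \<Rightarrow> 'a"
    by (auto simp: vec_eq_iff)
  show ?thesis
  proof
    assume ?L
    then obtain v where v: "v \<in> carrier_vec n" "v \<noteq> 0\<^sub>v n" "?A *\<^sub>v v = 0\<^sub>v n"
      using det_0_iff_vec_prod_zero_field[OF A] by blast
    have "v = vec n (\<lambda>i. v $ i)" using v(1) by auto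
    then show ?R using v(2,3) mv vz by metis
  next
    assume ?R
    then obtain c where "vec n c \<noteq> 0\<^sub>v n" "?A *\<^sub>v vec n c = 0\<^sub>v n" using mv vz by metis
    then show ?L using det_0_iff_vec_prod_zero_field[OF A] vec_carrier by blast
  qed
qed

text \<open>Lagrange interpolation at the nodes 0, ..., r. The basis l does not depend on f, so
  polynomial dependence on a parameter passes from values to coefficients.\<close>

lemma poly_coeffs_from_values:
  "\<exists>l :: nat \<Rightarrow> real poly. \<forall>f. degree f \<le> r \<longrightarrow> f = (\<Sum>y\<le>r. smult (poly f (real y)) (l y))"
proof -
  define b where "b y = (\<Prod>z\<in>{..r} - {y}. [:- real z, 1:])" for y
  define l where "l y = smult (1 / poly (b y) (real y)) (b y)" for y
  have bnz: "poly (b y) (real y) \<noteq> 0" for y by (auto simp: b_def poly_prod)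
  have bz: "poly (b y) (real z) = 0" if "z \<le> r" "z \<noteq> y" for y z
    using that by (auto simp: b_def poly_prod)
  have db: "degree (b y) \<le> r" if "y \<le> r" for y
    using that degree_prod_sum_le[of "{..r} - {y}" "\<lambda>z. [:- real z, 1:]"] by (simp add: b_def)
  have "f = (\<Sum>y\<le>r. smult (poly f (real y)) (l y))" if f: "degree f \<le> r" for f
  proof (rule poly_eqI_degree[of "real ` {..r}"])
    fix x assume "x \<in> real ` {..r}"
    then obtain z where z: "z \<le> r" "x = real z" by auto
    have "poly (\<Sum>y\<le>r. smult (poly f (real y)) (l y)) x = (\<Sum>y\<le>r. if y = z then poly f x else 0)"
      unfolding poly_sum
      by (rule sum.cong) (use z bnz bz in \<open>auto simp: l_def\<close>)
    then show "poly f x = poly (\<Sum>y\<le>r. smult (poly f (real y)) (l y)) x" using z by simp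
  next
    have "degree (smult (poly f (real y)) (l y)) \<le> r" if "y \<le> r" for y
      using db[OF that] unfolding l_def by (metis degree_smult_le order_trans)
    then have "degree (\<Sum>y\<le>r. smult (poly f (real y)) (l y)) \<le> r"
      by (intro degree_sum_le) auto
    then show "degree (\<Sum>y\<le>r. smult (poly f (real y)) (l y)) < card (real ` {..r})"
      by (simp add: card_image)
    show "degree f < card (real ` {..r})" using f by (simp add: card_image)
  qed
  then show ?thesis by blast
qed

lemma prod_list_minus:
  fixes y :: "'a::comm_ring_1"
  shows "(\<Prod>r\<leftarrow>rs. r - y) = (- 1) ^ length rs * poly (\<Prod>r\<leftarrow>rs. [:- r, 1:]) y"
  by (induction rs) (simp_all add: algebra_simps)

lemma prod_list_linear_factors:
  fixes rs :: "'a::idom list"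
  shows "degree (\<Prod>r\<leftarrow>rs. [:- r, 1:]) = length rs" "lead_coeff (\<Prod>r\<leftarrow>rs. [:- r, 1:]) = 1"
proof -
  have *: "lead_coeff (\<Prod>r\<leftarrow>rs. [:- r, 1:]) = 1" for rs :: "'a list"
  proof (induction rs)
    case (Cons r rs)
    have "lead_coeff ([:- r, 1:] * (\<Prod>r\<leftarrow>rs. [:- r, 1:])) = 1"
      by (subst lead_coeff_mult, subst Cons) simp
    then show ?case by simp
  qed simp
  then show "lead_coeff (\<Prod>r\<leftarrow>rs. [:- r, 1:]) = 1" .
  show "degree (\<Prod>r\<leftarrow>rs. [:- r, 1:]) = length rs"
  proof (induction rs)
    case (Cons r rs)
    have "(\<Prod>r\<leftarrow>rs. [:- r, 1:]) \<noteq> 0"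
      using *[of rs] by auto
    then have "degree ([:- r, 1:] * (\<Prod>r\<leftarrow>rs. [:- r, 1:])) = length (r # rs)"
      using Cons by (subst degree_mult_eq) auto
    then show ?case by simp
  qed simp
qed

section \<open>Positive functionals on the quotients of R[t] by h(a - t e)\<close>

text \<open>The commutative trace of the noncommutative functional: at each point a, a positive
  functional on polynomials in a . z, with moments that are polynomial in a.\<close>

locale hankel_family = hyperbolic_poly h e d
  for h :: "'n::finite mpoly" and e d +
  fixes L :: "('n \<Rightarrow> real) \<Rightarrow> real poly \<Rightarrow> real"
  assumes L_add: "L a (p + q) = L a p + L a q"
    and L_smult: "L a (smult c p) = c * L a p"
    and L_g: "L a (hae h a e * q) = 0"
    and L_square: "L a (p * p) \<ge> 0"
    and L_one: "L a 1 = 1"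
    and L_polyfun: "polyfun (\<lambda>a. L a (monom 1 j))"
begin

lemma L_zero [simp]: "L a 0 = 0"
  using L_smult[of a 0 0] by simp

lemma L_sum: "L a (\<Sum>i\<in>I. f i) = (\<Sum>i\<in>I. L a (f i))"
  by (induction I rule: infinite_finite_induct) (auto simp: L_add)

lemma L_expand: "L a p = (\<Sum>i\<le>degree p. coeff p i * L a (monom 1 i))"
proof -
  have "L a p = L a (\<Sum>i\<le>degree p. smult (coeff p i) (monom 1 i))"
    by (subst poly_as_sum_of_monoms[of p, symmetric]) (simp add: smult_monom)
  then show ?thesis by (simp add: L_sum L_smult)
qed

lemma L_polyfun_fixed: "polyfun (\<lambda>a. L a p)"
  by (subst L_expand) (intro polyfun_sum polyfun_mult polyfun_const L_polyfun)

text \<open>The radical of the bilinear form (f, q) \<mapsto> L(f q), an ideal of R[t].\<close>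

definition kernel :: "('n \<Rightarrow> real) \<Rightarrow> real poly set" where
  "kernel a = {f. \<forall>q. L a (f * q) = 0}"

lemma kernel_mult: "f \<in> kernel a \<Longrightarrow> f * q \<in> kernel a"
  by (simp add: kernel_def mult.assoc)

lemma L_diff: "L a (p - q) = L a p - L a q"
  using L_add[of a "p - q" q] by simp

lemma kernel_diff: "f \<in> kernel a \<Longrightarrow> f' \<in> kernel a \<Longrightarrow> f - f' \<in> kernel a"
  by (simp add: kernel_def left_diff_distrib L_diff)

lemma g_kernel: "g a \<in> kernel a"
  by (simp add: kernel_def L_g)

text \<open>Cauchy-Schwarz: if L(f f) = 0, the nonnegative number L((q + c f)^2) is affine in c, so
  its slope 2 L(f q) vanishes.\<close>

lemma kernel_of_square_zero:
  assumes "L a (f * f) = 0"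
  shows "f \<in> kernel a"
proof -
  have "L a (f * q) = 0" for q
  proof -
    have nn: "0 \<le> L a (q * q) + c * (2 * L a (f * q))" for c
    proof -
      have "(q + smult c f) * (q + smult c f) = q * q + (smult (2 * c) (f * q) + smult (c * c) (f * f))"
        unfolding poly_eq_poly_eq_iff[symmetric] fun_eq_iff by (simp add: algebra_simps)
      then show ?thesis
        using L_square[of a "q + smult c f"] assms by (simp only: L_add L_smult)
    qed
    show ?thesis
    proof (rule ccontr)
      assume "L a (f * q) \<noteq> 0"
      then show False using nn[of "- (L a (q * q) + 1) / (2 * L a (f * q))"] by (simp add: field_simps)
    qed
  qed
  then show ?thesis by (simp add: kernel_def)
qed

definition hankel :: "nat \<Rightarrow> ('n \<Rightarrow> real) \<Rightarrow> real" where
  "hankel r a = det (mat r r (\<lambda>(i, j). L a (monom 1 (i + j))))"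

lemma polyfun_hankel: "polyfun (hankel r)"
  unfolding hankel_def by (rule polyfun_det) (rule L_polyfun)

text \<open>A null vector of the Hankel matrix gives f of degree below r that is orthogonal only to
  degrees below r. But then L(f f) = 0, and positivity makes f orthogonal to everything.\<close>

lemma hankel_zero_iff:
  "hankel r a = 0 \<longleftrightarrow> (\<exists>f. f \<noteq> 0 \<and> f \<in> kernel a \<and> degree f < r)"
proof
  assume "hankel r a = 0"
  then obtain c j where c: "j < r" "c j \<noteq> 0" "\<And>i. i < r \<Longrightarrow> (\<Sum>j<r. L a (monom 1 (i + j)) * c j) = 0"
    unfolding hankel_def det_mat_zero_iff by blast
  define f where "f = (\<Sum>j<r. monom (c j) j)"
  have coeff_f: "coeff f i = (if i < r then c i else 0)" for i
    by (auto simp: f_def coeff_sum)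
  have "f \<noteq> 0" using c(1,2) coeff_f by (metis coeff_0)
  have deg: "degree f < r"
    using c(1) coeff_f degree_le[of "r - 1" f] by (cases r) auto
  have Li: "L a (monom 1 i * f) = 0" if "i < r" for i
  proof -
    have "monom 1 i * f = (\<Sum>j<r. smult (c j) (monom 1 (i + j)))"
      by (simp add: f_def sum_distrib_left mult_monom smult_monom)
    then show ?thesis using c(3)[OF that] by (simp add: L_sum L_smult mult.commute)
  qed
  have "f * f = (\<Sum>i<r. monom (c i) i * f)"
    by (simp add: f_def sum_distrib_right)
  also have "\<dots> = (\<Sum>i<r. smult (c i) (monom 1 i * f))"
    by (rule sum.cong) (auto simp: smult_monom simp flip: mult_smult_left)
  finally have "f * f = (\<Sum>i<r. smult (c i) (monom 1 i * f))" .
  then have "L a (f * f) = 0" using Li by (simp add: L_sum L_smult)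
  then show "\<exists>f. f \<noteq> 0 \<and> f \<in> kernel a \<and> degree f < r"
    using \<open>f \<noteq> 0\<close> deg kernel_of_square_zero by blast
next
  assume "\<exists>f. f \<noteq> 0 \<and> f \<in> kernel a \<and> degree f < r"
  then obtain f where f: "f \<noteq> 0" "f \<in> kernel a" "degree f < r" by blast
  have fs: "f = (\<Sum>j<r. monom (coeff f j) j)"
    by (rule poly_eqI) (use f(3) in \<open>auto simp: coeff_sum coeff_eq_0\<close>)
  have "(\<Sum>j<r. L a (monom 1 (i + j)) * coeff f j) = L a (monom 1 i * f)" for i
  proof -
    have "monom 1 i * f = (\<Sum>j<r. smult (coeff f j) (monom 1 (i + j)))"
      by (subst fs) (simp add: sum_distrib_left mult_monom smult_monom)
    then show ?thesis by (simp add: L_sum L_smult mult.commute)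
  qed
  also have "L a (monom 1 i * f) = 0" for i
  proof -
    have "L a (f * monom 1 i) = 0" using f(2) unfolding kernel_def by blast
    then show ?thesis by (subst mult.commute)
  qed
  finally have "(\<Sum>j<r. L a (monom 1 (i + j)) * coeff f j) = 0" for i .
  moreover have "coeff f (degree f) \<noteq> 0" using f(1) by simp
  ultimately show "hankel r a = 0"
    unfolding hankel_def det_mat_zero_iff using f(3) by blast
qed

text \<open>In the Newton basis attached to the roots of a generator of the kernel, multiplication by
  \<open>t - y\<close> is triangular.\<close>

lemma hankel_weighted:
  assumes F: "F \<in> kernel a" "degree F = r" "lead_coeff F = 1" "real_rooted F"
  shows "det (mat r r (\<lambda>(i, j). L a (monom 1 (i + j) * [:- y, 1:] ^ k))) =
    hankel r a * ((- 1) ^ r * poly F y) ^ k"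
proof -
  obtain c rs where crs: "F = smult c (\<Prod>r\<leftarrow>rs. [:- r, 1:])"
    using real_rooted_split[OF F(4)] F(3) by fastforce
  note lead_prod = prod_list_linear_factors[where 'a = real]
  have "c = 1" using F(3) lead_prod[of rs] unfolding crs lead_coeff_smult by simp
  then have Frs: "F = (\<Prod>r\<leftarrow>rs. [:- r, 1:])" using crs by simp
  have len: "length rs = r" using F(2) lead_prod[of rs] Frs by simp
  define p where "p j = (\<Prod>r\<leftarrow>take j rs. [:- r, 1:])" for j
  have p_deg: "degree (p j) = j" "coeff (p j) j = 1" if "j \<le> r" for j
  proof -
    show "degree (p j) = j" using lead_prod(1)[of "take j rs"] that len by (simp add: p_def)
    then show "coeff (p j) j = 1" using lead_prod(2)[of "take j rs"] by (simp add: p_def)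
  qed
  have p_Suc: "p (Suc j) = p j * [:- (rs ! j), 1:]" if "j < r" for j
    using that len by (simp add: p_def take_Suc_conv_app_nth del: mult_pCons_right)
  have p_r: "p r = F" using len by (simp add: p_def Frs)
  define w where "w = [:- y, 1:]"
  define X where "X k = mat r r (\<lambda>(i, j). L a (monom 1 i * p j * w ^ k))" for k
  define H where "H k = mat r r (\<lambda>(i, j). L a (monom 1 (i + j) * w ^ k))" for k
  define U where "U = mat r r (\<lambda>(l, j). coeff (p j) l)"
  define T where "T = mat r r (\<lambda>(l, j). if l = j then rs ! j - y else if l = Suc j then 1 else 0)"
  \<comment> \<open>Only the columns pass to the Newton basis, the rows keep the monomials. The
    change of basis is unitriangular, so the determinant stays the same.\<close>
  have "H k * U = X k" for k
  proof (rule eq_matI)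
    fix i j assume "i < dim_row (X k)" "j < dim_col (X k)"
    then have ij: "i < r" "j < r" by (auto simp: X_def)
    have "p j = (\<Sum>l<r. monom (coeff (p j) l) l)"
      by (rule poly_eqI) (use p_deg(1)[of j] ij in \<open>auto simp: coeff_sum coeff_eq_0\<close>)
    then have "monom 1 i * p j * w ^ k = monom 1 i * (\<Sum>l<r. monom (coeff (p j) l) l) * w ^ k" by simp
    also have "\<dots> = (\<Sum>l<r. monom (coeff (p j) l) (i + l) * w ^ k)"
      by (simp add: sum_distrib_left sum_distrib_right mult_monom)
    also have "\<dots> = (\<Sum>l<r. smult (coeff (p j) l) (monom 1 (i + l) * w ^ k))"
      by (rule sum.cong) (auto simp: smult_monom simp flip: mult_smult_left)
    finally have "L a (monom 1 i * p j * w ^ k) = (\<Sum>l<r. coeff (p j) l * L a (monom 1 (i + l) * w ^ k))"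
      by (simp add: L_sum L_smult)
    then show "(H k * U) $$ (i, j) = X k $$ (i, j)"
      using ij by (simp add: H_def U_def X_def scalar_prod_def atLeast0LessThan mult.commute)
  qed (auto simp: H_def U_def X_def)
  moreover have "det U = 1"
  proof -
    have "upper_triangular U"
      unfolding upper_triangular_def U_def using p_deg(1) by (auto simp: coeff_eq_0)
    then have "det U = prod_list (diag_mat U)" by (rule det_upper_triangular[of _ r]) (simp add: U_def)
    also have "\<dots> = 1" using p_deg(2) by (simp add: prod_list_diag_prod U_def)
    finally show ?thesis .
  qed
  ultimately have HX: "det (H k) = det (X k)" for k
    using det_mult[of "H k" r U] by (simp add: H_def U_def)
  \<comment> \<open>The recursion is (t - y) p_j = (r_j - y) p_j + p_{j+1}. In the last column p_r =
    F appears, which the form annihilates.\<close>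
  have "X (Suc k) = X k * T" for k
  proof (rule eq_matI)
    fix i j assume "i < dim_row (X k * T)" "j < dim_col (X k * T)"
    then have ij: "i < r" "j < r" by (auto simp: X_def T_def)
    have "(X k * T) $$ (i, j) = (\<Sum>l<r. L a (monom 1 i * p l * w ^ k) *
        (if l = j then rs ! j - y else if l = Suc j then 1 else 0))"
      using ij by (simp add: X_def T_def scalar_prod_def atLeast0LessThan)
    also have "\<dots> = (\<Sum>l<r. (if l = j then (rs ! j - y) * L a (monom 1 i * p j * w ^ k) else 0) +
        (if l = Suc j then L a (monom 1 i * p (Suc j) * w ^ k) else 0))"
      by (rule sum.cong) auto
    also have "\<dots> = (rs ! j - y) * L a (monom 1 i * p j * w ^ k) +
        (if Suc j < r then L a (monom 1 i * p (Suc j) * w ^ k) else 0)"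
      using ij by (simp add: sum.distrib)
    also have "(if Suc j < r then L a (monom 1 i * p (Suc j) * w ^ k) else 0) =
        L a (monom 1 i * p (Suc j) * w ^ k)"
    proof (cases "Suc j < r")
      case False
      then have "p (Suc j) = F" using ij p_r by (metis Suc_lessI)
      then have "L a (monom 1 i * p (Suc j) * w ^ k) = L a (F * (monom 1 i * w ^ k))"
        by (simp add: mult_ac)
      then show ?thesis using False F(1) by (simp add: kernel_def)
    qed simp
    also have "(rs ! j - y) * L a (monom 1 i * p j * w ^ k) + L a (monom 1 i * p (Suc j) * w ^ k) =
        L a (smult (rs ! j - y) (monom 1 i * p j * w ^ k) + monom 1 i * p (Suc j) * w ^ k)"
      by (simp only: L_add L_smult)
    also have "smult (rs ! j - y) (monom 1 i * p j * w ^ k) + monom 1 i * p (Suc j) * w ^ k =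
        monom 1 i * p j * w ^ Suc k"
      unfolding p_Suc[OF ij(2)] poly_eq_poly_eq_iff[symmetric] fun_eq_iff w_def
        poly_add poly_smult poly_mult power_Suc by (simp add: algebra_simps)
    finally show "X (Suc k) $$ (i, j) = (X k * T) $$ (i, j)"
      using ij by (simp add: X_def)
  qed (auto simp: X_def T_def)
  then have XT: "det (X (Suc k)) = det (X k) * det T" for k
    using det_mult[of "X k" r T] by (simp add: X_def T_def)
  have detX: "det (X k) = det (X 0) * det T ^ k" for k
    by (induction k) (auto simp: XT)
  have detT: "det T = (- 1) ^ r * poly F y"
  proof -
    have "det T = prod_list (diag_mat T)"
      by (rule det_lower_triangular[of r]) (auto simp: T_def)
    also have "diag_mat T = map (\<lambda>r. r - y) rs"
      by (rule nth_equalityI) (use len in \<open>auto simp: diag_mat_def T_def\<close>)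
    also have "prod_list \<dots> = (- 1) ^ length rs * poly (\<Prod>r\<leftarrow>rs. [:- r, 1:]) y"
      by (rule prod_list_minus)
    finally show ?thesis unfolding len Frs .
  qed
  have "det (H 0) = hankel r a" by (simp add: H_def hankel_def)
  then have "det (H k) = hankel r a * ((- 1) ^ r * poly F y) ^ k"
    unfolding HX detX[of k] detT by simp
  then show ?thesis unfolding H_def w_def .
qed

text \<open>Otherwise h(a - t e) factors with coefficients polynomial in a, and t = 0 turns this
  into a factorization h = u v.\<close>

lemma hankel_not_identically_zero:
  assumes irr: "irreducible h"
  shows "\<exists>a. hankel d a \<noteq> 0"
proof (rule ccontr)
  assume "\<nexists>a. hankel d a \<noteq> 0"
  then have d0: "\<forall>a. hankel d a = 0" by simp
  \<comment> \<open>The least size with identically vanishing determinant exceeds by one the degree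
    of a kernel generator at a generic point.\<close>
  define r' where "r' = (LEAST r. \<forall>a. hankel r a = 0)"
  have r'0: "hankel r' a = 0" for a
    using LeastI[of "\<lambda>r. \<forall>a. hankel r a = 0" d] d0 unfolding r'_def by blast
  have "r' \<le> d" unfolding r'_def by (rule Least_le) (rule d0)
  \<comment> \<open>Since L 1 = 1, no nonzero constant lies in the kernel; this gives the factor
    positive degree.\<close>
  have const_kernel: "f = 0" if f: "degree f = 0" "f \<in> kernel a" for f a
  proof -
    obtain c where c: "f = [:c:]" using degree_eq_zeroE[OF f(1)] by blast
    have "L a (f * 1) = 0" using f(2) unfolding kernel_def by blast
    moreover have "f * 1 = smult c 1" by (simp add: c)
    ultimately have "c * 1 = 0" using L_smult[of a c 1] L_one[of a] by metis
    then show ?thesis using c by simp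
  qed
  have "r' \<ge> 2"
  proof (rule ccontr)
    assume "\<not> r' \<ge> 2"
    obtain f where f: "f \<noteq> 0" "f \<in> kernel undefined" "degree f < r'"
      using r'0[of undefined] hankel_zero_iff by blast
    have "degree f = 0" using f(3) \<open>\<not> r' \<ge> 2\<close> by linarith
    then show False using const_kernel f by blast
  qed
  define r where "r = r' - 1"
  have r: "r \<ge> 1" "r < d" "Suc r = r'" using \<open>r' \<ge> 2\<close> \<open>r' \<le> d\<close> by (auto simp: r_def)
  obtain a0 where a0: "hankel r a0 \<noteq> 0"
  proof -
    have "r < (LEAST r. \<forall>a. hankel r a = 0)" using r(3) unfolding r'_def by linarith
    then show ?thesis using not_less_Least[of r "\<lambda>r. \<forall>a. hankel r a = 0"] that by blast
  qed
  \<comment> \<open>Where the determinant of size r is nonzero, r is the least degree of a nonzero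
    kernel element, so the remainder of \<open>g a\<close> modulo a kernel element of degree r must
    vanish.\<close>
  have "\<exists>F. F \<in> kernel a \<and> degree F = r \<and> lead_coeff F = 1 \<and> F dvd g a" if a: "hankel r a \<noteq> 0" for a
  proof -
    obtain f where f: "f \<noteq> 0" "f \<in> kernel a" "degree f < r'"
      using r'0[of a] by (auto simp: hankel_zero_iff)
    have small: "q = 0" if "q \<in> kernel a" "degree q < r" for q
      using a that by (auto simp: hankel_zero_iff)
    have "degree f = r" using small[OF f(2)] f(1,3) r(3) by linarith
    define F where "F = smult (1 / lead_coeff f) f"
    have "lead_coeff f \<noteq> 0" using f(1) by simp
    then have F: "F \<in> kernel a" "degree F = r" "lead_coeff F = 1"
      using kernel_mult[OF f(2), of "[:1 / lead_coeff f:]"] \<open>degree f = r\<close>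
      unfolding F_def by (simp_all del: leading_coeff_0_iff)
    have "F \<noteq> 0" using F(3) by auto
    have "g a mod F = g a - F * (g a div F)" by (simp add: minus_mult_div_eq_mod)
    then have "g a mod F \<in> kernel a"
      using kernel_diff[OF g_kernel kernel_mult[OF F(1)]] by simp
    moreover have "g a mod F = 0 \<or> degree (g a mod F) < r"
      using degree_mod_less[OF \<open>F \<noteq> 0\<close>] F(2) by auto
    ultimately have "g a mod F = 0" using small by blast
    then have "F dvd g a" by (rule dvd_eq_mod_eq_0[THEN iffD2])
    then show ?thesis using F by blast
  qed
  then have "\<forall>a. \<exists>F. hankel r a \<noteq> 0 \<longrightarrow> F \<in> kernel a \<and> degree F = r \<and> lead_coeff F = 1 \<and> F dvd g a"
    by blast
  from choice[OF this] obtain F where F: "\<And>a. hankel r a \<noteq> 0 \<Longrightarrow> F a \<in> kernel a \<and>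
      degree (F a) = r \<and> lead_coeff (F a) = 1 \<and> F a dvd g a"
    by blast
  \<comment> \<open>Hyperbolicity passes to the factor, whose real roots carry the Newton basis of
    the weighted determinant formula.\<close>
  have F_rr: "real_rooted (F a)" if a: "hankel r a \<noteq> 0" for a
  proof -
    obtain q where q: "g a = F a * q" using F[OF a] by blast
    show ?thesis using real_rooted_g[of a] unfolding q by (rule real_rooted_factor)
  qed
  have "\<exists>U. polyfun U \<and> (\<forall>a. hankel r a \<noteq> 0 \<longrightarrow> U a = poly (F a) y)" for y
  proof -
    have "\<exists>U. polyfun U \<and> (\<forall>a. hankel r a \<noteq> 0 \<longrightarrow> U a = (- 1) ^ r * poly (F a) y)"
    proof (rule polyfun_almost_integral[OF polyfun_hankel a0])
      fix k
      have "polyfun (\<lambda>a. det (mat r r (\<lambda>(i, j). L a (monom 1 (i + j) * [:- y, 1:] ^ k))))"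
        by (rule polyfun_det) (rule L_polyfun_fixed)
      then show "\<exists>W. polyfun W \<and> (\<forall>a. hankel r a \<noteq> 0 \<longrightarrow>
          hankel r a * ((- 1) ^ r * poly (F a) y) ^ k = W a)"
        using hankel_weighted F F_rr by (metis (no_types, lifting))
    qed
    then obtain U where "polyfun U" "\<And>a. hankel r a \<noteq> 0 \<Longrightarrow> U a = (- 1) ^ r * poly (F a) y" by blast
    then show ?thesis
      by (intro exI[of _ "\<lambda>a. (- 1) ^ r * U a"])
        (auto simp flip: mult.assoc power_mult_distrib)
  qed
  then obtain U where U: "\<And>y. polyfun (U y)" "\<And>y a. hankel r a \<noteq> 0 \<Longrightarrow> U y a = poly (F a) y"
    by metis
  obtain l :: "nat \<Rightarrow> real poly" where l: "\<And>f. degree f \<le> r \<Longrightarrow> f = (\<Sum>y\<le>r. smult (poly f (real y)) (l y))"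
    using poly_coeffs_from_values by blast
  \<comment> \<open>\<open>G0\<close> extends F from the points with \<open>hankel r a\<close>
    nonzero to all points. That it is monic of degree r and divides \<open>g a\<close> everywhere
    follows from the identity principle.\<close>
  define G0 where "G0 a = (\<Sum>y\<le>r. smult (U (real y) a) (l y))" for a
  have G0: "polyfam G0" unfolding G0_def
    by (intro polyfam_sum polyfam_smult U polyfam_const)
  have G0F: "G0 a = F a" if "hankel r a \<noteq> 0" for a
    using l[of "F a"] F[OF that] U(2)[OF that] by (simp add: G0_def)
  have G0_coeff: "coeff (G0 a) i = (if i = r then 1 else 0)" if "i \<ge> r" for a i
  proof -
    have "polyfun (\<lambda>a. coeff (G0 a) i - (if i = r then 1 else 0))"
      using G0 by (intro polyfun_diff polyfun_const) (auto simp: polyfam_def)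
    then have "coeff (G0 a) i - (if i = r then 1 else 0) = 0"
      by (rule polyfun_zero_of_nonzero_set[OF _ polyfun_hankel a0])
        (use F G0F that in \<open>auto simp: coeff_eq_0\<close>)
    then show ?thesis by simp
  qed
  have G0_deg: "degree (G0 a) = r" for a
  proof (rule antisym)
    show "degree (G0 a) \<le> r" by (rule degree_le) (use G0_coeff[of _ a] in auto)
    show "r \<le> degree (G0 a)" by (rule le_degree) (use G0_coeff[of r a] in auto)
  qed
  define Q0 where "Q0 a = g a div G0 a" for a
  have G0_lead: "coeff (G0 a) r = 1" for a using G0_coeff[of r a] by simp
  have g_deg: "degree (g a) \<le> d" for a using degree_g by simp
  note dm = polyfam_div_mod[OF G0 G0_deg G0_lead one_neq_zero polyfam_hae[of h e] g_deg]
  have Q0: "polyfam Q0" unfolding Q0_def by (rule dm(1))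
  have R0: "polyfam (\<lambda>a. g a mod G0 a)" by (rule dm(2))
  have "coeff (g a mod G0 a) i = 0" for a i
    by (rule polyfun_zero_of_nonzero_set[OF _ polyfun_hankel a0])
      (use R0 G0F F in \<open>auto simp: polyfam_def mod_eq_0_iff_dvd\<close>)
  then have "g a mod G0 a = 0" for a by (simp add: poly_eq_iff)
  then have gQG: "g a = Q0 a * G0 a" for a
    using div_mult_mod_eq[of "g a" "G0 a"] unfolding Q0_def by simp
  have at0: "\<exists>u. \<forall>a. poly (P a) 0 = mpeval u a" if P: "polyfam P" for P :: "('n \<Rightarrow> real) \<Rightarrow> real poly"
  proof -
    obtain u where "(\<lambda>a. coeff (P a) 0) = mpeval u"
      using P unfolding polyfam_def polyfun_def by blast
    then show ?thesis unfolding poly_0_coeff_0 fun_eq_iff by blast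
  qed
  obtain u where u: "\<And>a. poly (Q0 a) 0 = mpeval u a" using at0[OF Q0] by blast
  obtain v where v: "\<And>a. poly (G0 a) 0 = mpeval v a" using at0[OF G0] by blast
  have "mpeval h a = mpeval (u * v) a" for a
    using arg_cong[OF gQG[of a], of "\<lambda>p. poly p 0"] by (simp add: poly_hae mpeval_mult u v)
  then have "h = u * v" by (intro mpeval_inject ext)
  then have "u dvd 1 \<or> v dvd 1" using irr unfolding irreducible_def by blast
  moreover have "\<not> p dvd 1" if "mpeval p x = 0" for p :: "'n mpoly" and x
  proof
    assume "p dvd 1"
    then obtain q where "1 = p * q" by blast
    then have "mpeval p x * mpeval q x = 1" by (metis mpeval_mult mpeval_one)
    then show False using that by simp
  qed
  \<comment> \<open>At a = 0 the product of the two factors is a constant times t^d. Both have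
    positive degree, so both are constants times positive powers of t and vanish at t = 0; hence u
    and v are not units.\<close>
  moreover have "mpeval u (\<lambda>i. 0) = 0 \<and> mpeval v (\<lambda>i. 0) = 0"
  proof -
    let ?o = "\<lambda>i :: 'n. 0 :: real"
    have "g ?o = monom ((- 1) ^ d * mpeval h e) d"
      unfolding poly_eq_poly_eq_iff[symmetric] fun_eq_iff poly_g_zero poly_monom
      by (subst power_minus) (simp add: mult_ac)
    then have "order 0 (g ?o) = d" using h_e by simp
    moreover have nz: "Q0 ?o * G0 ?o \<noteq> 0" using g_nonzero[of ?o] gQG by metis
    ultimately have "order 0 (Q0 ?o) + order 0 (G0 ?o) = d"
      using order_mult[OF nz, of 0] gQG[of ?o] by simp
    moreover have "order 0 (Q0 ?o) \<le> degree (Q0 ?o)" "order 0 (G0 ?o) \<le> r"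
      using order_degree[of "Q0 ?o" 0] order_degree[of "G0 ?o" 0] nz G0_deg[of ?o] by auto
    moreover have "degree (Q0 ?o) + r = d"
      using nz degree_mult_eq[of "Q0 ?o" "G0 ?o"] gQG[of ?o] degree_g[of ?o] G0_deg[of ?o] by auto
    ultimately have "order 0 (Q0 ?o) \<noteq> 0" "order 0 (G0 ?o) \<noteq> 0" using r by linarith+
    then have "poly (Q0 ?o) 0 = 0" "poly (G0 ?o) 0 = 0" using order_root by blast+
    then show ?thesis using u v by simp
  qed
  ultimately show False by blast
qed

end

section \<open>A functional in \<open>F(h,e)\<close> yields a spectrahedral representation\<close>

lemma hgen_eq: "hgen h e a = nc_subst (hae h a e) (nc_lin a)"
  by (simp add: hgen_def)

text \<open>Elements of \<open>Fset\<close> are only constrained on polynomials of degree at most \<open>2 * k\<close>; replacing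
  one by its linear extension from words makes it linear everywhere.\<close>

lemma Fset_lin_ext:
  assumes "\<phi> \<in> Fset h e k" "deg_le (2 * k) p"
  shows "lin_ext (\<lambda>u. \<phi> (Poly_Mapping.single u 1)) p = \<phi> p"
proof -
  have add: "\<phi> (p + q) = \<phi> p + \<phi> q" if "deg_le (2 * k) p" "deg_le (2 * k) q" for p q
    using assms(1) that by (auto simp: Fset_def nc_deg_le_iff)
  have scale: "\<phi> (cst c * p) = c * \<phi> p" if "deg_le (2 * k) p" for c p
    using assms(1) that by (auto simp: Fset_def nc_deg_le_iff nc_scale_eq)
  have zero: "\<phi> 0 = 0" using scale[of 0 0] by simp
  have sum: "\<phi> (\<Sum>i\<in>I. f i) = (\<Sum>i\<in>I. \<phi> (f i))" if "finite I" "\<And>i. i \<in> I \<Longrightarrow> deg_le (2 * k) (f i)" for I and f :: "'b \<Rightarrow> _"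
    using that by induction (auto simp: zero add deg_le_sum)
  have single: "\<phi> (Poly_Mapping.single u c) = c * \<phi> (Poly_Mapping.single u 1)"
    if "length u \<le> 2 * k" for u c
    using scale[of "Poly_Mapping.single u 1" c] that by (simp add: mult_single deg_le_single)
  have "\<phi> p = \<phi> (\<Sum>u\<in>Poly_Mapping.keys p. Poly_Mapping.single u (Poly_Mapping.lookup p u))"
    using poly_mapping_sum_single[of p] by simp
  also have "\<dots> = (\<Sum>u\<in>Poly_Mapping.keys p. \<phi> (Poly_Mapping.single u (Poly_Mapping.lookup p u)))"
    by (rule sum) (use assms(2) in \<open>auto simp: deg_le_def intro!: deg_le_single\<close>)
  also have "\<dots> = (\<Sum>u\<in>Poly_Mapping.keys p. Poly_Mapping.lookup p u * \<phi> (Poly_Mapping.single u 1))"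
    by (intro sum.cong refl single) (use assms(2) in \<open>auto simp: deg_le_def\<close>)
  finally show ?thesis by (simp add: lin_ext_def)
qed

text \<open>The bounds are k = 2 (d - 1) and 2 k = 4 (d - 1). With d \<ge> 2 the product of two
  factors of degree d - 1 with a . z between them, of degree 2 (d - 1) + 1, stays within 2
  k.\<close>

locale truncated_functional = hyperbolic_poly h e d
  for h :: "'n::finite mpoly" and e d +
  fixes c :: "'n list \<Rightarrow> complex" and \<psi>
  defines "\<psi> \<equiv> lin_ext c"
  assumes d_ge: "d \<ge> 2"
    and psi_one: "\<psi> 1 = 1"
    and psi_star: "deg_le (4 * (d - 1)) p \<Longrightarrow> \<psi> (nc_star p) = cnj (\<psi> p)"
    and psi_square: "deg_le (2 * (d - 1)) p \<Longrightarrow> Re (\<psi> (nc_star p * p)) \<ge> 0"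
    and psi_gen: "deg_le (4 * (d - 1)) (p * nc_subst (hae h a e) (nc_lin a) * q) \<Longrightarrow>
      \<psi> (p * nc_subst (hae h a e) (nc_lin a) * q) = 0"
begin

lemma psi_add: "\<psi> (p + q) = \<psi> p + \<psi> q"
  by (simp add: \<psi>_def lin_ext_add)

lemma psi_diff: "\<psi> (p - q) = \<psi> p - \<psi> q"
  by (simp add: \<psi>_def lin_ext_diff)

lemma psi_sum: "\<psi> (\<Sum>i\<in>I. f i) = (\<Sum>i\<in>I. \<psi> (f i))"
  by (simp add: \<psi>_def lin_ext_sum)

lemma psi_scale: "\<psi> (cst s * p) = s * \<psi> p"
  by (simp add: \<psi>_def lin_ext_scale)

lemma psi_dvd:
  assumes "g a dvd f" "deg_le (4 * (d - 1)) (p * nc_subst f (nc_lin a) * q)"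
  shows "\<psi> (p * nc_subst f (nc_lin a) * q) = 0"
proof -
  obtain f' where "f = g a * f'" using assms(1) by blast
  then have "p * nc_subst f (nc_lin a) * q = p * nc_subst (g a) (nc_lin a) * (nc_subst f' (nc_lin a) * q)"
    by (simp add: nc_subst_mult mult.assoc)
  then show ?thesis using psi_gen assms(2) by metis
qed

definition cone :: "('n \<Rightarrow> real) set" where
  "cone = {a. \<forall>p. deg_le (d - 1) p \<longrightarrow> Re (\<psi> (nc_star p * nc_lin a * p)) \<ge> 0}"

lemma psi_lin_add_scale:
  "\<psi> (p * nc_lin (\<lambda>i. a i + s * b i) * q) =
    \<psi> (p * nc_lin a * q) + complex_of_real s * \<psi> (p * nc_lin b * q)"
  by (simp add: nc_lin_add nc_lin_scale ring_distribs psi_add cst_left_commute mult.assoc psi_scale)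

lemma cone_add_scale:
  assumes "a \<in> cone" "b \<in> cone" "s \<ge> 0"
  shows "(\<lambda>i. a i + s * b i) \<in> cone"
  using assms by (auto simp: cone_def psi_lin_add_scale)

lemma Lambda_subset_cone:
  assumes "a \<in> Lambda h e"
  shows "a \<in> cone"
  unfolding cone_def
proof (clarify)
  fix p :: "'n ncpoly" assume p: "deg_le (d - 1) p"
  let ?A = "Re (\<psi> (nc_star p * nc_lin a * p))" and ?E = "Re (\<psi> (nc_star p * nc_lin e * p))"
  \<comment> \<open>Adding \<epsilon> e moves every root up by \<epsilon>. The root 0 has to be
    avoided: t is not a square modulo t^2. Letting \<epsilon> tend to 0 then gives the
    claim.\<close>
  have *: "0 \<le> ?A + \<epsilon> * ?E" if "\<epsilon> > 0" for \<epsilon>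
  proof -
    define a' where "a' = (\<lambda>i. a i + \<epsilon> * e i)"
    have "t > 0" if "poly (g a') t = 0" for t
      using that assms \<open>\<epsilon> > 0\<close> unfolding a'_def poly_g_shift Lambda_iff by force
    then obtain s where s: "degree s < d" "g a' dvd [:0, 1:] - s ^ 2"
      using sqrt_mod_real_rooted[of "g a'" "[:0, 1:]"] real_rooted_g degree_g d_pos by auto
    define S where "S = nc_subst s (nc_lin a')"
    have S: "deg_le (d - 1) S" "nc_star S = S"
      using s(1) by (auto simp: S_def nc_star_subst intro!: deg_le_subst deg_le_lin)
    have sub: "nc_subst ([:0, 1:] - s ^ 2) (nc_lin a') = nc_lin a' - S * S"
      by (simp add: nc_subst_diff nc_subst_X power2_eq_square nc_subst_mult S_def)
    have "deg_le (2 * (d - 1)) (nc_lin a' - S * S)"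
      using d_ge deg_le_mult[OF S(1) S(1)]
      by (intro deg_le_diff deg_le_mono[OF deg_le_lin]) (auto simp: mult_2)
    then have "deg_le ((d - 1) + 2 * (d - 1) + (d - 1)) (nc_star p * (nc_lin a' - S * S) * p)"
      by (intro deg_le_mult deg_le_star p)
    then have "deg_le (4 * (d - 1)) (nc_star p * (nc_lin a' - S * S) * p)"
      by (rule deg_le_mono) simp
    then have "\<psi> (nc_star p * (nc_lin a' - S * S) * p) = 0"
      using psi_dvd[OF s(2), of "nc_star p" p] by (simp only: sub)
    then have "\<psi> (nc_star p * nc_lin a' * p) = \<psi> (nc_star (S * p) * (S * p))"
      by (simp add: nc_star_mult S ring_distribs psi_diff mult.assoc)
    moreover have "deg_le (2 * (d - 1)) (S * p)"
      using deg_le_mult[OF S(1) p] by (simp add: mult_2)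
    ultimately have "0 \<le> Re (\<psi> (nc_star p * nc_lin a' * p))"
      using psi_square by simp
    then show ?thesis by (simp add: a'_def psi_lin_add_scale)
  qed
  show "0 \<le> ?A"
  proof (rule ccontr)
    assume A: "\<not> 0 \<le> ?A"
    define \<epsilon> where "\<epsilon> = - ?A / (2 * (\<bar>?E\<bar> + 1))"
    have "\<epsilon> > 0" using A by (simp add: \<epsilon>_def divide_neg_pos)
    have "\<epsilon> * ?E \<le> \<epsilon> * (\<bar>?E\<bar> + 1)" using \<open>\<epsilon> > 0\<close> by (intro mult_left_mono) auto
    also have "\<dots> = - ?A / 2" by (simp add: \<epsilon>_def field_simps)
    finally show False using *[OF \<open>\<epsilon> > 0\<close>] A by linarith
  qed
qed

text \<open>The matrices \<open>M i\<close> are the Gram matrices of the forms p \<mapsto> \<psi>(p*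
  z_i p) in the basis of words of length at most d - 1; they are hermitian by
  \<open>psi_star\<close>.\<close>

lemma spectrahedral_cone: "spectrahedral cone"
proof -
  define W where "W = {u :: 'n list. length u \<le> d - 1}"
  have "finite W" using finite_lists_length_le[of "UNIV :: 'n set" "d - 1"] by (simp add: W_def)
  then obtain ws where ws: "set ws = W" "distinct ws" using finite_distinct_list by blast
  define m where "m = length ws"
  define M where "M i = mat m m (\<lambda>(r, s). \<psi> (Poly_Mapping.single (rev (ws ! r) @ [i] @ ws ! s) 1))" for i
  have len: "length (ws ! r) \<le> d - 1" if "r < m" for r
    using that ws nth_mem[of r ws] by (auto simp: W_def m_def)
  have herm: "hermitian_mat m (M i)" for i
    unfolding hermitian_mat_def
  proof (intro conjI allI impI)
    fix r s assume rs: "r < m" "s < m"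
    have "deg_le (4 * (d - 1)) (Poly_Mapping.single (rev (ws ! r) @ [i] @ ws ! s) 1)"
      using len[OF rs(1)] len[OF rs(2)] d_ge by (intro deg_le_single) simp
    from psi_star[OF this] show "M i $$ (s, r) = cnj (M i $$ (r, s))"
      using rs by (simp add: M_def)
  qed (simp add: M_def)
  define P where "P v = (\<Sum>s<m. Poly_Mapping.single (ws ! s) (v s))" for v :: "nat \<Rightarrow> complex"
  have degP: "deg_le (d - 1) (P v)" for v
    unfolding P_def by (intro deg_le_sum deg_le_single len) simp
  have P_surj: "\<exists>v. p = P v" if "deg_le (d - 1) p" for p
  proof -
    have "p = (\<Sum>u\<in>Poly_Mapping.keys p. Poly_Mapping.single u (Poly_Mapping.lookup p u))"
      by (rule poly_mapping_sum_single)
    also have "\<dots> = (\<Sum>u\<in>W. Poly_Mapping.single u (Poly_Mapping.lookup p u))"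
    proof (rule sum.mono_neutral_left)
      show "\<forall>u\<in>W - Poly_Mapping.keys p. Poly_Mapping.single u (Poly_Mapping.lookup p u) = 0"
        by (auto simp: not_in_keys_iff_lookup_eq_zero)
    qed (use that \<open>finite W\<close> in \<open>auto simp: W_def deg_le_def\<close>)
    also have "\<dots> = (\<Sum>s<m. Poly_Mapping.single (ws ! s) (Poly_Mapping.lookup p (ws ! s)))"
      unfolding m_def
      using sum.reindex_bij_betw[OF bij_betw_nth[OF ws(2) refl ws(1)[symmetric]],
          of "\<lambda>u. Poly_Mapping.single u (Poly_Mapping.lookup p u)"] by simp
    finally show ?thesis unfolding P_def by (rule exI[of _ "\<lambda>s. Poly_Mapping.lookup p (ws ! s)"])
  qed
  have pencil: "quad_form m (lin_pencil m M a) v = \<psi> (nc_star (P v) * nc_lin a * P v)" for a v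
  proof -
    have "nc_star (P v) * nc_lin a * P v =
      (\<Sum>r<m. \<Sum>s<m. \<Sum>i\<in>UNIV. Poly_Mapping.single (rev (ws ! r)) (cnj (v r)) *
         Poly_Mapping.single [i] (complex_of_real (a i)) * Poly_Mapping.single (ws ! s) (v s))"
      unfolding P_def nc_star_sum nc_lin_def nc_star_single
      by (simp only: sum_product) (simp only: sum_distrib_right)
    then have "\<psi> (nc_star (P v) * nc_lin a * P v) =
      (\<Sum>r<m. \<Sum>s<m. \<Sum>i\<in>UNIV. \<psi> (Poly_Mapping.single (rev (ws ! r)) (cnj (v r)) *
         Poly_Mapping.single [i] (complex_of_real (a i)) * Poly_Mapping.single (ws ! s) (v s)))"
      by (simp only: psi_sum)
    also have "\<dots> = (\<Sum>r<m. \<Sum>s<m. \<Sum>i\<in>UNIV. cnj (v r) * (complex_of_real (a i) * M i $$ (r, s)) * v s)"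
    proof (intro sum.cong refl)
      fix r i s assume "r \<in> {..<m}" "s \<in> {..<m}"
      then show "\<psi> (Poly_Mapping.single (rev (ws ! r)) (cnj (v r)) *
         Poly_Mapping.single [i] (complex_of_real (a i)) * Poly_Mapping.single (ws ! s) (v s)) =
        cnj (v r) * (complex_of_real (a i) * M i $$ (r, s)) * v s"
        by (simp add: mult_single plus_list_def M_def \<psi>_def)
    qed
    also have "\<dots> = quad_form m (lin_pencil m M a) v"
      unfolding quad_form_def
    proof (intro sum.cong refl)
      fix r s assume "r \<in> {..<m}" "s \<in> {..<m}"
      then have "lin_pencil m M a $$ (r, s) = (\<Sum>i\<in>UNIV. complex_of_real (a i) * M i $$ (r, s))"
        by (simp add: lin_pencil_def)
      then show "(\<Sum>i\<in>UNIV. cnj (v r) * (complex_of_real (a i) * M i $$ (r, s)) * v s) =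
          cnj (v r) * lin_pencil m M a $$ (r, s) * v s"
        by (simp only: sum_distrib_left sum_distrib_right)
    qed
    finally show ?thesis ..
  qed
  have "hermitian_mat m (lin_pencil m M a)" for a
    unfolding hermitian_mat_def
  proof (intro conjI allI impI)
    fix r s assume rs: "r < m" "s < m"
    then have "M i $$ (s, r) = cnj (M i $$ (r, s))" for i
      using herm[of i] unfolding hermitian_mat_def by blast
    then have "(\<Sum>i\<in>UNIV. complex_of_real (a i) * M i $$ (s, r)) =
        cnj (\<Sum>i\<in>UNIV. complex_of_real (a i) * M i $$ (r, s))"
      by (simp only: cnj_sum complex_cnj_mult complex_cnj_complex_of_real)
    then show "lin_pencil m M a $$ (s, r) = cnj (lin_pencil m M a $$ (r, s))"
      using rs by (simp only: lin_pencil_def index_mat prod.case)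
  qed (simp add: lin_pencil_def)
  then have "psd_mat m (lin_pencil m M a) \<longleftrightarrow> (\<forall>v. Re (\<psi> (nc_star (P v) * nc_lin a * P v)) \<ge> 0)" for a
    by (simp add: psd_mat_def pencil)
  moreover have "(\<forall>v. Re (\<psi> (nc_star (P v) * nc_lin a * P v)) \<ge> 0) \<longleftrightarrow> a \<in> cone" for a
  proof
    assume *: "\<forall>v. Re (\<psi> (nc_star (P v) * nc_lin a * P v)) \<ge> 0"
    have "Re (\<psi> (nc_star p * nc_lin a * p)) \<ge> 0" if "deg_le (d - 1) p" for p
      using P_surj[OF that] * by (elim exE) simp
    then show "a \<in> cone" by (simp add: cone_def)
  qed (use degP in \<open>simp add: cone_def\<close>)
  ultimately have "cone = {a. psd_mat m (lin_pencil m M a)}" by blast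
  then show ?thesis unfolding spectrahedral_def using herm by blast
qed

text \<open>The ideal condition on \<psi> reaches only up to degree 4 (d - 1). Reducing modulo
  \<open>g a\<close> first makes L vanish on all multiples of \<open>g a\<close> and changes nothing
  in low degrees.\<close>

definition L :: "('n \<Rightarrow> real) \<Rightarrow> real poly \<Rightarrow> real" where
  "L a f = Re (\<psi> (nc_subst (f mod g a) (nc_lin a)))"

lemma L_low_degree:
  assumes "degree f \<le> 4 * (d - 1)"
  shows "L a f = Re (\<psi> (nc_subst f (nc_lin a)))"
proof -
  have "degree (f mod g a) \<le> 4 * (d - 1)"
    using degree_mod_less[OF g_nonzero[of a], of f] degree_g[of a] d_ge by auto
  then have "deg_le (4 * (d - 1)) (1 * nc_subst (f - f mod g a) (nc_lin a) * 1)"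
    using assms by (auto intro!: deg_le_subst deg_le_lin degree_diff_le)
  then have "\<psi> (1 * nc_subst (f - f mod g a) (nc_lin a) * 1) = 0"
    by (intro psi_dvd) (simp add: dvd_minus_mod)
  then show ?thesis by (simp add: L_def nc_subst_diff psi_diff)
qed

text \<open>The prefix p absorbs the letters that appear when the factors a . z are expanded one at
  a time.\<close>

lemma polyfun_psi_power: "polyfun (\<lambda>a. Re (\<psi> (p * nc_lin a ^ j)))"
proof (induction j arbitrary: p)
  case (Suc j)
  have "Re (\<psi> (p * nc_lin a ^ Suc j)) =
      (\<Sum>i\<in>UNIV. a i * Re (\<psi> ((p * Poly_Mapping.single [i] 1) * nc_lin a ^ j)))" for a
  proof -
    have "nc_lin a = (\<Sum>i\<in>UNIV. cst (complex_of_real (a i)) * Poly_Mapping.single [i] 1)"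
      by (simp add: nc_lin_def mult_single)
    then have "p * nc_lin a ^ Suc j =
        (\<Sum>i\<in>UNIV. p * (cst (complex_of_real (a i)) * Poly_Mapping.single [i] 1) * nc_lin a ^ j)"
      by (simp only: power_Suc sum_distrib_left sum_distrib_right mult.assoc)
    also have "\<dots> = (\<Sum>i\<in>UNIV. cst (complex_of_real (a i)) * ((p * Poly_Mapping.single [i] 1) * nc_lin a ^ j))"
      by (simp only: cst_left_commute mult.assoc)
    finally show ?thesis by (simp only: psi_sum psi_scale) simp
  qed
  then show ?case by (simp only:) (intro polyfun_sum polyfun_mult polyfun_coord Suc)
qed (simp add: polyfun_const)

sublocale hankel_family h e d L
proof unfold_locales
  show "L a (p + q) = L a p + L a q" for a p q
    by (simp add: L_def poly_mod_add_left nc_subst_add psi_add)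
  show "L a (smult s p) = s * L a p" for a s p
    by (simp add: L_def mod_smult_left nc_subst_smult psi_scale)
  show "L a (g a * q) = 0" for a q
    by (simp add: L_def \<psi>_def)
  show "L a (p * p) \<ge> 0" for a p
  proof -
    define q where "q = p mod g a"
    have q: "degree q \<le> d - 1"
      using degree_mod_less[OF g_nonzero[of a], of p] degree_g[of a] unfolding q_def by auto
    have "L a (p * p) = L a (q * q)" by (simp add: L_def q_def mod_mult_eq)
    also have "\<dots> = Re (\<psi> (nc_star (nc_subst q (nc_lin a)) * nc_subst q (nc_lin a)))"
      using q degree_mult_le[of q q]
      by (subst L_low_degree) (auto simp: nc_subst_mult nc_star_subst)
    also have "\<dots> \<ge> 0"
      using q by (intro psi_square deg_le_subst deg_le_lin) auto
    finally show ?thesis .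
  qed
  show "L a 1 = 1" for a
    by (subst L_low_degree) (auto simp: psi_one)
  show "polyfun (\<lambda>a. L a (monom 1 j))" for j
  proof -
    \<comment> \<open>The leading coefficient of \<open>g a\<close> is the nonzero constant (-1)^d
      h(e), so remainders depend polynomially on a.\<close>
    have R: "polyfam (\<lambda>a. monom 1 j mod g a)"
    proof (rule polyfam_div_mod(2)[OF polyfam_hae degree_g lead_g])
      show "(- 1) ^ d * mpeval h e \<noteq> 0" using h_e by simp
    qed (auto simp: degree_monom_le)
    have "L a (monom 1 j) = (\<Sum>i\<le>d. coeff (monom 1 j mod g a) i * Re (\<psi> (1 * nc_lin a ^ i)))" for a
    proof -
      have "degree (monom 1 j mod g a) \<le> d"
        using degree_mod_less[OF g_nonzero[of a], of "monom 1 j"] degree_g[of a] by auto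
      then show ?thesis by (simp add: L_def nc_subst_superset psi_sum psi_scale)
    qed
    then show ?thesis
      using R by (simp only:) (intro polyfun_sum polyfun_mult polyfun_psi_power, auto simp: polyfam_def)
  qed
qed

text \<open>For a negative root t of \<open>g b\<close>, the quotient f of \<open>g b\<close> by x -
  t satisfies x f^2 = t f^2 modulo \<open>g b\<close>. Membership in the cone gives t L(f^2) \<ge>
  0, so L(f^2) = 0, and f is a kernel element of degree d - 1.\<close>

lemma hankel_zero_outside_Lambda:
  assumes "b \<in> cone" "b \<notin> Lambda h e"
  shows "hankel d b = 0"
proof -
  obtain t where t: "poly (g b) t = 0" "t < 0" using assms(2) by (auto simp: Lambda_iff not_le)
  obtain f where f: "g b = [:- t, 1:] * f" using t(1) by (metis dvdE poly_eq_0_iff_dvd)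
  have "f \<noteq> 0" using f g_nonzero[of b] by auto
  then have "degree (g b) = Suc (degree f)" unfolding f by (subst degree_mult_eq) auto
  then have deg: "degree f = d - 1" by (simp add: degree_g)
  define S where "S = nc_subst f (nc_lin b)"
  have S: "nc_star S = S" "deg_le (d - 1) S"
    using deg by (auto simp: S_def nc_star_subst intro!: deg_le_subst deg_le_lin)
  have "0 \<le> Re (\<psi> (nc_star S * nc_lin b * S))"
    using assms(1) S(2) by (auto simp: cone_def)
  also have "nc_star S * nc_lin b * S = nc_subst (f * [:0, 1:] * f) (nc_lin b)"
    by (simp only: S nc_subst_mult nc_subst_X) (simp only: S_def)
  also have "f * [:0, 1:] * f = g b * f + smult t (f * f)"
    unfolding poly_eq_poly_eq_iff[symmetric] fun_eq_iff f by (simp add: algebra_simps)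
  also have "Re (\<psi> (nc_subst (g b * f + smult t (f * f)) (nc_lin b))) = L b (g b * f + smult t (f * f))"
  proof (rule L_low_degree[symmetric], rule degree_add_le)
    show "degree (g b * f) \<le> 4 * (d - 1)"
      using degree_mult_le[of "g b" f] deg degree_g[of b] d_ge by linarith
    show "degree (smult t (f * f)) \<le> 4 * (d - 1)"
      using degree_mult_le[of f f] degree_smult_le[of t "f * f"] deg by linarith
  qed
  also have "\<dots> = t * L b (f * f)" by (simp only: L_add L_smult L_g)
  finally have "L b (f * f) \<le> 0" using t(2) by (simp add: zero_le_mult_iff)
  then have "f \<in> kernel b" using L_square[of b f] by (intro kernel_of_square_zero) simp
  then show ?thesis using \<open>f \<noteq> 0\<close> deg d_pos unfolding hankel_zero_iff by fastforce
qed

end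

section \<open>Inner and outer points of the hyperbolicity cone along rays\<close>

context hyperbolic_poly
begin

text \<open>h(a + s e) / h(e) is the product of s + r over the roots r \<ge> 0 of
  \<open>g a\<close>. Its use is the contrapositive: a quotient below s^d certifies that a lies
  outside \<open>Lambda\<close>, and such a strict inequality persists nearby.\<close>

lemma Lambda_lower_bound:
  assumes "a \<in> Lambda h e" "s \<ge> 0"
  shows "mpeval h (\<lambda>i. a i + s * e i) / mpeval h e \<ge> s ^ d"
proof -
  obtain c rs where crs: "c \<noteq> 0" "g a = smult c (\<Prod>r\<leftarrow>rs. [:- r, 1:])"
    using real_rooted_split[OF real_rooted_g g_nonzero] by blast
  have len: "length rs = d"
    using degree_g[of a] crs prod_list_linear_factors(1)[of rs] by simp
  have "lead_coeff (g a) = c" unfolding crs(2) lead_coeff_smult prod_list_linear_factors(2) by simp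
  then have c: "c = (- 1) ^ d * mpeval h e" using lead_g[of a] by (simp add: degree_g)
  have nonneg: "r \<ge> 0" if "r \<in> set rs" for r
  proof -
    have "poly (\<Prod>r\<leftarrow>rs. [:- r, 1:]) r = 0" using that by (induction rs) auto
    then show ?thesis using assms(1) unfolding Lambda_iff by (simp add: crs)
  qed
  have "poly (\<Prod>r\<leftarrow>xs. [:- r, 1:]) (- s) = (- 1) ^ length xs * (\<Prod>r\<leftarrow>xs. s + r)" for xs
    by (induction xs) (simp_all add: algebra_simps)
  then have "poly (g a) (- s) = mpeval h e * (\<Prod>r\<leftarrow>rs. s + r)"
    by (simp add: crs(2) len c flip: power_mult_distrib)
  then have "mpeval h (\<lambda>i. a i + s * e i) / mpeval h e = (\<Prod>r\<leftarrow>rs. s + r)"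
    using h_e by (simp add: poly_hae)
  also have "(\<Prod>r\<leftarrow>rs. s + r) \<ge> s ^ length rs"
    using nonneg by (induction rs) (auto intro!: mult_mono simp: assms(2))
  finally show ?thesis using len by simp
qed

text \<open>By homogeneity, a negative root r at e + t c gives a zero of s \<mapsto> h(e + s c) at s
  = t / (1 - r), which lies between 0 and t; but this polynomial is nonzero near s = 0.\<close>

lemma Lambda_near_e: "\<forall>\<^sub>F t in at_right (0::real). (\<lambda>i. e i + t * c i) \<in> Lambda h e"
proof -
  obtain q where q: "\<And>t. mpeval h (\<lambda>i. e i + t * c i) = poly q t"
    using polyfun_on_line[OF polyfun_mpeval] by metis
  have "poly q 0 \<noteq> 0" using q[of 0] h_e by simp
  then have "\<forall>\<^sub>F t in at 0. poly q t \<noteq> 0"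
    by (rule tendsto_imp_eventually_ne[OF isContD[OF poly_isCont]])
  then obtain \<delta> where \<delta>: "\<delta> > 0" "\<And>t. t \<noteq> 0 \<Longrightarrow> \<bar>t\<bar> < \<delta> \<Longrightarrow> poly q t \<noteq> 0"
    unfolding eventually_at by (auto simp: dist_real_def)
  have "(\<lambda>i. e i + t * c i) \<in> Lambda h e" if t: "0 < t" "t < \<delta>" for t
    unfolding Lambda_iff
  proof (intro allI impI)
    fix r assume r: "poly (g (\<lambda>i. e i + t * c i)) r = 0"
    show "r \<ge> 0"
    proof (rule ccontr)
      assume "\<not> r \<ge> 0"
      then have "1 - r > 1" by simp
      have "poly (g (\<lambda>i. e i + t * c i)) r = mpeval h (\<lambda>i. (1 - r) * (e i + t / (1 - r) * c i))"
        unfolding poly_hae using \<open>1 - r > 1\<close> by (intro arg_cong[of _ _ "mpeval h"]) (auto simp: field_simps)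
      also have "\<dots> = (1 - r) ^ d * poly q (t / (1 - r))"
        by (simp only: mpeval_homogeneous[OF homogeneous] q)
      finally have "poly q (t / (1 - r)) = 0" using r \<open>1 - r > 1\<close> by simp
      moreover have "\<bar>t / (1 - r)\<bar> < \<delta>"
        using t \<open>1 - r > 1\<close> by (simp add: divide_simps) (smt (verit) mult_less_cancel_left1)
      moreover have "t / (1 - r) \<noteq> 0" using t \<open>1 - r > 1\<close> by simp
      ultimately show False using \<delta>(2) by blast
    qed
  qed
  then show ?thesis using \<delta>(1) by (auto simp: eventually_at_right_field)
qed

end

context truncated_functional
begin

lemma cone_eq_Lambda:
  assumes "irreducible h"
  shows "cone = Lambda h e"
proof (rule antisym)
  show "Lambda h e \<subseteq> cone" using Lambda_subset_cone by blast
  show "cone \<subseteq> Lambda h e"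
  proof
    fix b assume b: "b \<in> cone"
    show "b \<in> Lambda h e"
    proof (rule ccontr)
      assume "b \<notin> Lambda h e"
      then obtain t where t: "poly (g b) t = 0" "t < 0" by (auto simp: Lambda_iff not_le)
      \<comment> \<open>Since 2 \<delta> = - t, h vanishes at b0 + \<delta> e = b - t e. One
        \<delta> moves b into the interior of the cone, the other leaves room to stay outside
        \<open>Lambda\<close>.\<close>
      define \<delta> where "\<delta> = - t / 2"
      have "\<delta> > 0" using t by (simp add: \<delta>_def)
      define b0 where "b0 = (\<lambda>i. b i + \<delta> * e i)"
      \<comment> \<open>On an initial segment of the ray from b0 in direction c the determinant
        vanishes, hence on the whole line. As c is arbitrary, the value at parameter 1 covers every
        point.\<close>
      have "hankel d (\<lambda>i. b0 i + 1 * c i) = 0" for c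
      proof -
        obtain q where q: "\<And>s. mpeval h (\<lambda>i. b0 i + \<delta> * e i + s * c i) = poly q s"
          using polyfun_on_line[OF polyfun_mpeval, of h "\<lambda>i. b0 i + \<delta> * e i" c] by auto
        have "poly q 0 = poly (g b) t"
          unfolding q[symmetric] poly_hae b0_def \<delta>_def by (intro arg_cong[of _ _ "mpeval h"]) auto
        then have "(\<lambda>s. poly q s / mpeval h e) \<midarrow>0\<rightarrow> 0"
          using t(1) h_e by (auto intro!: tendsto_eq_intros)
        then have "\<forall>\<^sub>F s in at 0. poly q s / mpeval h e < \<delta> ^ d"
          using \<open>\<delta> > 0\<close> by (intro order_tendstoD(2)) auto
        then have 1: "\<forall>\<^sub>F s in at_right 0. poly q s / mpeval h e < \<delta> ^ d"
          by (simp add: eventually_at_split)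
        have 2: "\<forall>\<^sub>F s in at_right 0. (\<lambda>i. e i + s * (c i / \<delta>)) \<in> Lambda h e"
          by (rule Lambda_near_e)
        have "\<forall>\<^sub>F s in at_right 0. hankel d (\<lambda>i. b0 i + s * c i) = 0"
          using 1 2
        proof eventually_elim
          case (elim s)
          have "(\<lambda>i. b i + \<delta> * (e i + s * (c i / \<delta>))) \<in> cone"
            using cone_add_scale[OF b Lambda_subset_cone[OF elim(2)], of \<delta>] \<open>\<delta> > 0\<close> by simp
          also have "(\<lambda>i. b i + \<delta> * (e i + s * (c i / \<delta>))) = (\<lambda>i. b0 i + s * c i)"
            using \<open>\<delta> > 0\<close> by (auto simp: b0_def field_simps)
          finally have "(\<lambda>i. b0 i + s * c i) \<in> cone" .
          moreover have "(\<lambda>i. b0 i + s * c i) \<notin> Lambda h e"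
          proof
            assume "(\<lambda>i. b0 i + s * c i) \<in> Lambda h e"
            then have "\<delta> ^ d \<le> mpeval h (\<lambda>i. b0 i + s * c i + \<delta> * e i) / mpeval h e"
              using \<open>\<delta> > 0\<close> by (intro Lambda_lower_bound) auto
            also have "(\<lambda>i. b0 i + s * c i + \<delta> * e i) = (\<lambda>i. b0 i + \<delta> * e i + s * c i)" by auto
            finally show False using elim(1) by (simp add: q)
          qed
          ultimately show ?case by (rule hankel_zero_outside_Lambda)
        qed
        then obtain \<eta> where \<eta>: "\<eta> > 0" "\<And>s. 0 < s \<Longrightarrow> s < \<eta> \<Longrightarrow> hankel d (\<lambda>i. b0 i + s * c i) = 0"
          by (auto simp: eventually_at_right_field)
        obtain p where p: "\<And>s. hankel d (\<lambda>i. b0 i + s * c i) = poly p s"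
          using polyfun_on_line[OF polyfun_hankel] by metis
        have "{0<..<\<eta>} \<subseteq> {s. poly p s = 0}" using \<eta>(2) p by auto
        then have "infinite {s. poly p s = 0}"
          using infinite_Ioo[OF \<eta>(1)] finite_subset by blast
        then have "p = 0" using poly_roots_finite by blast
        then show ?thesis by (simp only: p) simp
      qed
      from this[of "\<lambda>i. x i - b0 i" for x] have "hankel d x = 0" for x by simp
      then show False using hankel_not_identically_zero[OF assms] by blast
    qed
  qed
qed

end

text \<open>Here h is linear and h(a) / h(e) is the only root of \<open>g a\<close>, so its
  nonnegativity is a pencil condition of size 1.\<close>

lemma (in hyperbolic_poly) spectrahedral_degree_one:
  assumes "d = 1"
  shows "spectrahedral (Lambda h e)"
proof -
  define \<delta> :: "'n \<Rightarrow> 'n \<Rightarrow> real" where "\<delta> i = (\<lambda>j. if j = i then 1 else 0)" for i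
  have lin: "mpeval h x = (\<Sum>i\<in>UNIV. x i * mpeval h (\<delta> i))" for x
  proof -
    have term_eq: "(\<Prod>i\<in>UNIV. x i ^ Poly_Mapping.lookup m i) =
        (\<Sum>i\<in>UNIV. x i * (\<Prod>j\<in>UNIV. \<delta> i j ^ Poly_Mapping.lookup m j))"
      if "m \<in> Poly_Mapping.keys h" for m
    proof -
      have "(\<Sum>i\<in>UNIV. Poly_Mapping.lookup m i) = 1"
        using homogeneous that assms by (auto simp: homogeneous_of_degree_def)
      then obtain j where j: "Poly_Mapping.lookup m j = 1" "\<And>i. i \<noteq> j \<Longrightarrow> Poly_Mapping.lookup m i = 0"
        using sum_eq_1_iff[of "UNIV :: 'n set" "Poly_Mapping.lookup m"] by auto
      have "(\<Prod>i\<in>UNIV. y i ^ Poly_Mapping.lookup m i) = (\<Prod>i\<in>UNIV. if i = j then y j else 1)" for y :: "'n \<Rightarrow> real"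
        by (rule prod.cong) (use j in auto)
      then have *: "(\<Prod>i\<in>UNIV. y i ^ Poly_Mapping.lookup m i) = y j" for y :: "'n \<Rightarrow> real" by simp
      have "x i * \<delta> i j = (if i = j then x j else 0)" for i by (auto simp: \<delta>_def)
      then show ?thesis unfolding * by simp
    qed
    then show ?thesis
      unfolding mpeval_def sum_distrib_left
      by (subst sum.swap) (auto simp: sum_distrib_left mult_ac intro!: sum.cong)
  qed
  define M where "M i = mat 1 1 (\<lambda>_. complex_of_real (mpeval h (\<delta> i) / mpeval h e))" for i
  have herm: "hermitian_mat 1 (M i)" for i by (simp add: hermitian_mat_def M_def)
  have pencil: "lin_pencil 1 M a = mat 1 1 (\<lambda>_. complex_of_real (mpeval h a / mpeval h e))" for a
    by (rule eq_matI) (auto simp: lin_pencil_def M_def lin[of a] sum_divide_distrib)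
  have "psd_mat 1 (lin_pencil 1 M a) \<longleftrightarrow> mpeval h a / mpeval h e \<ge> 0" for a
  proof
    assume "psd_mat 1 (lin_pencil 1 M a)"
    then have "Re (quad_form 1 (lin_pencil 1 M a) (\<lambda>_. 1)) \<ge> 0" by (simp add: psd_mat_def)
    then show "mpeval h a / mpeval h e \<ge> 0"
      by (simp add: quad_form_def pencil[unfolded One_nat_def])
  next
    assume *: "mpeval h a / mpeval h e \<ge> 0"
    have "Re (quad_form 1 (lin_pencil 1 M a) v) \<ge> 0" for v
    proof -
      have "quad_form 1 (lin_pencil 1 M a) v = complex_of_real (mpeval h a / mpeval h e) * (cnj (v 0) * v 0)"
        by (simp add: quad_form_def pencil[unfolded One_nat_def] mult_ac)
      also have "Re \<dots> = mpeval h a / mpeval h e * (cmod (v 0))\<^sup>2"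
        by (simp add: complex_mod_mult_cnj flip: complex_norm_square mult.commute[of "v 0"])
      finally show ?thesis using * zero_le_mult_iff zero_le_power2 by metis
    qed
    then show "psd_mat 1 (lin_pencil 1 M a)"
      by (simp add: psd_mat_def hermitian_mat_def pencil[unfolded One_nat_def])
  qed
  moreover have "a \<in> Lambda h e \<longleftrightarrow> mpeval h a / mpeval h e \<ge> 0" for a
  proof -
    have "poly (g a) t = mpeval h a - t * mpeval h e" for t
    proof -
      have "poly (g a) t = coeff (g a) 0 + t * coeff (g a) 1"
        using degree_g[of a] assms by (simp add: poly_altdef)
      also have "coeff (g a) 0 = mpeval h a" by (simp add: poly_hae flip: poly_0_coeff_0)
      also have "coeff (g a) 1 = - mpeval h e" using lead_g[of a] assms by simp
      finally show ?thesis by simp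
    qed
    then have "poly (g a) t = 0 \<longleftrightarrow> t = mpeval h a / mpeval h e" for t
      using h_e by (simp only: eq_divide_eq) auto
    then show ?thesis by (simp add: Lambda_iff)
  qed
  ultimately show ?thesis
    unfolding spectrahedral_def using herm by (intro exI[of _ 1] exI[of _ M]) auto
qed

text \<open>A homogeneous polynomial of degree 0 is constant, hence zero or a unit.\<close>

lemma homogeneous_irreducible_degree_pos:
  assumes "irreducible h" "homogeneous_of_degree h d"
  shows "d > 0"
proof (rule ccontr)
  assume "\<not> d > 0"
  define c where "c = mpeval h (\<lambda>i. 0)"
  have "mpeval h x = c" for x
    using mpeval_homogeneous[OF assms(2), of 0 x] \<open>\<not> d > 0\<close> by (simp add: c_def)
  then have h: "h = Poly_Mapping.single 0 c"
    by (intro mpeval_inject ext) (simp add: mpeval_const)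
  then have "c \<noteq> 0" using assms(1) by auto
  then have "h * Poly_Mapping.single 0 (1 / c) = 1" by (simp add: h mult_single)
  then show False using assms(1) unfolding irreducible_def by (metis dvdI)
qed

theorem spectrahedral_if_Fset_nonempty:
  assumes "irreducible h" "homogeneous_of_degree h d" "hyperbolic h e"
    and "\<phi> \<in> Fset h e (2 * (d - 1))"
  shows "spectrahedral (Lambda h e)"
proof -
  have "d > 0" using assms homogeneous_irreducible_degree_pos by blast
  interpret hyperbolic_poly h e d by unfold_locales (use assms \<open>d > 0\<close> in auto)
  show ?thesis
  proof (cases "d = 1")
    case True
    then show ?thesis by (rule spectrahedral_degree_one)
  next
    case False
    define c where "c = (\<lambda>u. \<phi> (Poly_Mapping.single u 1))"
    have eq: "lin_ext c p = \<phi> p" if "deg_le (4 * (d - 1)) p" for p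
      using Fset_lin_ext[OF assms(4)] that by (simp add: c_def)
    interpret truncated_functional h e d c "lin_ext c"
    proof unfold_locales
      show "d \<ge> 2" using False \<open>d > 0\<close> by simp
      show "lin_ext c 1 = 1" using assms(4) by (simp add: eq Fset_def nc_one_eq)
      show "lin_ext c (nc_star p) = cnj (lin_ext c p)" if "deg_le (4 * (d - 1)) p" for p
        using assms(4) that by (simp add: eq deg_le_star Fset_def nc_deg_le_iff)
      show "Re (lin_ext c (nc_star p * p)) \<ge> 0" if "deg_le (2 * (d - 1)) p" for p
      proof -
        have "deg_le (4 * (d - 1)) (nc_star p * p)"
          using deg_le_mult[OF deg_le_star[OF that] that] by simp
        then show ?thesis
          using assms(4) that by (simp add: eq Fset_def nc_deg_le_iff nc_mult_eq)
      qed
      show "lin_ext c (p * nc_subst (hae h a e) (nc_lin a) * q) = 0"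
        if "deg_le (4 * (d - 1)) (p * nc_subst (hae h a e) (nc_lin a) * q)" for p a q
        using assms(4) that by (simp add: eq Fset_def nc_deg_le_iff nc_mult_eq hgen_eq)
    qed simp
    show ?thesis using spectrahedral_cone cone_eq_Lambda[OF assms(1)] by simp
  qed
qed

section \<open>A definite determinantal representation yields a functional in \<open>F(h,e)\<close>\<close>

text \<open>Complex coefficients are needed because the annihilating polynomial from which an
  eigenvector is extracted need not be real.\<close>

definition csubst :: "complex poly \<Rightarrow> 'n ncpoly \<Rightarrow> 'n ncpoly" where
  "csubst f x = (\<Sum>j\<le>degree f. cst (coeff f j) * x ^ j)"

lemma csubst_superset:
  assumes "degree f \<le> N"
  shows "csubst f x = (\<Sum>j\<le>N. cst (coeff f j) * x ^ j)"
  unfolding csubst_def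
  by (rule sum.mono_neutral_left) (use assms in \<open>auto simp: coeff_eq_0\<close>)

lemma csubst_add: "csubst (f + g) x = csubst f x + csubst g x"
proof -
  let ?N = "max (degree f) (degree g)"
  have "degree (f + g) \<le> ?N" by (rule degree_add_le_max)
  then show ?thesis
    by (simp add: csubst_superset[of _ ?N] single_add ring_distribs sum.distrib)
qed

lemma csubst_smult: "csubst (smult c f) x = cst c * csubst f x"
  by (simp add: csubst_superset[of _ "degree f"] sum_distrib_left cst_mult flip: mult.assoc)

lemma csubst_pCons: "csubst (pCons c f) x = cst c + x * csubst f x"
proof -
  have "csubst (pCons c f) x = (\<Sum>j\<le>Suc (degree f). cst (coeff (pCons c f) j) * x ^ j)"
    by (rule csubst_superset) (rule degree_pCons_le)
  also have "\<dots> = cst c + x * csubst f x"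
    unfolding sum.atMost_Suc_shift
    by (simp add: csubst_superset[of f "degree f"] sum_distrib_left cst_left_commute)
  finally show ?thesis .
qed

lemma csubst_zero [simp]: "csubst 0 x = 0"
  by (simp add: csubst_superset[of 0 0])

lemma csubst_mult: "csubst (f * g) x = csubst f x * csubst g x"
proof (induction f)
  case (pCons c f)
  then show ?case
    by (simp add: csubst_add csubst_smult csubst_pCons ring_distribs mult.assoc)
qed simp

lemma nc_subst_eq_csubst: "nc_subst f x = csubst (map_poly complex_of_real f) x"
proof (induction f)
  case (pCons c f)
  then show ?case by (simp add: map_poly_pCons csubst_pCons nc_subst_pCons)
qed simp

lemma det_zero_row:
  fixes f :: "nat \<Rightarrow> nat \<Rightarrow> 'a::field"
  assumes "k < n" "\<And>j. j < n \<Longrightarrow> f k j = 0"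
  shows "det (mat n n (\<lambda>(i, j). f i j)) = 0"
proof -
  have "det (mat n n (\<lambda>(i, j). f i j)) = det (transpose_mat (mat n n (\<lambda>(i, j). f i j)))"
    by (subst det_transpose[of _ n]) auto
  also have "transpose_mat (mat n n (\<lambda>(i, j). f i j)) = mat n n (\<lambda>(i, j). f j i)"
    by (rule eq_matI) auto
  also have "det \<dots> = 0"
  proof -
    define c :: "nat \<Rightarrow> 'a" where "c j = (if j = k then 1 else 0)" for j
    have "\<exists>j<n. c j \<noteq> 0" using assms(1) by (auto simp: c_def)
    moreover have "(\<Sum>j<n. f j i * c j) = 0" if "i < n" for i
      by (rule sum.neutral) (use assms(2) that in \<open>auto simp: c_def\<close>)
    ultimately show ?thesis unfolding det_mat_zero_iff by blast
  qed
  finally show ?thesis .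
qed

locale definite_pencil =
  fixes m :: nat and M :: "'n::finite \<Rightarrow> complex mat" and e :: "'n \<Rightarrow> real" and BI :: "complex mat"
  assumes herm: "hermitian_mat m (M i)"
    and pd: "pd_mat m (lin_pencil m M e)"
    and BI: "BI \<in> carrier_mat m m" "lin_pencil m M e * BI = 1\<^sub>m m"
begin

text \<open>C^m as functions that vanish from m on, so that equality of vectors is equality of
  functions.\<close>

definition V :: "(nat \<Rightarrow> complex) set" where
  "V = {x. \<forall>r\<ge>m. x r = 0}"

definition mv :: "complex mat \<Rightarrow> (nat \<Rightarrow> complex) \<Rightarrow> nat \<Rightarrow> complex" where
  "mv A x = (\<lambda>r. if r < m then \<Sum>s<m. A $$ (r, s) * x s else 0)"

abbreviation "B \<equiv> lin_pencil m M e"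

definition ip :: "(nat \<Rightarrow> complex) \<Rightarrow> (nat \<Rightarrow> complex) \<Rightarrow> complex" where
  "ip x y = (\<Sum>r<m. cnj (x r) * mv B y r)"

text \<open>The matrix of \<open>T i\<close> is B^-1 M_i, in general not hermitian; it is
  self-adjoint for \<open>ip\<close> because B B^-1 M_i = M_i is hermitian.\<close>

definition T :: "'n \<Rightarrow> (nat \<Rightarrow> complex) \<Rightarrow> nat \<Rightarrow> complex" where
  "T i x = mv BI (mv (M i) x)"

definition Tw :: "'n list \<Rightarrow> (nat \<Rightarrow> complex) \<Rightarrow> nat \<Rightarrow> complex" where
  "Tw u x = foldr T u x"

definition op :: "'n ncpoly \<Rightarrow> (nat \<Rightarrow> complex) \<Rightarrow> nat \<Rightarrow> complex" where
  "op p x = (\<lambda>r. lin_ext (\<lambda>u. Tw u x r) p)"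

lemma mv_V: "mv A x \<in> V"
  by (simp add: mv_def V_def)

lemma V_eqI: "x \<in> V \<Longrightarrow> y \<in> V \<Longrightarrow> (\<And>r. r < m \<Longrightarrow> x r = y r) \<Longrightarrow> x = y"
  by (rule ext) (metis (mono_tags, lifting) V_def mem_Collect_eq not_le)

lemma mv_add: "mv A (\<lambda>r. x r + y r) = (\<lambda>r. mv A x r + mv A y r)"
  by (auto simp: mv_def ring_distribs sum.distrib)

lemma mv_scale: "mv A (\<lambda>r. c * x r) = (\<lambda>r. c * mv A x r)"
  by (auto simp: mv_def sum_distrib_left mult_ac)

lemma T_add: "T i (\<lambda>r. x r + y r) = (\<lambda>r. T i x r + T i y r)"
  by (simp add: T_def mv_add)

lemma T_scale: "T i (\<lambda>r. c * x r) = (\<lambda>r. c * T i x r)"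
  by (simp add: T_def mv_scale)

lemma Tw_append: "Tw (u + v) x = Tw u (Tw v x)"
  by (simp add: Tw_def plus_list_def)

lemma Tw_zero [simp]: "Tw 0 x = x"
  by (simp add: Tw_def zero_list_def)

lemma Tw_singleton [simp]: "Tw [i] x = T i x"
  by (simp add: Tw_def)

lemma Tw_add: "Tw u (\<lambda>r. x r + y r) = (\<lambda>r. Tw u x r + Tw u y r)"
  by (induction u) (simp_all add: Tw_def T_add)

lemma Tw_scale: "Tw u (\<lambda>r. c * x r) = (\<lambda>r. c * Tw u x r)"
  by (induction u) (simp_all add: Tw_def T_scale)

lemma Tw_V: "x \<in> V \<Longrightarrow> Tw u x \<in> V"
  by (induction u) (simp_all add: Tw_def T_def mv_V)

lemma op_V: "x \<in> V \<Longrightarrow> op p x \<in> V"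
  using Tw_V by (auto simp: op_def V_def lin_ext_def)

lemma op_zero_left: "op 0 x = (\<lambda>r. 0)"
  by (simp add: op_def)

lemma op_add_left: "op (p + q) x = (\<lambda>r. op p x r + op q x r)"
  by (simp add: op_def lin_ext_add)

lemma op_scale_left: "op (cst c * p) x = (\<lambda>r. c * op p x r)"
  by (simp add: op_def lin_ext_scale)

lemma op_sum_left: "op (\<Sum>i\<in>I. f i) x = (\<lambda>r. \<Sum>i\<in>I. op (f i) x r)"
  by (simp add: op_def lin_ext_sum)

lemma op_cst: "op (cst c) x = (\<lambda>r. c * x r)"
  by (simp add: op_def)

lemma op_one [simp]: "op 1 x = x"
  using op_cst[of 1 x] by simp

lemma op_single: "op (Poly_Mapping.single u c) x = (\<lambda>r. c * Tw u x r)"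
  by (simp add: op_def)

lemma op_add_right: "op p (\<lambda>r. x r + y r) = (\<lambda>r. op p x r + op p y r)"
  by (simp add: op_def lin_ext_def Tw_add ring_distribs sum.distrib)

lemma op_scale_right: "op p (\<lambda>r. c * x r) = (\<lambda>r. c * op p x r)"
  by (simp add: op_def lin_ext_def Tw_scale sum_distrib_left mult_ac)

lemma op_zero_right: "op p (\<lambda>r. 0) = (\<lambda>r. 0)"
  using op_scale_right[of p 0 "\<lambda>r. 0"] by simp

lemma op_mult: "op (p * q) x = op p (op q x)"
proof (induction p rule: poly_mapping_add_induct)
  case (single u c)
  show ?case
  proof (induction q rule: poly_mapping_add_induct)
    case zero
    then show ?case by (simp add: op_zero_left op_zero_right)
  next
    case (single v c')
    then show ?case by (simp add: mult_single op_single Tw_append Tw_scale mult.assoc)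
  next
    case (add p q)
    then show ?case by (simp add: ring_distribs op_add_left op_add_right)
  qed
qed (simp_all add: ring_distribs op_add_left op_zero_left)

lemma mv_adjoint:
  assumes "hermitian_mat m A"
  shows "(\<Sum>r<m. cnj (x r) * mv A y r) = (\<Sum>r<m. cnj (mv A x r) * y r)"
proof -
  have A: "A $$ (s, r) = cnj (A $$ (r, s))" if "r < m" "s < m" for r s
    using assms that unfolding hermitian_mat_def by blast
  have "(\<Sum>r<m. cnj (x r) * mv A y r) = (\<Sum>r<m. \<Sum>s<m. cnj (x r) * (A $$ (r, s) * y s))"
    by (simp add: mv_def sum_distrib_left)
  also have "\<dots> = (\<Sum>s<m. \<Sum>r<m. cnj (x r) * (A $$ (r, s) * y s))"
    by (rule sum.swap)
  also have "\<dots> = (\<Sum>s<m. \<Sum>r<m. cnj (A $$ (s, r) * x r) * y s)"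
  proof (intro sum.cong refl)
    fix r s assume "r \<in> {..<m}" "s \<in> {..<m}"
    then show "cnj (x r) * (A $$ (r, s) * y s) = cnj (A $$ (s, r) * x r) * y s"
      using A[of r s] by simp
  qed
  also have "\<dots> = (\<Sum>s<m. cnj (mv A x s) * y s)"
    by (intro sum.cong refl) (simp add: mv_def sum_distrib_right)
  finally show ?thesis .
qed

lemma herm_B: "hermitian_mat m B"
  using pd by (simp add: pd_mat_def)

lemma ip_add_left: "ip (\<lambda>r. x r + y r) z = ip x z + ip y z"
  by (simp add: ip_def ring_distribs sum.distrib)

lemma ip_add_right: "ip z (\<lambda>r. x r + y r) = ip z x + ip z y"
  by (simp add: ip_def mv_add ring_distribs sum.distrib)

lemma ip_scale_left: "ip (\<lambda>r. c * x r) y = cnj c * ip x y"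
  by (simp add: ip_def sum_distrib_left mult_ac)

lemma ip_scale_right: "ip x (\<lambda>r. c * y r) = c * ip x y"
  by (simp add: ip_def mv_scale sum_distrib_left mult_ac)

lemma ip_cnj: "cnj (ip x y) = ip y x"
proof -
  have "ip y x = (\<Sum>r<m. cnj (mv B y r) * x r)"
    unfolding ip_def by (rule mv_adjoint[OF herm_B])
  then show ?thesis by (simp add: ip_def mult.commute)
qed

lemma ip_pos:
  assumes "x \<in> V" "x \<noteq> (\<lambda>r. 0)"
  shows "Re (ip x x) > 0" "Im (ip x x) = 0"
proof -
  have "\<exists>r<m. x r \<noteq> 0" using assms V_eqI[of x "\<lambda>r. 0"] by (force simp: V_def)
  then have "Re (quad_form m B x) > 0" using pd by (simp add: pd_mat_def)
  moreover have "quad_form m B x = ip x x"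
    by (simp add: quad_form_def ip_def mv_def sum_distrib_left mult.assoc)
  ultimately show "Re (ip x x) > 0" by simp
  show "Im (ip x x) = 0" using arg_cong[OF ip_cnj[of x x], of Im] by simp
qed

lemma ip_nonneg: "x \<in> V \<Longrightarrow> Re (ip x x) \<ge> 0"
proof (cases "x = (\<lambda>r. 0)")
  case True
  then show ?thesis by (simp add: ip_def)
qed (use ip_pos(1)[of x] in auto)

lemma mv_B_BI: "mv B (mv BI x) = (\<lambda>r. if r < m then x r else 0)"
proof -
  have "mv B (mv BI x) r = x r" if r: "r < m" for r
  proof -
    have "mv B (mv BI x) r = (\<Sum>s<m. \<Sum>t<m. B $$ (r, s) * (BI $$ (s, t) * x t))"
      using r by (simp add: mv_def sum_distrib_left)
    also have "\<dots> = (\<Sum>t<m. \<Sum>s<m. B $$ (r, s) * (BI $$ (s, t) * x t))"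
      by (rule sum.swap)
    also have "\<dots> = (\<Sum>t<m. (B * BI) $$ (r, t) * x t)"
    proof (intro sum.cong refl)
      fix t assume "t \<in> {..<m}"
      then have "(B * BI) $$ (r, t) = (\<Sum>s<m. B $$ (r, s) * BI $$ (s, t))"
        using r BI(1) by (simp add: scalar_prod_def atLeast0LessThan lin_pencil_def)
      then show "(\<Sum>s<m. B $$ (r, s) * (BI $$ (s, t) * x t)) = (B * BI) $$ (r, t) * x t"
        by (simp add: sum_distrib_right mult.assoc)
    qed
    also have "\<dots> = (\<Sum>t<m. if t = r then x t else 0)"
      unfolding BI(2) using r by (intro sum.cong refl) auto
    finally show ?thesis using r by simp
  qed
  then show ?thesis by (auto simp: mv_def)
qed

lemma mv_B_T: "mv B (T i x) = mv (M i) x"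
  unfolding T_def by (subst mv_B_BI) (auto simp: mv_def)

lemma T_adjoint: "ip x (T i y) = ip (T i x) y"
proof -
  have "ip x (T i y) = (\<Sum>r<m. cnj (mv (M i) x r) * y r)"
    unfolding ip_def mv_B_T by (rule mv_adjoint[OF herm])
  also have "\<dots> = ip (T i x) y"
    unfolding ip_def mv_adjoint[OF herm_B] mv_B_T ..
  finally show ?thesis .
qed

lemma Tw_adjoint: "ip x (Tw u y) = ip (Tw (rev u) x) y"
proof (induction u arbitrary: x)
  case (Cons i u)
  have "ip x (Tw (i # u) y) = ip x (T i (Tw u y))" by (simp add: Tw_def)
  also have "\<dots> = ip (Tw (rev u) (T i x)) y" by (simp add: T_adjoint Cons)
  finally show ?case by (simp add: Tw_def)
qed (simp add: Tw_def)

lemma op_adjoint: "ip x (op p y) = ip (op (nc_star p) x) y"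
proof (induction p rule: poly_mapping_add_induct)
  case zero
  then show ?case by (simp add: op_zero_left ip_def mv_def)
next
  case (single u c)
  then show ?case by (simp add: op_single ip_scale_left ip_scale_right Tw_adjoint)
next
  case (add p q)
  then show ?case by (simp add: op_add_left nc_star_add ip_add_left ip_add_right)
qed

lemma mv_B_op_lin: "mv B (op (nc_lin a) x) = mv (lin_pencil m M a) x"
proof -
  have op: "op (nc_lin a) x = (\<lambda>r. \<Sum>i\<in>UNIV. complex_of_real (a i) * T i x r)"
    by (simp add: nc_lin_def op_sum_left op_single)
  have mv_sum: "mv B (\<lambda>r. \<Sum>i\<in>I. f i r) = (\<lambda>r. \<Sum>i\<in>I. mv B (f i) r)" for I :: "'n set" and f
  proof (induction I rule: infinite_finite_induct)
    case (insert i I)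
    then show ?case by (simp add: mv_add)
  qed (simp_all add: mv_def fun_eq_iff)
  have "mv B (op (nc_lin a) x) = (\<lambda>r. \<Sum>i\<in>UNIV. complex_of_real (a i) * mv (M i) x r)"
    unfolding op mv_sum mv_scale mv_B_T ..
  also have "\<dots> = mv (lin_pencil m M a) x"
  proof
    fix r
    show "(\<Sum>i\<in>UNIV. complex_of_real (a i) * mv (M i) x r) = mv (lin_pencil m M a) x r"
    proof (cases "r < m")
      case True
      then have "(\<Sum>i\<in>UNIV. complex_of_real (a i) * mv (M i) x r) =
          (\<Sum>i\<in>UNIV. \<Sum>s<m. complex_of_real (a i) * M i $$ (r, s) * x s)"
        by (simp add: mv_def sum_distrib_left mult.assoc)
      also have "\<dots> = (\<Sum>s<m. \<Sum>i\<in>UNIV. complex_of_real (a i) * M i $$ (r, s) * x s)"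
        by (rule sum.swap)
      finally show ?thesis using True by (simp add: mv_def lin_pencil_def sum_distrib_right)
    qed (simp add: mv_def)
  qed
  finally show ?thesis .
qed

lemma annihilator_exists:
  assumes "y \<in> V"
  shows "\<exists>q. q \<noteq> 0 \<and> op (csubst q x) y = (\<lambda>r. 0)"
proof -
  \<comment> \<open>The m + 1 vectors x^j y have only m coordinates. Padding with a zero row makes
    the array square and singular, and a null vector is the linear dependence sought.\<close>
  define f where "f r j = (if r < m then op (x ^ j) y r else 0)" for r j :: nat
  have "det (mat (Suc m) (Suc m) (\<lambda>(r, j). f r j)) = 0"
    by (rule det_zero_row[of m]) (auto simp: f_def)
  then obtain c j where c: "j < Suc m" "c j \<noteq> 0" "\<And>r. r < Suc m \<Longrightarrow> (\<Sum>j<Suc m. f r j * c j) = 0"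
    unfolding det_mat_zero_iff by blast
  define q where "q = (\<Sum>j\<le>m. monom (c j) j)"
  have coeff_q: "coeff q i = (if i \<le> m then c i else 0)" for i
    by (auto simp: q_def coeff_sum)
  have "q \<noteq> 0" using c(1,2) coeff_q by (metis coeff_0 less_Suc_eq_le)
  have "degree q \<le> m" by (rule degree_le) (simp add: coeff_q)
  then have "csubst q x = (\<Sum>j\<le>m. cst (c j) * x ^ j)"
    by (simp add: csubst_superset[of q m] coeff_q)
  then have op_q: "op (csubst q x) y = (\<lambda>r. \<Sum>j\<le>m. c j * op (x ^ j) y r)"
    by (simp add: op_sum_left op_scale_left)
  have "op (csubst q x) y = (\<lambda>r. 0)"
  proof (rule V_eqI)
    show "op (csubst q x) y \<in> V" "(\<lambda>r. 0) \<in> V" using op_V[OF assms] by (auto simp: V_def)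
    fix r assume "r < m"
    then show "op (csubst q x) y r = 0"
      using c(3)[of r] by (simp add: op_q f_def lessThan_Suc_atMost mult.commute)
  qed
  then show ?thesis using \<open>q \<noteq> 0\<close> by blast
qed

text \<open>If \<open>g(A) y\<close> were nonzero, its orbit under \<open>A\<close> would contain an eigenvector \<open>w\<close>. Its eigenvalue
  is a root of \<open>g\<close>, so \<open>g(A) w = 0\<close>; but \<open>w\<close> also lies in the range of the self-adjoint \<open>g(A)\<close>.\<close>

lemma op_annihilated:
  assumes roots: "\<And>t. det (lin_pencil m M (\<lambda>i. a i - t * e i)) = 0 \<Longrightarrow> poly f t = 0"
    and y: "y \<in> V"
  shows "op (nc_subst f (nc_lin a)) y = (\<lambda>r. 0)"
proof (rule ccontr)
  let ?x = "nc_lin a"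
  let ?f = "nc_subst f ?x"
  define w0 where "w0 = op ?f y"
  assume "op ?f y \<noteq> (\<lambda>r. 0)"
  then have w0: "w0 \<noteq> (\<lambda>r. 0)" "w0 \<in> V" using op_V[OF y] by (auto simp: w0_def)
  define Q where "Q q \<longleftrightarrow> q \<noteq> 0 \<and> op (csubst q ?x) w0 = (\<lambda>r. 0)" for q
  \<comment> \<open>\<open>q\<close> has minimal degree among the polynomials annihilating
    \<open>w0\<close>, so splitting off one root leaves a nonzero vector, which is an
    eigenvector.\<close>
  obtain q where q: "Q q" "\<And>q'. Q q' \<Longrightarrow> degree q \<le> degree q'"
  proof -
    obtain q0 where "Q q0" using annihilator_exists[OF w0(2)] unfolding Q_def by blast
    then show ?thesis using ex_has_least_nat[of Q q0 degree] that by blast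
  qed
  have "degree q \<noteq> 0"
  proof
    assume "degree q = 0"
    then obtain c where c: "q = [:c:]" by (rule degree_eq_zeroE)
    then have "(\<lambda>r. c * w0 r) = (\<lambda>r. 0)" using q(1) by (simp add: Q_def csubst_pCons op_cst)
    moreover have "c \<noteq> 0" using q(1) c by (auto simp: Q_def)
    ultimately have "w0 r = 0" for r by (auto dest: fun_cong[of _ _ r])
    then show False using w0(1) by auto
  qed
  then obtain z where "poly q z = 0"
    using fundamental_theorem_of_algebra[of q] by (auto simp: constant_degree)
  then obtain q' where q': "q = [:- z, 1:] * q'" by (metis dvdE poly_eq_0_iff_dvd)
  have "q' \<noteq> 0" using q(1) q' by (auto simp: Q_def)
  then have "degree q = Suc (degree q')" unfolding q' by (subst degree_mult_eq) auto
  define w where "w = op (csubst q' ?x) w0"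
  have w: "w \<noteq> (\<lambda>r. 0)" "w \<in> V"
    using q(2)[of q'] \<open>q' \<noteq> 0\<close> \<open>degree q = Suc (degree q')\<close> op_V[OF w0(2)]
    by (auto simp: w_def Q_def)
  have lin: "csubst [:- z, 1:] ?x = cst (- z) + ?x" by (simp add: csubst_pCons)
  have "op (csubst [:- z, 1:] ?x) w = (\<lambda>r. 0)"
    using q(1) by (simp only: Q_def q' csubst_mult op_mult w_def)
  then have "op ?x w r - z * w r = 0" for r
    unfolding lin op_add_left op_cst by (simp add: fun_eq_iff)
  then have eig: "op ?x w = (\<lambda>r. z * w r)" by auto
  have "z * ip w w = ip w (op ?x w)" by (simp add: eig ip_scale_right)
  also have "\<dots> = ip (op ?x w) w" by (simp add: op_adjoint)
  also have "\<dots> = cnj z * ip w w" by (simp add: eig ip_scale_left)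
  finally have "z * ip w w = cnj z * ip w w" .
  moreover have "ip w w \<noteq> 0" using ip_pos(1)[OF w(2,1)] by auto
  ultimately have "z = cnj z" by (simp only: mult_cancel_right) simp
  then have "z \<in> \<real>" by (simp add: Reals_cnj_iff)
  then obtain t where t: "z = complex_of_real t" by (rule Reals_cases)
  obtain r0 where r0: "w r0 \<noteq> 0" using w(1) by auto
  \<comment> \<open>Multiplying the eigenvector equation by B shows that w is in the kernel of the
    pencil at a - t e.\<close>
  have "det (lin_pencil m M (\<lambda>i. a i - t * e i)) = 0"
    unfolding lin_pencil_def det_mat_zero_iff
  proof (intro exI conjI allI impI)
    show "w r0 \<noteq> 0" by (rule r0)
    show "r0 < m"
    proof (rule ccontr)
      assume "\<not> r0 < m"
      then show False using r0 w(2) by (simp add: V_def)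
    qed
    fix r assume r: "r < m"
    have "(\<Sum>s<m. (\<Sum>i\<in>UNIV. complex_of_real (a i - t * e i) * M i $$ (r, s)) * w s) =
        mv (lin_pencil m M a) w r - z * mv B w r"
    proof -
      have "(\<Sum>i\<in>UNIV. complex_of_real (a i - t * e i) * M i $$ (r, s)) * w s =
          lin_pencil m M a $$ (r, s) * w s - z * (B $$ (r, s) * w s)" if "s < m" for s
      proof -
        have "(\<Sum>i\<in>UNIV. complex_of_real (a i - t * e i) * M i $$ (r, s)) =
            (\<Sum>i\<in>UNIV. complex_of_real (a i) * M i $$ (r, s)) -
            z * (\<Sum>i\<in>UNIV. complex_of_real (e i) * M i $$ (r, s))"
          unfolding t of_real_diff of_real_mult left_diff_distrib sum_subtractf sum_distrib_left mult.assoc ..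
        then show ?thesis using r that by (simp add: lin_pencil_def left_diff_distrib mult.assoc)
      qed
      then have "(\<Sum>s<m. (\<Sum>i\<in>UNIV. complex_of_real (a i - t * e i) * M i $$ (r, s)) * w s) =
          (\<Sum>s<m. lin_pencil m M a $$ (r, s) * w s - z * (B $$ (r, s) * w s))"
        by (intro sum.cong[OF refl]) (simp only: lessThan_iff)
      also have "\<dots> = mv (lin_pencil m M a) w r - z * mv B w r"
        using r by (simp only: mv_def sum_subtractf sum_distrib_left if_True)
      finally show ?thesis .
    qed
    also have "mv (lin_pencil m M a) w = (\<lambda>r. z * mv B w r)"
      using mv_B_op_lin[of a w] unfolding eig mv_scale by (rule sym)
    also have "z * mv B w r - z * mv B w r = 0" by simp
    finally show "(\<Sum>s<m. (\<Sum>i\<in>UNIV. complex_of_real (a i - t * e i) * M i $$ (r, s)) * w s) = 0" .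
  qed
  then have "poly f t = 0" by (rule roots)
  then obtain f' where f': "f = [:- t, 1:] * f'" by (metis dvdE poly_eq_0_iff_dvd)
  have "nc_subst [:- t, 1:] ?x = csubst [:- z, 1:] ?x"
    by (simp add: nc_subst_eq_csubst map_poly_pCons t)
  then have "op (nc_subst [:- t, 1:] ?x) w = (\<lambda>r. 0)"
    using \<open>op (csubst [:- z, 1:] ?x) w = (\<lambda>r. 0)\<close> by simp
  moreover have "f = f' * [:- t, 1:]" using f' by (simp only: mult.commute)
  ultimately have fw: "op ?f w = (\<lambda>r. 0)"
    by (simp only: nc_subst_mult op_mult op_zero_right)
  have "csubst q' ?x * ?f = ?f * csubst q' ?x"
    unfolding nc_subst_eq_csubst csubst_mult[symmetric] by (simp only: mult.commute)
  then have "w = op ?f (op (csubst q' ?x) y)"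
    unfolding w_def w0_def op_mult[symmetric] by simp
  then have "ip w w = ip (op ?f (op (csubst q' ?x) y)) w" by simp
  also have "\<dots> = ip (op (csubst q' ?x) y) (op ?f w)"
    by (simp add: op_adjoint nc_star_subst)
  also have "\<dots> = 0" by (simp add: fw ip_def mv_def)
  finally show False using ip_pos(1)[OF w(2,1)] by simp
qed

end

text \<open>A self-adjoint operator is annihilated by every polynomial vanishing on its spectrum,
  whatever the multiplicities. Hence the hypothesis speaks of the zero set of the determinant, and
  all powers of h are covered at once.\<close>

lemma Fset_nonempty_if_definite_pencil:
  assumes "m > 0" "\<And>i. hermitian_mat m (M i)" "pd_mat m (lin_pencil m M e)"
    and "\<And>x. det (lin_pencil m M x) = 0 \<Longrightarrow> mpeval h x = 0"
  shows "Fset h e k \<noteq> {}"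
proof -
  let ?B = "lin_pencil m M e"
  have B: "?B \<in> carrier_mat m m" by (simp add: lin_pencil_def)
  have "det ?B \<noteq> 0"
  proof
    assume "det ?B = 0"
    moreover have "mat m m (\<lambda>(i, j). ?B $$ (i, j)) = ?B"
      by (rule eq_matI) (use B in auto)
    ultimately have "det (mat m m (\<lambda>(i, j). ?B $$ (i, j))) = 0"
      by (simp only:)
    then obtain c where c: "\<exists>j<m. c j \<noteq> 0" "\<And>i. i < m \<Longrightarrow> (\<Sum>j<m. ?B $$ (i, j) * c j) = 0"
      unfolding det_mat_zero_iff by blast
    have "quad_form m ?B c = (\<Sum>i<m. cnj (c i) * (\<Sum>j<m. ?B $$ (i, j) * c j))"
      by (simp add: quad_form_def sum_distrib_left mult.assoc)
    also have "\<dots> = 0" using c(2) by simp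
    finally show False using assms(3) c(1) by (auto simp: pd_mat_def)
  qed
  then obtain BI where BI: "BI \<in> carrier_mat m m" "?B * BI = 1\<^sub>m m"
    using det_non_zero_imp_unit[OF B, of "()"] by (auto simp: Units_def ring_mat_def)
  interpret definite_pencil m M e BI
    by unfold_locales (use assms BI in auto)
  \<comment> \<open>Any nonzero vector would serve as the state; m > 0 provides the first unit
    vector.\<close>
  define v0 :: "nat \<Rightarrow> complex" where "v0 = (\<lambda>r. if r = 0 then 1 else 0)"
  have v0: "v0 \<in> V" "v0 \<noteq> (\<lambda>r. 0)" using assms(1) by (auto simp: v0_def V_def fun_eq_iff)
  define n where "n = Re (ip v0 v0)"
  have n: "n > 0" "ip v0 v0 = complex_of_real n"
    using ip_pos[OF v0] by (auto simp: n_def complex_eq_iff)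
  define \<phi> where "\<phi> p = ip v0 (op p v0) / complex_of_real n" for p
  have "\<phi> \<in> Fset h e k"
    unfolding Fset_def mem_Collect_eq nc_mult_eq nc_one_eq nc_scale_eq hgen_eq
  proof (intro conjI allI impI)
    show "\<phi> (p + q) = \<phi> p + \<phi> q" for p q
      by (simp add: \<phi>_def op_add_left ip_add_right add_divide_distrib)
    show "\<phi> (cst c * p) = c * \<phi> p" for c p
      by (simp add: \<phi>_def op_scale_left ip_scale_right)
    show "\<phi> 1 = 1" using n by (simp add: \<phi>_def)
    show "\<phi> (nc_star p) = cnj (\<phi> p)" for p
      by (simp add: \<phi>_def op_adjoint[of _ "nc_star p"] ip_cnj)
    have sq: "\<phi> (nc_star p * p) = ip (op p v0) (op p v0) / complex_of_real n" for p
      by (simp add: \<phi>_def op_mult op_adjoint[of v0 "nc_star p"])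
    have "Im (ip (op p v0) (op p v0)) = 0" for p
      using arg_cong[OF ip_cnj[of "op p v0" "op p v0"], of Im] by simp
    then show "\<phi> (nc_star p * p) \<in> \<real>" for p
      by (simp add: sq complex_is_Real_iff Im_divide_of_real)
    show "Re (\<phi> (nc_star p * p)) \<ge> 0" for p
      using ip_nonneg[OF op_V[OF v0(1)], of p] n by (simp add: sq Re_divide_of_real)
    show "\<phi> (p * nc_subst (hae h a e) (nc_lin a) * q) = 0" for a p q
    proof -
      have "op (nc_subst (hae h a e) (nc_lin a)) (op q v0) = (\<lambda>r. 0)"
        by (rule op_annihilated[OF _ op_V[OF v0(1)]]) (simp add: poly_hae assms(4))
      then show ?thesis by (simp add: \<phi>_def op_mult op_zero_right ip_def mv_def)
    qed
  qed
  then show ?thesis by blast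
qed

lemma Fset_nonempty_if_definite_det_rep:
  assumes "homogeneous_of_degree h d" "d > 0" "definite_det_rep (h ^ r) e" "r \<ge> 1"
  shows "Fset h e k \<noteq> {}"
proof -
  obtain m and M :: "'a \<Rightarrow> complex mat" where M: "\<And>i. hermitian_mat m (M i)"
    "pd_mat m (lin_pencil m M e) \<or> pd_mat m (- lin_pencil m M e)"
    "\<And>x. complex_of_real (mpeval (h ^ r) x) = det (lin_pencil m M x)"
    using assms(3) unfolding definite_det_rep_def by blast
  \<comment> \<open>A pencil of size 0 has determinant 1, whereas h^r vanishes at the
    origin.\<close>
  have "m > 0"
  proof (rule ccontr)
    assume "\<not> m > 0"
    then have "complex_of_real (mpeval h (\<lambda>i. 0) ^ r) = 1"
      using M(3)[of "\<lambda>i. 0"] by (simp add: mpeval_power det_def lin_pencil_def)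
    moreover have "mpeval h (\<lambda>i. 0) = 0"
      using mpeval_homogeneous[OF assms(1), of 0 "\<lambda>i. 0"] assms(2) by (simp add: zero_power)
    ultimately show False using assms(4) by (simp add: zero_power)
  qed
  have zero: "mpeval h x = 0" if "det (lin_pencil m M x) = 0" for x
    using M(3)[of x] that by (simp add: mpeval_power)
  show ?thesis
  proof (cases "pd_mat m (lin_pencil m M e)")
    case True
    show ?thesis
      by (rule Fset_nonempty_if_definite_pencil[of m M e h k, OF \<open>m > 0\<close> M(1) True zero])
  next
    case False
    \<comment> \<open>In the negative definite case all matrices are negated; this scales the
      determinant by (-1)^m and keeps its zero set.\<close>
    define N where "N i = - M i" for i
    have M_carrier: "M i \<in> carrier_mat m m" for i using M(1) by (simp add: hermitian_mat_def)
    have pencil: "lin_pencil m N x = - lin_pencil m M x" for x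
    proof (rule eq_matI)
      fix r s assume "r < dim_row (- lin_pencil m M x)" "s < dim_col (- lin_pencil m M x)"
      then have "r < m" "s < m" by (simp_all add: lin_pencil_def)
      moreover from this have "N i $$ (r, s) = - (M i $$ (r, s))" for i
        using M_carrier[of i] by (simp add: N_def)
      ultimately show "lin_pencil m N x $$ (r, s) = (- lin_pencil m M x) $$ (r, s)"
        by (simp add: lin_pencil_def sum_negf)
    qed (simp_all add: lin_pencil_def)
    have "hermitian_mat m (N i)" for i
      unfolding hermitian_mat_def
    proof (intro conjI allI impI)
      show "N i \<in> carrier_mat m m" using M_carrier by (simp add: N_def)
      fix r s assume rs: "r < m" "s < m"
      then have "M i $$ (s, r) = cnj (M i $$ (r, s))"
        using M(1)[of i] unfolding hermitian_mat_def by blast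
      then show "N i $$ (s, r) = cnj (N i $$ (r, s))"
        using rs M_carrier[of i] by (simp add: N_def)
    qed
    moreover have "pd_mat m (lin_pencil m N e)" using M(2) False by (simp add: pencil)
    moreover have "mpeval h x = 0" if "det (lin_pencil m N x) = 0" for x
    proof (rule zero)
      have "- lin_pencil m M x = (- 1) \<cdot>\<^sub>m lin_pencil m M x"
        by (rule eq_matI) auto
      then have "lin_pencil m N x = (- 1) \<cdot>\<^sub>m lin_pencil m M x"
        using pencil by metis
      moreover have "dim_col (lin_pencil m M x) = m" by (simp add: lin_pencil_def)
      ultimately have "det (lin_pencil m N x) = (- 1) ^ m * det (lin_pencil m M x)"
        using det_smult by metis
      then show "det (lin_pencil m M x) = 0" using that by simp
    qed
    ultimately show ?thesis
      by (rule Fset_nonempty_if_definite_pencil[of m N e h k, OF \<open>m > 0\<close>])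
  qed
qed

section \<open>Separating a cone with an order unit\<close>

text \<open>Scalar multiplication is a parameter so that the free algebra can serve as a real vector
  space through \<open>cst\<close>. That u is an order unit of the whole space keeps the separating
  functional finite everywhere.\<close>

locale order_unit_cone = vector_space scale
  for scale :: "real \<Rightarrow> 'v \<Rightarrow> 'v::ab_group_add" (infixr \<open>*\<^sub>s\<close> 75) +
  fixes u :: 'v and C :: "'v set"
  assumes C_add: "x \<in> C \<Longrightarrow> y \<in> C \<Longrightarrow> x + y \<in> C"
    and C_scale: "x \<in> C \<Longrightarrow> t \<ge> 0 \<Longrightarrow> t *\<^sub>s x \<in> C"
    and C_unit: "\<exists>N. N *\<^sub>s u + x \<in> C"
    and C_proper: "- u \<notin> C"
begin

definition proper_cones :: "'v set set" where
  "proper_cones = {M. C \<subseteq> M \<and> (\<forall>x\<in>M. \<forall>y\<in>M. x + y \<in> M) \<and>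
     (\<forall>x\<in>M. \<forall>t\<ge>0. t *\<^sub>s x \<in> M) \<and> - u \<notin> M}"

lemma maximal_proper_cone:
  obtains M where "M \<in> proper_cones" "\<And>X. X \<in> proper_cones \<Longrightarrow> M \<subseteq> X \<Longrightarrow> X = M"
proof -
  have "\<exists>M\<in>proper_cones. \<forall>X\<in>proper_cones. M \<subseteq> X \<longrightarrow> X = M"
  proof (rule subset_Zorn_nonempty)
    have "C \<in> proper_cones" using C_add C_scale C_proper by (auto simp: proper_cones_def)
    then show "proper_cones \<noteq> {}" by blast
    fix K assume K: "K \<noteq> {}" "subset.chain proper_cones K"
    then have KP: "K \<subseteq> proper_cones" and tot: "\<And>X Y. X \<in> K \<Longrightarrow> Y \<in> K \<Longrightarrow> X \<subseteq> Y \<or> Y \<subseteq> X"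
      by (auto simp: subset_chain_def)
    have "x + y \<in> \<Union> K" if "x \<in> \<Union> K" "y \<in> \<Union> K" for x y
    proof -
      obtain X Y where XY: "X \<in> K" "x \<in> X" "Y \<in> K" "y \<in> Y" using \<open>x \<in> \<Union> K\<close> \<open>y \<in> \<Union> K\<close> by blast
      then obtain Z where "Z \<in> K" "x \<in> Z" "y \<in> Z" using tot[of X Y] by blast
      moreover from this have "x + y \<in> Z" using KP unfolding proper_cones_def by blast
      ultimately show ?thesis by blast
    qed
    moreover have "C \<subseteq> \<Union> K"
    proof -
      obtain X where X: "X \<in> K" using K(1) by blast
      then have "C \<subseteq> X" using KP unfolding proper_cones_def by blast
      then show ?thesis using X by blast
    qed
    moreover have "\<forall>x\<in>\<Union> K. \<forall>t\<ge>0. t *\<^sub>s x \<in> \<Union> K" "- u \<notin> \<Union> K"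
      using KP unfolding proper_cones_def by blast+
    ultimately show "\<Union> K \<in> proper_cones" unfolding proper_cones_def by blast
  qed
  then show ?thesis using that by blast
qed

text \<open>A maximal cone M avoiding -u contains x or -x for every x. Comparing x with the
  multiples of u in the order defined by M is then a Dedekind cut, and the real number it defines is
  f x.\<close>

lemma positive_functional_exists:
  "\<exists>f. (\<forall>x y. f (x + y) = f x + f y) \<and> (\<forall>t x. f (t *\<^sub>s x) = t * f x) \<and> f u = 1 \<and> (\<forall>x\<in>C. f x \<ge> 0)"
proof -
  obtain M where M: "M \<in> proper_cones" and max: "\<And>X. X \<in> proper_cones \<Longrightarrow> M \<subseteq> X \<Longrightarrow> X = M"
    using maximal_proper_cone by blast
  have CM: "x \<in> M" if "x \<in> C" for x using M that by (auto simp: proper_cones_def)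
  have add: "x + y \<in> M" if "x \<in> M" "y \<in> M" for x y using M that by (auto simp: proper_cones_def)
  have scale: "t *\<^sub>s x \<in> M" if "x \<in> M" "t \<ge> 0" for x t using M that by (auto simp: proper_cones_def)
  have nu: "- u \<notin> M" using M by (simp add: proper_cones_def)
  have zero: "0 \<in> M"
  proof -
    obtain N where "N *\<^sub>s u + 0 \<in> C" using C_unit by blast
    then have "0 *\<^sub>s (N *\<^sub>s u + 0) \<in> M" by (intro scale CM) auto
    then show ?thesis by simp
  qed
  \<comment> \<open>By maximality, the cone generated by M and x must contain -u.\<close>
  have neg: "\<exists>m\<in>M. \<exists>a\<ge>0. - u = m + a *\<^sub>s x" if x: "x \<notin> M" for x
  proof (rule ccontr)
    assume *: "\<not> ?thesis"
    define X where "X = {m + a *\<^sub>s x | m a. m \<in> M \<and> a \<ge> 0}"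
    have MX: "M \<subseteq> X"
    proof
      fix m assume "m \<in> M"
      then have "m = m + 0 *\<^sub>s x \<and> m \<in> M \<and> (0::real) \<ge> 0" by simp
      then show "m \<in> X" unfolding X_def by blast
    qed
    have "y + z \<in> X" if yz: "y \<in> X" "z \<in> X" for y z
    proof -
      obtain m a m' a' where "y = m + a *\<^sub>s x" "z = m' + a' *\<^sub>s x" "m \<in> M" "m' \<in> M" "a \<ge> 0" "a' \<ge> 0"
        using yz unfolding X_def by blast
      then have "y + z = (m + m') + (a + a') *\<^sub>s x \<and> m + m' \<in> M \<and> a + a' \<ge> 0"
        using add by (simp add: scale_left_distrib add_ac)
      then show ?thesis unfolding X_def by blast
    qed
    moreover have "t *\<^sub>s y \<in> X" if y: "y \<in> X" "t \<ge> 0" for y t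
    proof -
      obtain m a where "y = m + a *\<^sub>s x" "m \<in> M" "a \<ge> 0" using y unfolding X_def by blast
      then have "t *\<^sub>s y = t *\<^sub>s m + (t * a) *\<^sub>s x \<and> t *\<^sub>s m \<in> M \<and> t * a \<ge> 0"
        using scale y(2) by (simp add: scale_right_distrib)
      then show ?thesis unfolding X_def by blast
    qed
    moreover have "- u \<notin> X" using * unfolding X_def by blast
    ultimately have "X \<in> proper_cones" using MX CM unfolding proper_cones_def by blast
    then have "X = M" using max MX by blast
    moreover have "x = 0 + 1 *\<^sub>s x \<and> 0 \<in> M \<and> (1::real) \<ge> 0" using zero by simp
    then have "x \<in> X" unfolding X_def by blast
    ultimately show False using x by blast
  qed
  \<comment> \<open>If neither x nor -x were in M, then -u = m + a x and -u = m' - b x; weighting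
    these by b and a cancels x and puts -u into M.\<close>
  have total: "- x \<in> M" if x: "x \<notin> M" for x
  proof (rule ccontr)
    assume "- x \<notin> M"
    obtain m a where m: "m \<in> M" "a \<ge> 0" "- u = m + a *\<^sub>s x" using neg[OF x] by blast
    obtain m' b where m': "m' \<in> M" "b \<ge> 0" "- u = m' + b *\<^sub>s (- x)" using neg[OF \<open>- x \<notin> M\<close>] by blast
    show False
    proof (cases "a + b = 0")
      case True
      then show False using m nu by (simp add: add_nonneg_eq_0_iff m'(2))
    next
      case False
      then have ab: "a + b > 0" using m(2) m'(2) by simp
      have "b *\<^sub>s m + a *\<^sub>s m' = b *\<^sub>s (m + a *\<^sub>s x) + a *\<^sub>s (m' + b *\<^sub>s (- x))"
        by (simp add: scale_right_distrib scale_right_diff_distrib mult.commute)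
      also have "\<dots> = (a + b) *\<^sub>s (- u)"
        unfolding m(3)[symmetric] m'(3)[symmetric] by (simp add: scale_left_distrib)
      finally have eq: "b *\<^sub>s m + a *\<^sub>s m' = (a + b) *\<^sub>s (- u)" .
      have "(1 / (a + b)) *\<^sub>s (b *\<^sub>s m + a *\<^sub>s m') \<in> M"
        using m m' ab by (intro scale add) auto
      moreover have "(1 / (a + b)) *\<^sub>s ((a + b) *\<^sub>s (- u)) = - u"
        using ab by (simp only: scale_scale) simp
      ultimately show False using nu unfolding eq by simp
    qed
  qed
  have uM: "u \<in> M" using total[of "- u"] nu by simp
  have tu: "t \<ge> 0" if t: "t *\<^sub>s u \<in> M" for t
  proof (rule ccontr)
    assume "\<not> t \<ge> 0"
    then have "(1 / - t) *\<^sub>s (t *\<^sub>s u) \<in> M" by (intro scale t) auto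
    moreover have "(1 / - t) *\<^sub>s (t *\<^sub>s u) = - u" using \<open>\<not> t \<ge> 0\<close> by (simp only: scale_scale) simp
    ultimately show False using nu by simp
  qed
  define f where "f x = Sup {t. x - t *\<^sub>s u \<in> M}" for x
  \<comment> \<open>M need not be closed, so a value of f is characterized by approximation up to
    every \<epsilon> > 0; additivity, scaling and normalization are all verified in this
    form.\<close>
  have f_unique: "f z = r" if z: "\<And>\<epsilon>. \<epsilon> > 0 \<Longrightarrow> z - (r - \<epsilon>) *\<^sub>s u \<in> M \<and> (r + \<epsilon>) *\<^sub>s u - z \<in> M" for z r
  proof -
    have ub: "t \<le> r" if t: "z - t *\<^sub>s u \<in> M" for t
    proof (rule field_le_epsilon)
      fix \<epsilon> :: real assume "\<epsilon> > 0"
      then have "(z - t *\<^sub>s u) + ((r + \<epsilon>) *\<^sub>s u - z) \<in> M" using z by (intro add t) blast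
      moreover have "(z - t *\<^sub>s u) + ((r + \<epsilon>) *\<^sub>s u - z) = (r + \<epsilon> - t) *\<^sub>s u"
        by (simp add: scale_left_diff_distrib)
      ultimately show "t \<le> r + \<epsilon>" using tu[of "r + \<epsilon> - t"] by simp
    qed
    show ?thesis unfolding f_def
    proof (rule cSup_eq)
      show "t \<le> r" if "t \<in> {t. z - t *\<^sub>s u \<in> M}" for t using ub that by simp
      fix y assume y: "\<And>t. t \<in> {t. z - t *\<^sub>s u \<in> M} \<Longrightarrow> t \<le> y"
      show "r \<le> y"
      proof (rule field_le_epsilon)
        fix \<epsilon> :: real assume "\<epsilon> > 0"
        then show "r \<le> y + \<epsilon>" using y[of "r - \<epsilon>"] z[of \<epsilon>] by simp
      qed
    qed
  qed
  have f_approx: "x - (f x - \<epsilon>) *\<^sub>s u \<in> M \<and> (f x + \<epsilon>) *\<^sub>s u - x \<in> M" if eps: "\<epsilon> > 0" for x \<epsilon>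
  proof -
    let ?S = "{t. x - t *\<^sub>s u \<in> M}"
    obtain N where N: "N *\<^sub>s u + x \<in> C" using C_unit by blast
    obtain N' where N': "N' *\<^sub>s u + (- x) \<in> C" using C_unit by blast
    have "- N \<in> ?S" using CM[OF N] by (simp add: add.commute)
    then have ne: "?S \<noteq> {}" by blast
    have bdd: "bdd_above ?S"
    proof (rule bdd_aboveI)
      fix t assume "t \<in> ?S"
      then have "x - t *\<^sub>s u \<in> M" by simp
      then have "(x - t *\<^sub>s u) + (N' *\<^sub>s u + (- x)) \<in> M" by (rule add[OF _ CM[OF N']])
      moreover have "(x - t *\<^sub>s u) + (N' *\<^sub>s u + (- x)) = (N' - t) *\<^sub>s u"
        by (simp add: scale_left_diff_distrib)
      ultimately show "t \<le> N'" using tu[of "N' - t"] by simp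
    qed
    have "f x - \<epsilon> < Sup ?S" using eps by (simp add: f_def)
    then obtain t where t: "t \<in> ?S" "f x - \<epsilon> < t" using less_cSup_iff[OF ne bdd] by blast
    have "(x - t *\<^sub>s u) + (t - (f x - \<epsilon>)) *\<^sub>s u \<in> M" using t uM by (intro add scale) auto
    moreover have "(x - t *\<^sub>s u) + (t - (f x - \<epsilon>)) *\<^sub>s u = x - (f x - \<epsilon>) *\<^sub>s u"
      by (simp add: scale_left_diff_distrib)
    moreover have "x - (f x + \<epsilon>) *\<^sub>s u \<notin> M"
    proof
      assume "x - (f x + \<epsilon>) *\<^sub>s u \<in> M"
      then have "f x + \<epsilon> \<le> f x" unfolding f_def by (intro cSup_upper bdd) simp
      then show False using eps by simp
    qed
    from total[OF this] have "(f x + \<epsilon>) *\<^sub>s u - x \<in> M" by simp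
    ultimately show ?thesis by simp
  qed
  have f_add: "f (x + y) = f x + f y" for x y
  proof (rule f_unique)
    fix \<epsilon> :: real assume "\<epsilon> > 0"
    then have x: "x - (f x - \<epsilon> / 2) *\<^sub>s u \<in> M" "(f x + \<epsilon> / 2) *\<^sub>s u - x \<in> M"
      and y: "y - (f y - \<epsilon> / 2) *\<^sub>s u \<in> M" "(f y + \<epsilon> / 2) *\<^sub>s u - y \<in> M"
      using f_approx[of "\<epsilon> / 2"] by auto
    have "(f x - \<epsilon> / 2) + (f y - \<epsilon> / 2) = f x + f y - \<epsilon>" "(f x + \<epsilon> / 2) + (f y + \<epsilon> / 2) = f x + f y + \<epsilon>"
      by (simp_all add: field_simps)
    then have eqs: "(x - (f x - \<epsilon> / 2) *\<^sub>s u) + (y - (f y - \<epsilon> / 2) *\<^sub>s u) = x + y - (f x + f y - \<epsilon>) *\<^sub>s u"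
      "((f x + \<epsilon> / 2) *\<^sub>s u - x) + ((f y + \<epsilon> / 2) *\<^sub>s u - y) = (f x + f y + \<epsilon>) *\<^sub>s u - (x + y)"
      unfolding add_diff_add[symmetric] scale_left_distrib[symmetric] by (simp_all only:)
    show "x + y - (f x + f y - \<epsilon>) *\<^sub>s u \<in> M \<and> (f x + f y + \<epsilon>) *\<^sub>s u - (x + y) \<in> M"
      using add[OF x(1) y(1)] add[OF x(2) y(2)] unfolding eqs by blast
  qed
  have f_pos: "f (t *\<^sub>s x) = t * f x" if t: "t > 0" for t x
  proof (rule f_unique)
    fix \<epsilon> :: real assume "\<epsilon> > 0"
    then have x: "x - (f x - \<epsilon> / t) *\<^sub>s u \<in> M" "(f x + \<epsilon> / t) *\<^sub>s u - x \<in> M"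
      using f_approx[of "\<epsilon> / t"] t by auto
    have "t *\<^sub>s (x - (f x - \<epsilon> / t) *\<^sub>s u) = t *\<^sub>s x - (t * (f x - \<epsilon> / t)) *\<^sub>s u"
      "t *\<^sub>s ((f x + \<epsilon> / t) *\<^sub>s u - x) = (t * (f x + \<epsilon> / t)) *\<^sub>s u - t *\<^sub>s x"
      by (simp_all only: scale_right_diff_distrib scale_scale)
    moreover have "t * (f x - \<epsilon> / t) = t * f x - \<epsilon>" "t * (f x + \<epsilon> / t) = t * f x + \<epsilon>"
      using t by (simp_all add: field_simps)
    ultimately show "t *\<^sub>s x - (t * f x - \<epsilon>) *\<^sub>s u \<in> M \<and> (t * f x + \<epsilon>) *\<^sub>s u - t *\<^sub>s x \<in> M"
      using scale[OF x(1), of t] scale[OF x(2), of t] t by simp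
  qed
  have f0: "f 0 = 0" using f_add[of 0 0] by simp
  have f_minus: "f (- x) = - f x" for x using f_add[of x "- x"] f0 by simp
  have f_scale: "f (t *\<^sub>s x) = t * f x" for t x
  proof (cases t "0 :: real" rule: linorder_cases)
    case less
    have "f (t *\<^sub>s x) = - f ((- t) *\<^sub>s x)" by (simp flip: f_minus)
    then show ?thesis using f_pos[of "- t" x] less by simp
  qed (simp_all add: f0 f_pos)
  have "f u = 1"
  proof (rule f_unique)
    fix \<epsilon> :: real assume "\<epsilon> > 0"
    then have "\<epsilon> *\<^sub>s u \<in> M" using uM by (intro scale) auto
    moreover have "u - (1 - \<epsilon>) *\<^sub>s u = \<epsilon> *\<^sub>s u" "(1 + \<epsilon>) *\<^sub>s u - u = \<epsilon> *\<^sub>s u"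
      by (simp_all add: scale_left_diff_distrib scale_left_distrib)
    ultimately show "u - (1 - \<epsilon>) *\<^sub>s u \<in> M \<and> (1 + \<epsilon>) *\<^sub>s u - u \<in> M" by simp
  qed
  moreover have "f x \<ge> 0" if x: "x \<in> C" for x
  proof (rule ccontr)
    assume "\<not> f x \<ge> 0"
    then have "(f x + (- f x / 2)) *\<^sub>s u - x \<in> M" using f_approx[of "- f x / 2" x] by simp
    then have "((f x + (- f x / 2)) *\<^sub>s u - x) + x \<in> M" by (rule add[OF _ CM[OF x]])
    then have "(f x / 2) *\<^sub>s u \<in> M" by simp
    then show False using tu \<open>\<not> f x \<ge> 0\<close> by fastforce
  qed
  ultimately show ?thesis using f_add f_scale by blast
qed

end

section \<open>Sums of squares in the generalized Clifford algebra\<close>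

context hyperbolic_poly
begin

abbreviation "J \<equiv> J_ideal h e"

lemma J_zero: "0 \<in> J"
  by (simp add: J_ideal_def nc_ideal.zero)

lemma J_add: "x \<in> J \<Longrightarrow> y \<in> J \<Longrightarrow> x + y \<in> J"
  unfolding J_ideal_def by (rule nc_ideal.add)

lemma J_hgen: "p * nc_subst (g a) (nc_lin a) * q \<in> J"
  unfolding J_ideal_def hgen_eq[symmetric] nc_mult_eq[symmetric] by (rule nc_ideal.gen) blast

lemma J_mult_left: "x \<in> J \<Longrightarrow> p * x \<in> J"
  unfolding J_ideal_def
proof (induction rule: nc_ideal.induct)
  case (gen y q r)
  then show ?case using nc_ideal.gen[OF gen, of "p * q" r] by (simp add: nc_mult_eq mult.assoc)
qed (auto simp: ring_distribs intro: nc_ideal.intros)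

lemma J_uminus: "x \<in> J \<Longrightarrow> - x \<in> J"
  using J_mult_left[of x "- 1"] by simp

lemma J_mult_right: "x \<in> J \<Longrightarrow> x * p \<in> J"
  unfolding J_ideal_def
proof (induction rule: nc_ideal.induct)
  case (gen y q r)
  then show ?case using nc_ideal.gen[OF gen, of q "r * p"] by (simp add: nc_mult_eq mult.assoc)
qed (auto simp: ring_distribs intro: nc_ideal.intros)

text \<open>All generators are self-adjoint, and the adjoint only interchanges the outer
  factors.\<close>

lemma J_star: "x \<in> J \<Longrightarrow> nc_star x \<in> J"
  unfolding J_ideal_def
proof (induction rule: nc_ideal.induct)
  case (gen y q r)
  then have "nc_star y = y" by (auto simp: hgen_eq nc_star_subst nc_star_diff nc_one_eq)
  then show ?case
    using nc_ideal.gen[OF gen, of "nc_star r" "nc_star q"] by (simp add: nc_mult_eq nc_star_mult mult.assoc)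
qed (auto simp: nc_star_add intro: nc_ideal.intros)

lemma J_dvd: "g a dvd f \<Longrightarrow> nc_subst f (nc_lin a) \<in> J"
  using J_hgen[of 1 a] by (auto simp: nc_subst_mult)

abbreviation sos :: "'n ncpoly list \<Rightarrow> 'n ncpoly" where
  "sos ss \<equiv> sum_list (map (\<lambda>s. nc_star s * s) ss)"

text \<open>All elements whose hermitian part is a sum of squares in the quotient by \<open>J\<close>; skew-hermitian
  elements are included so that the unit is an order unit of the whole algebra.\<close>

definition sos_cone :: "'n ncpoly set" where
  "sos_cone = {x. \<exists>ss. x + nc_star x - sos ss \<in> J}"

lemma sos_cone_add:
  assumes "x \<in> sos_cone" "y \<in> sos_cone"
  shows "x + y \<in> sos_cone"
proof -
  obtain ss ts where "x + nc_star x - sos ss \<in> J" "y + nc_star y - sos ts \<in> J"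
    using assms by (auto simp: sos_cone_def)
  then have "(x + nc_star x - sos ss) + (y + nc_star y - sos ts) \<in> J" by (rule J_add)
  then have "(x + y) + nc_star (x + y) - sos (ss @ ts) \<in> J"
    by (simp add: nc_star_add algebra_simps)
  then show ?thesis unfolding sos_cone_def by blast
qed

lemma sos_cone_conj:
  assumes "x \<in> sos_cone"
  shows "nc_star p * x * p \<in> sos_cone"
proof -
  obtain ss where "x + nc_star x - sos ss \<in> J" using assms by (auto simp: sos_cone_def)
  then have "nc_star p * (x + nc_star x - sos ss) * p \<in> J" by (intro J_mult_left J_mult_right)
  moreover have "nc_star p * sos ss * p = sos (map (\<lambda>s. s * p) ss)"
    by (induction ss) (simp_all add: nc_star_mult ring_distribs mult.assoc)
  ultimately have "nc_star p * x * p + nc_star (nc_star p * x * p) - sos (map (\<lambda>s. s * p) ss) \<in> J"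
    by (simp add: nc_star_mult ring_distribs mult.assoc)
  then show ?thesis unfolding sos_cone_def by blast
qed

lemma sos_cone_scale:
  assumes "x \<in> sos_cone" "t \<ge> 0"
  shows "cst (complex_of_real t) * x \<in> sos_cone"
proof -
  define c :: "'n ncpoly" where "c = cst (complex_of_real (sqrt t))"
  have "nc_star c * x * c = c * c * x"
    unfolding c_def cst_commute[of "nc_star _ * x"] by (simp add: mult.assoc)
  also have "c * c = cst (complex_of_real t)"
    using assms(2) by (simp add: c_def cst_mult flip: of_real_mult)
  finally show ?thesis using sos_cone_conj[OF assms(1), of c] by simp
qed

lemma J_subset_sos_cone:
  assumes "x \<in> J"
  shows "x \<in> sos_cone"
  unfolding sos_cone_def mem_Collect_eq
  by (rule exI[of _ "[]"]) (simp add: J_add J_star assms)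

lemma skew_in_sos_cone:
  assumes "nc_star x = - x"
  shows "x \<in> sos_cone"
  unfolding sos_cone_def mem_Collect_eq
  by (rule exI[of _ "[]"]) (simp add: assms J_zero)

lemma square_in_sos_cone: "nc_star p * p \<in> sos_cone"
  unfolding sos_cone_def mem_Collect_eq
  \<comment> \<open>Listed twice, since membership concerns x + x*, which doubles a square.\<close>
  by (rule exI[of _ "[p, p]"]) (simp add: nc_star_mult J_zero)

lemma minus_one_in_sos_if_cone_improper:
  assumes "- 1 \<in> sos_cone"
  shows "minus_one_in_sos h e"
proof -
  \<comment> \<open>c^2 = 1/2 undoes the doubling in x + x* from inside the squares.\<close>
  define c :: "'n ncpoly" where "c = cst (complex_of_real (sqrt (1 / 2)))"
  have c: "nc_star c = c" by (simp add: c_def)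
  have cc: "c * c = cst (complex_of_real (1 / 2))"
    unfolding c_def cst_mult of_real_mult[symmetric] by simp
  have half: "cst (complex_of_real (1 / 2)) + cst (complex_of_real (1 / 2)) = (1 :: 'n ncpoly)"
    unfolding single_add[symmetric] of_real_add[symmetric] by simp
  obtain ss where "- 1 + nc_star (- 1) - sos ss \<in> J" using assms by (auto simp: sos_cone_def)
  then have "cst (complex_of_real (1 / 2)) * (- 1 + nc_star (- 1) - sos ss) \<in> J" by (rule J_mult_left)
  moreover have "cst (complex_of_real (1 / 2)) * sos ss = sos (map (\<lambda>s. c * s) ss)"
  proof (induction ss)
    case (Cons s ss)
    have "nc_star (c * s) * (c * s) = nc_star s * (c * c * s)"
      by (simp only: nc_star_mult c mult.assoc)
    also have "\<dots> = cst (complex_of_real (1 / 2)) * (nc_star s * s)"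
      unfolding cc by (rule cst_left_commute)
    finally have "nc_star (c * s) * (c * s) = cst (complex_of_real (1 / 2)) * (nc_star s * s)" .
    then show ?case using Cons by (simp only: list.map sum_list.Cons distrib_left)
  qed simp
  moreover have "cst (complex_of_real (1 / 2)) * (- 1 + nc_star (- 1)) = (- 1 :: 'n ncpoly)"
    unfolding nc_star_uminus nc_star_one distrib_left mult_minus_right mult_1_right
      minus_add_distrib[symmetric] half ..
  ultimately have "- 1 - sos (map (\<lambda>s. c * s) ss) \<in> J"
    by (simp only: right_diff_distrib)
  then show ?thesis unfolding minus_one_in_sos_def nc_one_eq nc_mult_eq by blast
qed

text \<open>N exceeds all squared roots of \<open>g a\<close>, so N - t^2 is positive on the roots
  and therefore a square modulo \<open>g a\<close>.\<close>

lemma generator_bounded: "\<exists>N\<ge>0. cst (complex_of_real N) - nc_lin a * nc_lin a \<in> sos_cone"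
proof -
  have "finite {t. poly (g a) t = 0}" by (rule poly_roots_finite[OF g_nonzero])
  then have fin: "finite ((\<lambda>t. t ^ 2) ` {t. poly (g a) t = 0})" by simp
  \<comment> \<open>The extra 0 keeps the maximum defined and N nonnegative; the summand 1 makes the
    bound strict.\<close>
  define N where "N = Max (insert 0 ((\<lambda>t. t ^ 2) ` {t. poly (g a) t = 0})) + 1"
  have N: "t ^ 2 < N" if "poly (g a) t = 0" for t
  proof -
    have "t ^ 2 \<le> Max (insert 0 ((\<lambda>t. t ^ 2) ` {t. poly (g a) t = 0}))"
      by (rule Max_ge) (use fin that in auto)
    then show ?thesis unfolding N_def by linarith
  qed
  have "0 \<le> Max (insert 0 ((\<lambda>t. t ^ 2) ` {t. poly (g a) t = 0}))"
    by (rule Max_ge) (use fin in auto)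
  then have "N \<ge> 0" unfolding N_def by linarith
  obtain s where s: "g a dvd [:N, 0, - 1:] - s ^ 2"
    using sqrt_mod_real_rooted[OF real_rooted_g, of a "[:N, 0, - 1:]"] N degree_g d_pos
    by (auto simp: power2_eq_square)
  define S where "S = nc_subst s (nc_lin a)"
  have "nc_subst ([:N, 0, - 1:] - s ^ 2) (nc_lin a) \<in> J" using s by (rule J_dvd)
  also have "nc_subst ([:N, 0, - 1:] - s ^ 2) (nc_lin a) =
      (cst (complex_of_real N) - nc_lin a * nc_lin a) - nc_star S * S"
    by (simp add: nc_subst_diff nc_subst_pCons power2_eq_square nc_subst_mult nc_star_subst S_def single_uminus)
  finally have "(cst (complex_of_real N) - nc_lin a * nc_lin a) - nc_star S * S + nc_star S * S \<in> sos_cone"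
    by (intro sos_cone_add J_subset_sos_cone square_in_sos_cone)
  then show ?thesis using \<open>N \<ge> 0\<close> by auto
qed

text \<open>If A - z z and B - w* w lie in the cone, then so does A B - (z w)* (z w) = w* (A - z z)
  w + A (B - w* w).\<close>

lemma word_bounded:
  "\<exists>N\<ge>0. cst (complex_of_real N) - nc_star (Poly_Mapping.single u 1) * Poly_Mapping.single u 1 \<in> sos_cone"
proof (induction u)
  case Nil
  have "cst (complex_of_real 1) - nc_star (Poly_Mapping.single [] 1) * Poly_Mapping.single [] 1 = (0 :: 'n ncpoly)"
    by (simp add: mult_single zero_list_def plus_list_def)
  then have "cst (complex_of_real 1) - nc_star (Poly_Mapping.single [] 1) * Poly_Mapping.single [] 1 \<in> sos_cone"
    using J_subset_sos_cone[OF J_zero] by (simp only:)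
  then show ?case using zero_le_one by blast
next
  case (Cons i u)
  let ?w = "Poly_Mapping.single u 1 :: 'n ncpoly"
  let ?z = "nc_lin (\<lambda>j. if j = i then 1 else 0) :: 'n ncpoly"
  obtain N where N: "N \<ge> 0" "cst (complex_of_real N) - nc_star ?w * ?w \<in> sos_cone" using Cons by blast
  obtain N' where N': "N' \<ge> 0" "cst (complex_of_real N') - ?z * ?z \<in> sos_cone"
    using generator_bounded by blast
  have "?z = (\<Sum>j\<in>UNIV. if j = i then Poly_Mapping.single [i] 1 else 0)"
    unfolding nc_lin_def by (rule sum.cong) auto
  then have z: "?z = Poly_Mapping.single [i] 1" by simp
  have cancel: "x - y + (b - x) = b - y" for x y b :: "'n ncpoly" by simp
  have w: "Poly_Mapping.single (i # u) 1 = ?z * ?w" by (simp add: z mult_single plus_list_def)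
  have "nc_star ?w * (cst (complex_of_real N') - ?z * ?z) * ?w +
      cst (complex_of_real N') * (cst (complex_of_real N) - nc_star ?w * ?w) \<in> sos_cone"
    by (intro sos_cone_add sos_cone_conj sos_cone_scale N N')
  also have "nc_star ?w * (cst (complex_of_real N') - ?z * ?z) * ?w =
      cst (complex_of_real N') * (nc_star ?w * ?w) - nc_star (?z * ?w) * (?z * ?w)"
    by (simp only: left_diff_distrib right_diff_distrib cst_commute[of "nc_star ?w"] nc_star_mult
        nc_star_lin mult.assoc)
  also have "cst (complex_of_real N') * (cst (complex_of_real N) - nc_star ?w * ?w) =
      cst (complex_of_real (N' * N)) - cst (complex_of_real N') * (nc_star ?w * ?w)"
    by (simp only: right_diff_distrib cst_mult of_real_mult)
  also have "cst (complex_of_real N') * (nc_star ?w * ?w) - nc_star (?z * ?w) * (?z * ?w) +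
      (cst (complex_of_real (N' * N)) - cst (complex_of_real N') * (nc_star ?w * ?w)) =
      cst (complex_of_real (N' * N)) - nc_star (?z * ?w) * (?z * ?w)"
    by (rule cancel)
  finally have "cst (complex_of_real (N' * N)) - nc_star (?z * ?w) * (?z * ?w) \<in> sos_cone" .
  moreover have "N' * N \<ge> 0" using N(1) N'(1) by simp
  ultimately show ?case unfolding w by blast
qed

text \<open>For a monomial x, (1 + x)* (1 + x) + x - x* = 1 + 2 x + x* x. The skew part x - x* is in
  the cone by construction, and x* x is bounded as a multiple of a word times its adjoint.\<close>

lemma order_unit: "\<exists>N. cst (complex_of_real N) + x \<in> sos_cone"
proof (induction x rule: poly_mapping_add_induct)
  case zero
  show ?case using J_subset_sos_cone[OF J_zero] by (intro exI[of _ 0]) simp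
next
  case (single u c)
  let ?w = "Poly_Mapping.single u 1 :: 'n ncpoly" and ?x = "Poly_Mapping.single u c :: 'n ncpoly"
  obtain N where N: "cst (complex_of_real N) - nc_star ?w * ?w \<in> sos_cone"
    using word_bounded by blast
  define b where "b = (cmod c)\<^sup>2"
  have "complex_of_real b = cnj c * c"
    unfolding b_def complex_norm_square by (rule mult.commute)
  then have xx: "nc_star ?x * ?x = cst (complex_of_real b) * (nc_star ?w * ?w)"
    by (simp add: mult_single)
  have "nc_star (1 + ?x) * (1 + ?x) + cst (complex_of_real b) * (cst (complex_of_real N) - nc_star ?w * ?w) +
      (?x - nc_star ?x) \<in> sos_cone"
    by (intro sos_cone_add square_in_sos_cone sos_cone_scale N skew_in_sos_cone)
      (auto simp: b_def nc_star_diff)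
  also have "nc_star (1 + ?x) * (1 + ?x) + cst (complex_of_real b) * (cst (complex_of_real N) - nc_star ?w * ?w) +
      (?x - nc_star ?x) = 1 + cst (complex_of_real b) * cst (complex_of_real N) + (?x + ?x)"
    unfolding right_diff_distrib xx[symmetric] nc_star_add ring_distribs
    by (simp del: nc_star_single)
  also have "\<dots> = cst (complex_of_real (1 + b * N)) + (?x + ?x)"
    by (simp add: cst_mult single_add)
  finally have "cst (complex_of_real (1 / 2)) * (cst (complex_of_real (1 + b * N)) + (?x + ?x)) \<in> sos_cone"
    by (rule sos_cone_scale) simp
  also have "cst (complex_of_real (1 / 2)) * (cst (complex_of_real (1 + b * N)) + (?x + ?x)) =
      cst (complex_of_real ((1 + b * N) / 2)) + ?x"
    by (simp add: ring_distribs mult_single add_divide_distrib flip: single_add)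
  finally show ?case by blast
next
  case (add x y)
  then obtain N N' where "cst (complex_of_real N) + x \<in> sos_cone" "cst (complex_of_real N') + y \<in> sos_cone"
    by blast
  then have "(cst (complex_of_real N) + x) + (cst (complex_of_real N') + y) \<in> sos_cone"
    by (rule sos_cone_add)
  then have "cst (complex_of_real (N + N')) + (x + y) \<in> sos_cone"
    by (simp add: single_add algebra_simps)
  then show ?case by blast
qed

text \<open>If -1 is outside the cone, the separating functional is positive on all squares and zero
  on all of J, without any bound on degrees, so it yields an element of \<open>Fset h e k\<close>
  for every k.\<close>

lemma minus_one_in_sos_if_Fset_empty:
  assumes "Fset h e k = {}"
  shows "minus_one_in_sos h e"
proof (rule minus_one_in_sos_if_cone_improper, rule ccontr)
  assume proper: "- 1 \<notin> sos_cone"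
  interpret order_unit_cone "\<lambda>t x. cst (complex_of_real t) * x" 1 sos_cone
  proof unfold_locales
    show "cst (complex_of_real a) * (x + y) = cst (complex_of_real a) * x + cst (complex_of_real a) * y"
      for a and x y :: "'n ncpoly" by (rule distrib_left)
    show "cst (complex_of_real (a + b)) * x = cst (complex_of_real a) * x + cst (complex_of_real b) * x"
      for a b and x :: "'n ncpoly" by (simp add: single_add distrib_right)
    show "cst (complex_of_real a) * (cst (complex_of_real b) * x) = cst (complex_of_real (a * b)) * x"
      for a b and x :: "'n ncpoly" by (simp add: cst_mult flip: mult.assoc)
    show "cst (complex_of_real 1) * x = x" for x :: "'n ncpoly" by simp
    show "\<exists>N. cst (complex_of_real N) * 1 + x \<in> sos_cone" for x using order_unit by simp
  qed (use proper sos_cone_add sos_cone_scale in auto)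
  obtain f where f_add: "\<And>x y. f (x + y) = f x + f y"
    and f_scale: "\<And>t x. f (cst (complex_of_real t) * x) = t * f x"
    and f_one: "f 1 = 1" and f_cone: "\<And>x. x \<in> sos_cone \<Longrightarrow> f x \<ge> 0"
    using positive_functional_exists by blast
  have f_minus: "f (- x) = - f x" for x using f_scale[of "- 1" x] by (simp add: single_uminus)
  \<comment> \<open>Both x and -x lie in the cone; the same argument applies to elements of
    J.\<close>
  have f_skew: "f x = 0" if "nc_star x = - x" for x
    using f_cone[OF skew_in_sos_cone[OF that]] f_cone[OF skew_in_sos_cone[of "- x"]] that
    by (simp add: f_minus nc_star_uminus)
  have f_J: "f x = 0" if "x \<in> J" for x
    using f_cone[OF J_subset_sos_cone[OF that]] f_cone[OF J_subset_sos_cone[OF J_uminus[OF that]]]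
    by (simp add: f_minus)
  have f_star: "f (nc_star x) = f x" for x
  proof -
    have "nc_star (nc_star x + - x) = - (nc_star x + - x)" by (simp add: nc_star_diff)
    from f_skew[OF this] show ?thesis by (simp only: f_add f_minus)
  qed
  \<comment> \<open>The complex-linear functional with real part f: linearity forces its imaginary
    part at x to be minus the value of f at i x.\<close>
  define \<phi> where "\<phi> x = Complex (f x) (- f (cst \<i> * x))" for x
  have "\<phi> \<in> Fset h e k"
    unfolding Fset_def mem_Collect_eq nc_mult_eq nc_one_eq nc_scale_eq hgen_eq
  proof (intro conjI allI impI)
    show "\<phi> (p + q) = \<phi> p + \<phi> q" for p q
      by (simp add: \<phi>_def f_add ring_distribs complex_eq_iff)
    show "\<phi> (cst c * p) = c * \<phi> p" for c p
    proof -
      have c: "cst c * p = cst (complex_of_real (Re c)) * p + cst (complex_of_real (Im c)) * (cst \<i> * p)"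
      proof -
        have "c = complex_of_real (Re c) + complex_of_real (Im c) * \<i>" by (simp add: complex_eq_iff)
        then show ?thesis
          unfolding mult.assoc[symmetric] cst_mult distrib_right[symmetric] single_add[symmetric] by simp
      qed
      have "cst \<i> * (cst c * p) =
          cst (complex_of_real (Re c)) * (cst \<i> * p) + cst (complex_of_real (- Im c)) * p"
      proof -
        have "\<i> * c = complex_of_real (Re c) * \<i> + complex_of_real (- Im c)" by (simp add: complex_eq_iff)
        then show ?thesis
          unfolding mult.assoc[symmetric] cst_mult distrib_right[symmetric] single_add[symmetric]
          by (simp only:)
      qed
      then have "f (cst \<i> * (cst c * p)) = Re c * f (cst \<i> * p) - Im c * f p"
        by (simp only: f_add f_scale)
      moreover have "f (cst c * p) = Re c * f p + Im c * f (cst \<i> * p)"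
        by (subst c) (simp only: f_add f_scale)
      ultimately show ?thesis by (simp add: \<phi>_def complex_eq_iff)
    qed
    have "f (cst \<i>) = 0" by (rule f_skew) (simp add: single_uminus)
    then show "\<phi> 1 = 1" by (simp add: \<phi>_def f_one complex_eq_iff)
    show "\<phi> (nc_star p) = cnj (\<phi> p)" for p
    proof -
      have "cst \<i> * nc_star p = nc_star (- (cst \<i> * p))"
        by (simp add: nc_star_mult nc_star_uminus cst_commute single_uminus)
      then have "f (cst \<i> * nc_star p) = - f (cst \<i> * p)" by (simp only: f_star f_minus)
      then show ?thesis by (simp add: \<phi>_def f_star complex_eq_iff)
    qed
    have "f (cst \<i> * (nc_star p * p)) = 0" for p
      by (rule f_skew) (simp add: nc_star_mult cst_commute single_uminus mult.assoc)
    then show "\<phi> (nc_star p * p) \<in> \<real>" for p by (simp add: \<phi>_def complex_is_Real_iff)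
    show "Re (\<phi> (nc_star p * p)) \<ge> 0" for p by (simp add: \<phi>_def f_cone square_in_sos_cone)
    show "\<phi> (p * nc_subst (g a) (nc_lin a) * q) = 0" for a p q
      by (simp add: \<phi>_def f_J J_hgen J_mult_left complex_eq_iff)
  qed
  then show False using assms by blast
qed

end

theorem theorem5p1:
  fixes h :: "('n::finite \<Rightarrow>\<^sub>0 nat) \<Rightarrow>\<^sub>0 real" and e :: "'n \<Rightarrow> real" and d k :: nat
  assumes "irreducible h"
    and "homogeneous_of_degree h d"
    and "hyperbolic h e"
    and "k = 2 * (d - 1)"
  shows "(Fset h e k \<noteq> {} \<longrightarrow> spectrahedral (Lambda h e)) \<and>
         (Fset h e k = {} \<longrightarrow> minus_one_in_sos h e \<and> (\<forall>r\<ge>1. \<not> definite_det_rep (h ^ r) e))"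
proof -
  have "d > 0" using assms homogeneous_irreducible_degree_pos by blast
  interpret hyperbolic_poly h e d by unfold_locales (use assms \<open>d > 0\<close> in auto)
  have "spectrahedral (Lambda h e)" if "Fset h e k \<noteq> {}"
    using spectrahedral_if_Fset_nonempty[OF assms(1-3)] that assms(4) by blast
  moreover have "minus_one_in_sos h e" if "Fset h e k = {}"
    using minus_one_in_sos_if_Fset_empty that .
  moreover have "\<not> definite_det_rep (h ^ r) e" if "Fset h e k = {}" "r \<ge> 1" for r
    using Fset_nonempty_if_definite_det_rep[OF assms(2) \<open>d > 0\<close>] that by blast
  ultimately show ?thesis by blast
qed

end
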